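(* Let $K\ge2$, $\alpha\ge0$ with $\alpha\ne1$, and $\beta\ge0$. The symmetric generalized degrees of freedom $\mathsf{GDoF}_{sym}$ of the $K$-user symmetric Gaussian interference channel with rate-limited feedback, with $\mathsf{INR}=\mathsf{SNR}^{\alpha}$ and $C_{FB}=\beta\log\mathsf{SNR}$, satisfies $$\mathsf{GDoF}_{sym}\ge\begin{cases}\min\{1-\alpha+\beta,\;1-\frac\alpha2\}, & 0\le\alpha\le\frac12,\\ \min\{\alpha+\beta,\;1-\frac\alpha2\}, & \frac12\le\alpha\le\frac23,\\ 1-\frac\alpha2, & \frac23\le\alpha<1,\\ \frac\alpha2, & 1<\alpha\le2,\\ \min\{1+\beta,\;\frac\alpha2\}, & 2\le\alpha.\end{cases}$$
   Context: $\log$ is to base 2. $K$-user symmetric Gaussian interference channel with rate-limited feedback: there are $K$ transmitters and $K$ receivers; transmitter $i$ has a message $W_i$ for receiver $i$. At time $t$ transmitter $i$ sends $X_i[t]\in\mathbb C$ subject to average power constraint 1, and receiver $i$ observes $$Y_i[t]=\sqrt{\mathsf{SNR}}\,X_i[t]+\sum_{j\ne i}\sqrt{\mathsf{INR}}\,X_j[t]+Z_i[t],$$ with $Z_i[t]\sim\mathcal{CN}(0,1)$ i.i.d. Each receiver $i$ has an error-free feedback link of capacity $C_{FB}$ bits per channel use to transmitter $i$ only; the feedback links are orthogonal to each other and to the data channel, and over a block of length $T$ the sum of the logarithms of the feedback alphabet sizes used on a link is at most $TC_{FB}$. The feedback sent by receiver $i$ at time $t$ is a function of its channel outputs up to time $t-1$,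 and $X_i[t]$ is a function of $W_i$ and of the feedback received until time $t$. Receivers decode at the end of the block of length $T$. A symmetric rate $R$ is achievable if there are schemes with $W_i$ uniform on $\{1,\dots,2^{TR}\}$ such that $\Pr(\hat W_i\ne W_i)\to0$ as $T\to\infty$ for each $i$. The symmetric capacity $C_{sym}$ is the supremum of achievable symmetric rates. For fixed $\alpha,\beta$, $\mathsf{GDoF}_{sym}=\lim_{\mathsf{SNR}\to\infty}\frac{C_{sym}}{\log\mathsf{SNR}}$, where $\mathsf{INR}=\mathsf{SNR}^\alpha$ and $C_{FB}=\beta\log\mathsf{SNR}$; the lower bound is to be read with $\liminf$ in case the limit is not known to exist. *)

theory Defs
  imports "HOL-Probability.Probability"
begin

text \<open>
  Users are numbered \<open>0, \<dots>, K - 1\<close> and the channel uses of a block of length \<open>T\<close> are numbered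
  \<open>0, \<dots>, T - 1\<close>. A history is an extensional function on the set of the relevant times, so that
  an encoder, a feedback map or a decoder has access to nothing beyond the times in that set.
\<close>

record scheme =
  fb_size :: "nat \<Rightarrow> nat \<Rightarrow> nat"  \<comment> \<open>user, time; the alphabet is \<open>{..<fb_size c i t}\<close>\<close>
  fb_map :: "nat \<Rightarrow> nat \<Rightarrow> (nat \<Rightarrow> complex) \<Rightarrow> nat"  \<comment> \<open>user, time, outputs at times \<open>{..<t}\<close>\<close>
  encoder :: "nat \<Rightarrow> nat \<Rightarrow> nat \<Rightarrow> (nat \<Rightarrow> nat) \<Rightarrow> complex"
    \<comment> \<open>user, time, own message, own feedback symbols at times \<open>{..t}\<close>\<close>
  decoder :: "nat \<Rightarrow> (nat \<Rightarrow> complex) \<Rightarrow> nat"  \<comment> \<open>user, outputs at times \<open>{..<T}\<close>\<close>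

definition fb_symbol :: "scheme \<Rightarrow> nat \<Rightarrow> (nat \<Rightarrow> complex) \<Rightarrow> nat \<Rightarrow> nat" where
  "fb_symbol c i y t = fb_map c i t (restrict y {..<t})"

definition encode :: "scheme \<Rightarrow> nat \<Rightarrow> nat \<Rightarrow> (nat \<Rightarrow> complex) \<Rightarrow> nat \<Rightarrow> complex" where
  "encode c i w y t = encoder c i t w (restrict (fb_symbol c i y) {..t})"

text \<open>The causality of \<open>encode\<close>, which makes the recursion below well-founded.\<close>

lemma encode_cong [fundef_cong]:
  assumes "c = c'" "i = i'" "w = w'" "t = t'" "\<And>s. s < t' \<Longrightarrow> y s = y' s"
  shows "encode c i w y t = encode c' i' w' y' t'"
proof -
  have "fb_symbol c i y s = fb_symbol c i y' s" if "s \<le> t'" for s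
    unfolding fb_symbol_def using that assms(5)
    by (intro arg_cong[where f = "fb_map c i s"] restrict_ext) auto
  then have "restrict (fb_symbol c i y) {..t'} = restrict (fb_symbol c i y') {..t'}"
    by (intro restrict_ext) auto
  then show ?thesis
    unfolding encode_def using assms(1-4) by simp
qed

text \<open>
  \<open>W i\<close> is the message of user \<open>i\<close>, \<open>Z (i, t)\<close> the noise at receiver \<open>i\<close> at time \<open>t\<close>.
\<close>

function received ::
  "nat \<Rightarrow> real \<Rightarrow> real \<Rightarrow> scheme \<Rightarrow> (nat \<Rightarrow> nat) \<Rightarrow> (nat \<times> nat \<Rightarrow> complex) \<Rightarrow> nat \<Rightarrow> nat \<Rightarrow> complex"
where
  "received K snr inr c W Z i t =
     complex_of_real (sqrt snr) * encode c i (W i) (\<lambda>s. received K snr inr c W Z i s) t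
     + (\<Sum>j\<in>{..<K} - {i}.
          complex_of_real (sqrt inr) * encode c j (W j) (\<lambda>s. received K snr inr c W Z j s) t)
     + Z (i, t)"
  by pat_completeness auto
termination
  by lexicographic_order

declare received.simps [simp del]

definition transmitted ::
  "nat \<Rightarrow> real \<Rightarrow> real \<Rightarrow> scheme \<Rightarrow> (nat \<Rightarrow> nat) \<Rightarrow> (nat \<times> nat \<Rightarrow> complex) \<Rightarrow> nat \<Rightarrow> nat \<Rightarrow> complex"
where
  "transmitted K snr inr c W Z i t = encode c i (W i) (received K snr inr c W Z i) t"

definition decoded ::
  "nat \<Rightarrow> real \<Rightarrow> real \<Rightarrow> nat \<Rightarrow> scheme \<Rightarrow> (nat \<Rightarrow> nat) \<Rightarrow> (nat \<times> nat \<Rightarrow> complex) \<Rightarrow> nat \<Rightarrow> nat"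
where
  "decoded K snr inr T c W Z i = decoder c i (restrict (received K snr inr c W Z i) {..<T})"

text \<open>The circularly symmetric complex Gaussian distribution \<open>CN(0,1)\<close>.\<close>

definition cgauss :: "complex measure" where
  "cgauss = density lborel (\<lambda>z. ennreal (exp (- (cmod z)\<^sup>2) / pi))"

definition block_measure :: "nat \<Rightarrow> nat \<Rightarrow> nat \<Rightarrow> ((nat \<Rightarrow> nat) \<times> (nat \<times> nat \<Rightarrow> complex)) measure" where
  "block_measure K T M =
     (\<Pi>\<^sub>M i\<in>{..<K}. uniform_count_measure {1..M}) \<Otimes>\<^sub>M (\<Pi>\<^sub>M p\<in>{..<K} \<times> {..<T}. cgauss)"

text \<open>
  The power constraint bounds the time average of the expected power, the expectation being taken
  over the messages and the noise.
\<close>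

definition valid_scheme ::
  "nat \<Rightarrow> real \<Rightarrow> real \<Rightarrow> real \<Rightarrow> nat \<Rightarrow> nat \<Rightarrow> scheme \<Rightarrow> bool"
where
  "valid_scheme K snr inr cfb T M c \<longleftrightarrow>
     (\<forall>i<K.
        (\<forall>t<T. fb_map c i t \<in> (\<Pi>\<^sub>M s\<in>{..<t}. borel) \<rightarrow>\<^sub>M count_space {..<fb_size c i t}) \<and>
        (\<Sum>t<T. log 2 (real (fb_size c i t))) \<le> real T * cfb \<and>
        decoder c i \<in> (\<Pi>\<^sub>M s\<in>{..<T}. borel) \<rightarrow>\<^sub>M count_space UNIV \<and>
        (\<Sum>t<T. \<integral>\<^sup>+ \<omega>. ennreal ((cmod (transmitted K snr inr c (fst \<omega>) (snd \<omega>) i t))\<^sup>2)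
                    \<partial>block_measure K T M) / of_nat T \<le> 1)"

definition error_prob ::
  "nat \<Rightarrow> real \<Rightarrow> real \<Rightarrow> nat \<Rightarrow> nat \<Rightarrow> scheme \<Rightarrow> nat \<Rightarrow> real"
where
  "error_prob K snr inr T M c i =
     measure (block_measure K T M)
       {\<omega> \<in> space (block_measure K T M). decoded K snr inr T c (fst \<omega>) (snd \<omega>) i \<noteq> fst \<omega> i}"

text \<open>The number of messages \<open>2 powr (T * R)\<close> is rounded up to an integer.\<close>

definition num_messages :: "nat \<Rightarrow> real \<Rightarrow> nat" where
  "num_messages T R = nat \<lceil>2 powr (real T * R)\<rceil>"

definition achievable_rate :: "nat \<Rightarrow> real \<Rightarrow> real \<Rightarrow> real \<Rightarrow> real \<Rightarrow> bool" where
  "achievable_rate K snr inr cfb R \<longleftrightarrow>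
     0 \<le> R \<and>
     (\<exists>c. (\<forall>T\<ge>1. valid_scheme K snr inr cfb T (num_messages T R) (c T)) \<and>
          (\<forall>i<K. (\<lambda>T. error_prob K snr inr T (num_messages T R) (c T) i) \<longlonglongrightarrow> 0))"

text \<open>
  Extended reals, so that the supremum is meaningful without a proof that it is finite.
\<close>

definition sym_capacity :: "nat \<Rightarrow> real \<Rightarrow> real \<Rightarrow> real \<Rightarrow> ereal" where
  "sym_capacity K snr inr cfb = (SUP R\<in>{R. achievable_rate K snr inr cfb R}. ereal R)"

text \<open>The limit is not known to exist in general; whenever it does, it is this limit inferior.\<close>

definition gdof_sym :: "nat \<Rightarrow> real \<Rightarrow> real \<Rightarrow> ereal" where
  "gdof_sym K \<alpha> \<beta> =
     Liminf at_top (\<lambda>snr::real.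
       sym_capacity K snr (snr powr \<alpha>) (\<beta> * log 2 snr) / ereal (log 2 snr))"

end

theory Submission
  imports Defs "HOL-Real_Asymp.Real_Asymp"
begin

text \<open>
  Put \<open>P = sqrt SNR\<close> and treat the real and the imaginary part of the channel as two real channels
  \<open>y i = P x i + P\<^sup>\<alpha> (sum of the other x j) + noise\<close>. Gaps that are constant or sublinear in
  \<open>log SNR\<close> are irrelevant for the degrees of freedom, so it suffices to code over two channel uses
  with finitely many messages such that bounded noise, of size \<open>P\<^sup>\<eta>\<close>, causes no error. Such a code
  fails with a small probability per pair of channel uses, and an outer Gilbert-Varshamov code of rate
  close to 1 over these pairs makes the error probability vanish with the block length.

  The inner codes superpose integers at different signal levels. As all interferers have the same gain,
  a receiver sees their levelwise sum only. For \<open>\<alpha> \<le> 2 / 3\<close> and \<open>\<alpha> \<ge> 2\<close> the first use carries an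
  additional digit of size at most \<open>P powr (2 * \<beta>)\<close> per user. Receiver \<open>i\<close> feeds the sum of the digits of
  the other users back, up to a quantity known to its transmitter, so every transmitter learns the sum
  \<open>T\<close> of the digits of all users. In the second use all of them transmit \<open>T\<close>, which is thus known
  interference and resolves the first use. For \<open>2 / 3 < \<alpha> < 2\<close> no feedback is needed: with
  generic real coefficients \<open>g k\<close> the own integers and the sums of the interfering ones can be read off
  from one real number, because the two families enter with the different gains 1 and
  \<open>P powr (- \<bar>1 - \<alpha>\<bar>)\<close>.
\<close>

section \<open>Gaussian noise\<close>

text \<open>At a fixed SNR the inner code keeps a fixed positive failure probability, so repeating
  it is not enough and some outer code is unavoidable. Failures are not local to a user: a wrong
  label at one receiver alters what all receivers see in the second use. The outer code therefore
  treats a pair of uses as lost for everybody as soon as one of its noises is large, and corrects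
  lost pairs by minimum distance, which needs only the number of large noises. The number of users
  does not affect the exponents, since a sum of K digits takes only about K times as many values as
  one digit, a factor absorbed by the guards. The accounting of feedback is as follows. Per pair of
  uses and real dimension a label has at most P powr (2 * \<beta>) values, that is \<beta> * log SNR
  bits, and two dimensions over two uses give just the permitted \<beta> * log SNR per use. A digit
  of size P powr b adds b / 2 to the degrees of freedom, so b = 2 * \<beta> buys a gain of
  \<beta>.\<close>

lemma prob_space_cgauss: "prob_space cgauss"
proof
  \<comment> \<open>Standard deviation 1 / sqrt 2 in each coordinate makes the planar density a
    product of two normal densities.\<close>
  let ?f = "\<lambda>x::real. ennreal (normal_density 0 (1 / sqrt 2) x)"
  have [simp]: "1 / sqrt (2::real) > 0" by simp
  have one: "(\<integral>\<^sup>+x. ?f x \<partial>lborel) = 1"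
    using prob_space.emeasure_space_1[OF prob_space_normal_density[of "1 / sqrt 2" 0]]
    by (simp add: emeasure_density)
  have dens: "normal_density 0 (1 / sqrt 2) x = exp (- x\<^sup>2) / sqrt pi" for x :: real
    by (simp add: normal_density_def power_divide)
  have "emeasure cgauss (space cgauss) = (\<integral>\<^sup>+z. ennreal (exp (- (cmod z)\<^sup>2) / pi) \<partial>lborel)"
    by (simp add: cgauss_def emeasure_density)
  also have "\<dots> = (\<integral>\<^sup>+z. (\<Prod>b\<in>Basis. ?f (z \<bullet> b)) \<partial>(lborel :: complex measure))"
  proof (intro nn_integral_cong)
    fix z :: complex
    have "exp (- (cmod z)\<^sup>2) / pi = (exp (- (Re z)\<^sup>2) / sqrt pi) * (exp (- (Im z)\<^sup>2) / sqrt pi)"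
      by (simp add: cmod_power2 exp_add[symmetric])
    then show "ennreal (exp (- (cmod z)\<^sup>2) / pi) = (\<Prod>b\<in>Basis. ?f (z \<bullet> b))"
      by (simp add: Basis_complex_def dens ennreal_mult[symmetric])
  qed
  also have "\<dots> = 1"
    by (subst nn_integral_lborel_prod) (simp_all add: one)
  finally show "emeasure cgauss (space cgauss) = 1" .
qed

lemma sets_cgauss [measurable_cong, simp]: "sets cgauss = sets borel"
  by (simp add: cgauss_def)

lemma space_cgauss [simp]: "space cgauss = UNIV"
  by (simp add: cgauss_def)

lemma cgauss_tail_tendsto_0:
  "((\<lambda>\<rho>. measure cgauss {z. \<rho> < cmod z}) \<longlongrightarrow> 0) at_top"
proof -
  interpret prob_space cgauss by (rule prob_space_cgauss)
  have "(\<lambda>n::nat. prob {z. real n < cmod z}) \<longlonglongrightarrow> prob (\<Inter>n. {z. real n < cmod z})"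
    by (rule finite_Lim_measure_decseq) (auto simp: decseq_def)
  moreover have "(\<Inter>n::nat. {z. real n < cmod z}) = {}"
    by auto (meson less_le_not_le real_arch_simple)
  ultimately have lim: "(\<lambda>n::nat. prob {z. real n < cmod z}) \<longlonglongrightarrow> 0"
    by simp
  show ?thesis
  proof (rule tendstoI)
    fix e :: real assume "0 < e"
    from tendstoD[OF lim this] obtain n :: nat where n: "prob {z. real n < cmod z} < e"
      by (auto simp: eventually_sequentially)
    show "\<forall>\<^sub>F \<rho> in at_top. dist (prob {z. \<rho> < cmod z}) 0 < e"
      using eventually_ge_at_top[of "real n"]
    proof eventually_elim
      case (elim \<rho>)
      then have "prob {z. \<rho> < cmod z} \<le> prob {z. real n < cmod z}"
        by (intro finite_measure_mono) auto
      then show ?case using n by simp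
    qed
  qed
qed

text \<open>Chernoff bound with weight 2 per large noise: by independence, 2 to the number of large
  noises has mean (1 + p) ^ card I, where p is the tail probability, and Markov's inequality does
  the rest.\<close>

lemma prob_many_large_noises:
  assumes I: "finite I"
  shows "measure (\<Pi>\<^sub>M p\<in>I. cgauss) {Z \<in> space (\<Pi>\<^sub>M p\<in>I. cgauss). d \<le> card {p\<in>I. \<rho> < cmod (Z p)}}
    \<le> (1 + measure cgauss {z. \<rho> < cmod z}) ^ card I / 2 ^ d"
proof -
  let ?\<epsilon> = "measure cgauss {z. \<rho> < cmod z}"
  let ?N = "\<Pi>\<^sub>M p\<in>I. cgauss"
  interpret G: prob_space cgauss by (rule prob_space_cgauss)
  interpret N: prob_space ?N by (intro prob_space_PiM prob_space_cgauss)
  interpret P: product_prob_space "\<lambda>_. cgauss" I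
    by (simp add: product_prob_space_def product_prob_space_axioms_def product_sigma_finite_def
        prob_space_cgauss G.sigma_finite_measure_axioms)
  let ?w = "\<lambda>z. 1 + indicator {z. \<rho> < cmod z} z :: ennreal"
  have [measurable]: "{z. \<rho> < cmod z} \<in> sets cgauss" by simp
  have two': "(2::ennreal) ^ d = ennreal (2 ^ d)"
    by (simp flip: ennreal_power)
  have two: "(2::ennreal) ^ d / 2 ^ d = 1"
    unfolding two' by (simp add: divide_ennreal)
  have w: "(\<Prod>p\<in>I. ?w (Z p)) = 2 ^ card {p\<in>I. \<rho> < cmod (Z p)}" for Z
  proof -
    have "(\<Prod>p\<in>I. ?w (Z p)) = (\<Prod>p\<in>I. if \<rho> < cmod (Z p) then 2 else 1)"
      by (intro prod.cong) (auto simp: indicator_def)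
    also have "\<dots> = (\<Prod>p\<in>{p\<in>I. \<rho> < cmod (Z p)}. 2)"
      using I by (simp add: prod.inter_filter[symmetric])
    finally show ?thesis by simp
  qed
  have "ennreal (measure ?N {Z \<in> space ?N. d \<le> card {p\<in>I. \<rho> < cmod (Z p)}})
      = emeasure ?N {Z \<in> space ?N. d \<le> card {p\<in>I. \<rho> < cmod (Z p)}}"
    by (simp add: N.emeasure_eq_measure)
  also have "\<dots> \<le> emeasure ?N {Z \<in> space ?N. 1 \<le> (1 / 2 ^ d) * (\<Prod>p\<in>I. ?w (Z p))}"
  proof (intro emeasure_mono subsetI)
    fix Z assume "Z \<in> {Z \<in> space ?N. d \<le> card {p\<in>I. \<rho> < cmod (Z p)}}"
    then have Z: "Z \<in> space ?N" "d \<le> card {p\<in>I. \<rho> < cmod (Z p)}" by auto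
    have "(1::ennreal) = (1 / 2 ^ d) * 2 ^ d"
      by (simp add: ennreal_divide_times two)
    also have "\<dots> \<le> (1 / 2 ^ d) * 2 ^ card {p\<in>I. \<rho> < cmod (Z p)}"
      using Z by (intro mult_left_mono power_increasing) auto
    finally show "Z \<in> {Z \<in> space ?N. 1 \<le> (1 / 2 ^ d) * (\<Prod>p\<in>I. ?w (Z p))}"
      using Z w by auto
  qed measurable
  also have "\<dots> = emeasure ?N ({Z \<in> space ?N. 1 \<le> (1 / 2 ^ d) * (\<Prod>p\<in>I. ?w (Z p))} \<inter> space ?N)"
    by (intro arg_cong2[where f = emeasure]) auto
  also have "\<dots> \<le> (1 / 2 ^ d) * (\<integral>\<^sup>+Z. (\<Prod>p\<in>I. ?w (Z p)) * indicator (space ?N) Z \<partial>?N)"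
  proof -
    have "{Z \<in> space ?N. 1 \<le> (1 / 2 ^ d) * (\<Prod>p\<in>I. ?w (Z p))} \<inter> space ?N
      = {Z \<in> space ?N. 1 \<le> (1 / 2 ^ d) * (\<Prod>p\<in>I. ?w (Z p))}" by auto
    then show ?thesis
      by (simp only:) (rule nn_integral_Markov_inequality, auto)
  qed
  also have "(\<integral>\<^sup>+Z. (\<Prod>p\<in>I. ?w (Z p)) * indicator (space ?N) Z \<partial>?N) = (\<integral>\<^sup>+Z. (\<Prod>p\<in>I. ?w (Z p)) \<partial>?N)"
    by (intro nn_integral_cong) auto
  also have "\<dots> = (\<Prod>p\<in>I. \<integral>\<^sup>+z. ?w z \<partial>cgauss)"
    using I by (intro P.product_nn_integral_prod) auto
  also have "(\<integral>\<^sup>+z. ?w z \<partial>cgauss) = ennreal (1 + ?\<epsilon>)"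
    using G.emeasure_space_1 by (simp add: nn_integral_add G.emeasure_eq_measure)
  also have "(1 / 2 ^ d) * (\<Prod>p\<in>I. ennreal (1 + ?\<epsilon>)) = ennreal ((1 + ?\<epsilon>) ^ card I / 2 ^ d)"
  proof -
    have "(1 / 2 ^ d :: ennreal) = ennreal (1 / 2 ^ d)"
      unfolding two' by (simp add: divide_ennreal flip: ennreal_1)
    moreover have "(\<Prod>p\<in>I. ennreal (1 + ?\<epsilon>)) = ennreal ((1 + ?\<epsilon>) ^ card I)"
      by (simp add: ennreal_power del: ennreal_plus)
    ultimately show ?thesis
      by (simp add: ennreal_mult'[symmetric] del: ennreal_plus)
  qed
  finally show ?thesis
    by (subst (asm) ennreal_le_iff) auto
qed

section \<open>Outer codes\<close>

text \<open>Choose the set of disagreeing positions, then the values there. Bounding the number of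
  such sets by 2 ^ n costs one bit per outer symbol, which is negligible because the alphabet grows
  with the SNR.\<close>

lemma card_hamming_ball_le:
  fixes S :: "'a set"
  assumes S: "finite S" "S \<noteq> {}" and x: "x \<in> {..<n} \<rightarrow>\<^sub>E S"
  shows "card {y \<in> {..<n} \<rightarrow>\<^sub>E S. card {s. s < n \<and> x s \<noteq> y s} \<le> D} \<le> 2 ^ n * card S ^ D"
proof -
  have S1: "1 \<le> card S" using S by (simp add: card_gt_0_iff Suc_le_eq)
  let ?F = "\<lambda>A. Pi\<^sub>E {..<n} (\<lambda>s. if s \<in> A then S else {x s})"
  let ?I = "{A \<in> Pow {..<n}. card A \<le> D}"
  have fin: "finite (?F A)" for A
    by (rule finite_PiE) (use S(1) in simp_all)
  have card_F: "card (?F A) \<le> card S ^ D" if "A \<in> ?I" for A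
  proof -
    have "card (?F A) = (\<Prod>s<n. if s \<in> A then card S else 1)"
      by (subst card_PiE) (auto intro!: prod.cong)
    also have "\<dots> = (\<Prod>s\<in>{..<n} \<inter> A. card S)"
      by (subst prod.inter_restrict) auto
    also have "\<dots> = card S ^ card A"
      using that by (simp add: Int_absorb1)
    also have "\<dots> \<le> card S ^ D"
      using that S1 by (intro power_increasing) auto
    finally show ?thesis .
  qed
  have "{y \<in> {..<n} \<rightarrow>\<^sub>E S. card {s. s < n \<and> x s \<noteq> y s} \<le> D} \<subseteq> (\<Union>A\<in>?I. ?F A)"
  proof
    fix y assume y: "y \<in> {y \<in> {..<n} \<rightarrow>\<^sub>E S. card {s. s < n \<and> x s \<noteq> y s} \<le> D}"
    then have "{s. s < n \<and> x s \<noteq> y s} \<in> ?I" by auto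
    moreover have "y \<in> ?F {s. s < n \<and> x s \<noteq> y s}"
    proof (rule PiE_I)
      fix s assume "s \<in> {..<n}"
      moreover from this have "y s \<in> S" using y by blast
      ultimately show "y s \<in> (if s \<in> {s. s < n \<and> x s \<noteq> y s} then S else {x s})" by simp
    qed (use y in blast)
    ultimately show "y \<in> (\<Union>A\<in>?I. ?F A)" by blast
  qed
  then have "card {y \<in> {..<n} \<rightarrow>\<^sub>E S. card {s. s < n \<and> x s \<noteq> y s} \<le> D} \<le> card (\<Union>A\<in>?I. ?F A)"
    by (intro card_mono) (use fin in auto)
  also have "\<dots> \<le> (\<Sum>A\<in>?I. card (?F A))"
    by (intro card_UN_le) auto
  also have "\<dots> \<le> (\<Sum>A\<in>?I. card S ^ D)"
    by (intro sum_mono card_F)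
  also have "\<dots> = card ?I * card S ^ D" by simp
  also have "\<dots> \<le> 2 ^ n * card S ^ D"
  proof -
    have "card ?I \<le> card (Pow {..<n})" by (intro card_mono) auto
    then show ?thesis by (intro mult_right_mono) (auto simp: card_Pow)
  qed
  finally show ?thesis .
qed

text \<open>Greedy choice: while the balls of radius D around the chosen words are too small to
  cover all words, an uncovered word can be added.\<close>

lemma gilbert_varshamov_set:
  fixes S :: "'a set"
  assumes S: "finite S" "S \<noteq> {}" and "M * (2 ^ n * card S ^ D) \<le> card S ^ n"
  shows "\<exists>C \<subseteq> {..<n} \<rightarrow>\<^sub>E S. card C = M \<and>
    (\<forall>x\<in>C. \<forall>y\<in>C. x \<noteq> y \<longrightarrow> D < card {s. s < n \<and> x s \<noteq> y s})"
  using assms(3)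
proof (induction M)
  case 0
  show ?case by (intro exI[of _ "{}"]) auto
next
  case (Suc M)
  let ?W = "{..<n} \<rightarrow>\<^sub>E S"
  let ?B = "\<lambda>x. {y \<in> ?W. card {s. s < n \<and> x s \<noteq> y s} \<le> D}"
  from Suc obtain C where C: "C \<subseteq> ?W" "card C = M"
    "\<And>x y. x \<in> C \<Longrightarrow> y \<in> C \<Longrightarrow> x \<noteq> y \<Longrightarrow> D < card {s. s < n \<and> x s \<noteq> y s}"
    by fastforce
  have finW: "finite ?W" using S by (intro finite_PiE) auto
  have finC: "finite C" using C(1) finW by (rule finite_subset)
  show ?case
  proof (cases "?W \<subseteq> (\<Union>x\<in>C. ?B x)")
    case False
    then obtain z where z: "z \<in> ?W" "\<And>x. x \<in> C \<Longrightarrow> D < card {s. s < n \<and> x s \<noteq> z s}"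
      by fastforce
    have "z \<notin> C" using z(2) by fastforce
    moreover have "D < card {s. s < n \<and> z s \<noteq> x s}" if "x \<in> C" for x
      using z(2)[OF that] by (simp add: eq_commute)
    ultimately show ?thesis
      using C z finC by (intro exI[of _ "insert z C"]) auto
  next
    case True
    have "card S ^ n = card ?W" by (simp add: card_PiE)
    also have "\<dots> \<le> card (\<Union>x\<in>C. ?B x)"
      using True finW finC by (intro card_mono) auto
    also have "\<dots> \<le> (\<Sum>x\<in>C. card (?B x))"
      by (intro card_UN_le finC)
    also have "\<dots> \<le> (\<Sum>x\<in>C. 2 ^ n * card S ^ D)"
      using C(1) by (intro sum_mono card_hamming_ball_le S) auto
    also have "\<dots> = M * (2 ^ n * card S ^ D)" using C(2) by simp
    finally have "Suc M * (2 ^ n * card S ^ D) \<le> M * (2 ^ n * card S ^ D)"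
      using Suc.prems by linarith
    moreover have "0 < 2 ^ n * card S ^ D" using S by (simp add: card_gt_0_iff)
    ultimately show ?thesis by simp
  qed
qed

text \<open>The distance claim is conditional because a valid scheme is required for every block
  length, including the short ones for which the counting condition fails.\<close>

lemma gilbert_varshamov:
  fixes S :: "'a set"
  assumes S: "finite S" "S \<noteq> {}"
  shows "\<exists>cw :: nat \<Rightarrow> nat \<Rightarrow> 'a. (\<forall>w s. cw w s \<in> S) \<and>
    (M * (2 ^ n * card S ^ D) \<le> card S ^ n \<longrightarrow>
      (\<forall>w\<in>{1..M}. \<forall>w'\<in>{1..M}. w \<noteq> w' \<longrightarrow> D < card {s. s < n \<and> cw w s \<noteq> cw w' s}))"
proof (cases "M * (2 ^ n * card S ^ D) \<le> card S ^ n")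
  case False
  moreover obtain x0 where "x0 \<in> S" using S by auto
  ultimately show ?thesis by (intro exI[of _ "\<lambda>_ _. x0"]) blast
next
  case True
  from gilbert_varshamov_set[OF S this] obtain C where C: "C \<subseteq> {..<n} \<rightarrow>\<^sub>E S" "card C = M"
    "\<And>x y. x \<in> C \<Longrightarrow> y \<in> C \<Longrightarrow> x \<noteq> y \<Longrightarrow> D < card {s. s < n \<and> x s \<noteq> y s}"
    by blast
  have "finite C" using C(1) S by (meson finite_PiE finite_lessThan finite_subset)
  then obtain h where h: "bij_betw h {1..M} C"
    using C(2) by (metis ex_bij_betw_nat_finite_1)
  obtain x0 where x0: "x0 \<in> S" using S by auto
  \<comment> \<open>The default makes words of nonexistent messages consist of symbols in S as well,
    so that the power bound needs no side condition on the message.\<close>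
  define cw where "cw = (\<lambda>w s. if w \<in> {1..M} \<and> s < n then h w s else x0)"
  have hC: "h w \<in> C" if "w \<in> {1..M}" for w using h that by (auto simp: bij_betw_def)
  have "cw w s \<in> S" for w s
  proof (cases "w \<in> {1..M} \<and> s < n")
    case True
    then have "h w \<in> {..<n} \<rightarrow>\<^sub>E S" using C(1) hC[of w] by blast
    then have "h w s \<in> S" using True by (simp add: PiE_iff)
    with True show ?thesis by (simp add: cw_def)
  next
    case False
    then have "cw w s = x0" unfolding cw_def by (rule if_not_P)
    then show ?thesis using x0 by simp
  qed
  moreover have "D < card {s. s < n \<and> cw w s \<noteq> cw w' s}"
    if "w \<in> {1..M}" "w' \<in> {1..M}" "w \<noteq> w'" for w w'
  proof -
    have "h w \<noteq> h w'" using h that unfolding bij_betw_def inj_on_def by blast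
    then have "D < card {s. s < n \<and> h w s \<noteq> h w' s}" using C(3) hC that by blast
    also have "{s. s < n \<and> h w s \<noteq> h w' s} = {s. s < n \<and> cw w s \<noteq> cw w' s}"
      using that by (intro Collect_cong) (simp add: cw_def)
    finally show ?thesis .
  qed
  ultimately show ?thesis by (intro exI[of _ cw] conjI allI impI ballI)
qed

section \<open>From two-slot codes to block schemes\<close>

lemma prob_space_block_measure:
  assumes "1 \<le> M"
  shows "prob_space (block_measure K T M)"
  unfolding block_measure_def
  using assms by (intro prob_space_pair prob_space_PiM prob_space_cgauss prob_space_uniform_count_measure) auto

lemma measure_block_measure_noise:
  assumes M: "1 \<le> M" and B: "{Z \<in> space (\<Pi>\<^sub>M p\<in>{..<K} \<times> {..<T}. cgauss). P Z} \<in> sets (\<Pi>\<^sub>M p\<in>{..<K} \<times> {..<T}. cgauss)"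
  shows "{\<omega> \<in> space (block_measure K T M). P (snd \<omega>)} \<in> sets (block_measure K T M)"
    and "measure (block_measure K T M) {\<omega> \<in> space (block_measure K T M). P (snd \<omega>)}
      = measure (\<Pi>\<^sub>M p\<in>{..<K} \<times> {..<T}. cgauss) {Z \<in> space (\<Pi>\<^sub>M p\<in>{..<K} \<times> {..<T}. cgauss). P Z}"
proof -
  let ?A = "\<Pi>\<^sub>M i\<in>{..<K}. uniform_count_measure {1..M}"
  let ?B = "\<Pi>\<^sub>M p\<in>{..<K} \<times> {..<T}. cgauss"
  interpret A: prob_space ?A
    using M by (intro prob_space_PiM prob_space_uniform_count_measure) auto
  interpret B: prob_space ?B by (intro prob_space_PiM prob_space_cgauss)
  have eq: "{\<omega> \<in> space (block_measure K T M). P (snd \<omega>)} = space ?A \<times> {Z \<in> space ?B. P Z}"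
    by (auto simp: block_measure_def space_pair_measure)
  show "{\<omega> \<in> space (block_measure K T M). P (snd \<omega>)} \<in> sets (block_measure K T M)"
    unfolding eq unfolding block_measure_def using B by (intro pair_measureI) auto
  show "measure (block_measure K T M) {\<omega> \<in> space (block_measure K T M). P (snd \<omega>)} = measure ?B {Z \<in> space ?B. P Z}"
    unfolding eq unfolding block_measure_def measure_def
    using B by (simp add: B.emeasure_pair_measure_Times A.emeasure_space_1 del: One_nat_def)
qed

definition obs1 ::
  "nat \<Rightarrow> real \<Rightarrow> real \<Rightarrow> ('m \<Rightarrow> real) \<Rightarrow> (nat \<Rightarrow> 'm) \<Rightarrow> nat \<Rightarrow> real"
where
  "obs1 K snr inr e1 \<mu> i =
     sqrt snr * e1 (\<mu> i) + (\<Sum>j\<in>{..<K} - {i}. sqrt inr * e1 (\<mu> j))"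

text \<open>Every transmitter uses the true label \<open>f j \<mu>\<close> here, so this is the
  noiseless second output only if all K labels have been extracted correctly.\<close>

definition obs2 ::
  "nat \<Rightarrow> real \<Rightarrow> real \<Rightarrow> ('m \<Rightarrow> nat \<Rightarrow> real) \<Rightarrow> (nat \<Rightarrow> (nat \<Rightarrow> 'm) \<Rightarrow> nat) \<Rightarrow> (nat \<Rightarrow> 'm) \<Rightarrow> nat \<Rightarrow> real"
where
  "obs2 K snr inr e2 f \<mu> i =
     sqrt snr * e2 (\<mu> i) (f i \<mu>) + (\<Sum>j\<in>{..<K} - {i}. sqrt inr * e2 (\<mu> j) (f j \<mu>))"

text \<open>
  A code for one real dimension: \<open>e1\<close> maps the own message to the first transmitted symbol, \<open>f i \<mu>\<close> is
  the feedback label that receiver \<open>i\<close> extracts from its first output if the users' messages are \<open>\<mu>\<close>,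
  and \<open>e2\<close> maps the own message and label to the second symbol. Noise of size at most \<open>\<rho>\<close> does no harm
  as noiseless outputs that must be distinguished are more than \<open>2 * \<rho>\<close> apart.
\<close>

locale two_slot_code =
  fixes K :: nat and snr inr \<rho> :: real and S :: "'m set" and F :: nat
    and e1 :: "'m \<Rightarrow> real" and f :: "nat \<Rightarrow> (nat \<Rightarrow> 'm) \<Rightarrow> nat" and e2 :: "'m \<Rightarrow> nat \<Rightarrow> real"
  assumes finite_S: "finite S" and S_nonempty: "S \<noteq> {}" and F_pos: "0 < F"
    and e1_le: "m \<in> S \<Longrightarrow> \<bar>e1 m\<bar> \<le> 1 / 2"
    and e2_le: "m \<in> S \<Longrightarrow> l < F \<Longrightarrow> \<bar>e2 m l\<bar> \<le> 1 / 2"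
    and f_less: "\<mu> \<in> {..<K} \<rightarrow>\<^sub>E S \<Longrightarrow> i < K \<Longrightarrow> f i \<mu> < F"
    and separated1: "\<mu> \<in> {..<K} \<rightarrow>\<^sub>E S \<Longrightarrow> \<mu>' \<in> {..<K} \<rightarrow>\<^sub>E S \<Longrightarrow> i < K \<Longrightarrow>
      \<bar>obs1 K snr inr e1 \<mu> i - obs1 K snr inr e1 \<mu>' i\<bar> \<le> 2 * \<rho> \<Longrightarrow> f i \<mu> = f i \<mu>'"
    and separated2: "\<mu> \<in> {..<K} \<rightarrow>\<^sub>E S \<Longrightarrow> \<mu>' \<in> {..<K} \<rightarrow>\<^sub>E S \<Longrightarrow> i < K \<Longrightarrow>
      \<bar>obs1 K snr inr e1 \<mu> i - obs1 K snr inr e1 \<mu>' i\<bar> \<le> 2 * \<rho> \<Longrightarrow>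
      \<bar>obs2 K snr inr e2 f \<mu> i - obs2 K snr inr e2 f \<mu>' i\<bar> \<le> 2 * \<rho> \<Longrightarrow> \<mu> i = \<mu>' i"
begin

abbreviation tuples :: "(nat \<Rightarrow> 'm) set" where "tuples \<equiv> {..<K} \<rightarrow>\<^sub>E S"
abbreviation "o1 \<equiv> obs1 K snr inr e1"
abbreviation "o2 \<equiv> obs2 K snr inr e2 f"

section \<open>Labels, symbol tests and the block scheme\<close>

lemma finite_tuples: "finite tuples"
  using finite_S by (intro finite_PiE) auto

text \<open>By \<open>separated1\<close> at most one label explains y. LEAST makes the choice
  measurable, and the guard keeps the value inside the feedback alphabet when no tuple explains
  y.\<close>

definition label :: "nat \<Rightarrow> real \<Rightarrow> nat" where
  "label i y = (let l = LEAST l. \<exists>\<mu>\<in>tuples. f i \<mu> = l \<and> \<bar>y - o1 \<mu> i\<bar> \<le> \<rho> in if l < F then l else 0)"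

lemma label_less: "label i y < F"
  using F_pos by (simp add: label_def Let_def)

lemma measurable_label [measurable]: "label i \<in> borel \<rightarrow>\<^sub>M count_space UNIV"
proof -
  have [measurable]: "Measurable.pred borel (\<lambda>y. \<exists>\<mu>\<in>tuples. f i \<mu> = l \<and> \<bar>y - o1 \<mu> i\<bar> \<le> \<rho>)" for l
    by (intro pred_intros_finite finite_tuples) measurable
  show ?thesis unfolding label_def Let_def by measurable
qed

text \<open>Two tuples within \<rho> of the same output have noiseless outputs at most 2 * \<rho>
  apart, so \<open>separated1\<close> forces their labels to agree. The same argument with
  \<open>separated2\<close> gives \<open>fits_iff\<close>.\<close>

lemma label_eq:
  assumes "\<mu> \<in> tuples" "i < K" "\<bar>y - o1 \<mu> i\<bar> \<le> \<rho>"
  shows "label i y = f i \<mu>"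
proof -
  have "(\<exists>\<mu>\<in>tuples. f i \<mu> = l \<and> \<bar>y - o1 \<mu> i\<bar> \<le> \<rho>) \<longleftrightarrow> l = f i \<mu>" for l
  proof
    assume "\<exists>\<mu>\<in>tuples. f i \<mu> = l \<and> \<bar>y - o1 \<mu> i\<bar> \<le> \<rho>"
    then obtain \<mu>' where \<mu>': "\<mu>' \<in> tuples" "f i \<mu>' = l" "\<bar>y - o1 \<mu>' i\<bar> \<le> \<rho>" by blast
    have "\<bar>o1 \<mu>' i - o1 \<mu> i\<bar> \<le> 2 * \<rho>" using \<mu>'(3) assms(3) by linarith
    then show "l = f i \<mu>" using separated1 \<mu>' assms by blast
  qed (use assms in blast)
  moreover have "(LEAST l. l = f i \<mu>) = f i \<mu>" by (rule Least_equality) auto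
  ultimately show ?thesis using f_less[OF assms(1,2)] by (simp add: label_def Let_def)
qed

definition fits :: "nat \<Rightarrow> 'm \<Rightarrow> real \<Rightarrow> real \<Rightarrow> bool" where
  "fits i m y1 y2 \<longleftrightarrow> (\<exists>\<mu>\<in>tuples. \<mu> i = m \<and> \<bar>y1 - o1 \<mu> i\<bar> \<le> \<rho> \<and> \<bar>y2 - o2 \<mu> i\<bar> \<le> \<rho>)"

lemma fits_iff:
  assumes "\<mu> \<in> tuples" "i < K" "\<bar>y1 - o1 \<mu> i\<bar> \<le> \<rho>" "\<bar>y2 - o2 \<mu> i\<bar> \<le> \<rho>"
  shows "fits i m y1 y2 \<longleftrightarrow> m = \<mu> i"
proof
  assume "fits i m y1 y2"
  then obtain \<mu>' where \<mu>': "\<mu>' \<in> tuples" "\<mu>' i = m" "\<bar>y1 - o1 \<mu>' i\<bar> \<le> \<rho>" "\<bar>y2 - o2 \<mu>' i\<bar> \<le> \<rho>"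
    unfolding fits_def by blast
  have "\<bar>o1 \<mu>' i - o1 \<mu> i\<bar> \<le> 2 * \<rho>" "\<bar>o2 \<mu>' i - o2 \<mu> i\<bar> \<le> 2 * \<rho>"
    using \<mu>'(3,4) assms(3,4) by linarith+
  then show "m = \<mu> i" using separated2 \<mu>' assms by blast
qed (use assms in \<open>auto simp: fits_def\<close>)

lemma measurable_fits [measurable (raw)]:
  assumes [measurable]: "g1 \<in> borel_measurable N" "g2 \<in> borel_measurable N"
  shows "Measurable.pred N (\<lambda>x. fits i m (g1 x) (g2 x))"
  unfolding fits_def by (intro pred_intros_finite finite_tuples) measurable

definition sym_fits :: "nat \<Rightarrow> 'm \<times> 'm \<Rightarrow> complex \<Rightarrow> complex \<Rightarrow> bool" where
  "sym_fits i m a b \<longleftrightarrow> fits i (fst m) (Re a) (Re b) \<and> fits i (snd m) (Im a) (Im b)"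

text \<open>
  The real and the imaginary part use the code independently, with the labels paired up as
  \<open>l + F * l'\<close>. The decoder looks for the codeword that is inconsistent with few symbols; it never
  needs a hard decision on a symbol.
\<close>

definition block_scheme :: "(nat \<Rightarrow> nat \<Rightarrow> 'm \<times> 'm) \<Rightarrow> nat \<Rightarrow> nat \<Rightarrow> nat \<Rightarrow> scheme" where
  "block_scheme cw M n d =
    \<lparr>fb_size = \<lambda>i t. if odd t then F * F else 1,
     fb_map = \<lambda>i t y. if odd t then label i (Re (y (t - 1))) + F * label i (Im (y (t - 1))) else 0,
     encoder = \<lambda>i t w g.
       if even t then Complex (e1 (fst (cw w (t div 2)))) (e1 (snd (cw w (t div 2))))
       else Complex (e2 (fst (cw w (t div 2))) (g t mod F)) (e2 (snd (cw w (t div 2))) (g t div F)),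
     decoder = \<lambda>i y. LEAST w. w \<in> {1..M} \<and>
       card {s. s < n \<and> \<not> sym_fits i (cw w s) (y (2 * s)) (y (2 * s + 1))} \<le> d\<rparr>"

lemma pair_label_less: "label i x + F * label i y < F * F"
proof -
  have "label i x + F * label i y < F + F * label i y" using label_less by simp
  also have "\<dots> = F * Suc (label i y)" by simp
  also have "\<dots> \<le> F * F" using label_less[of i y] by (intro mult_left_mono) auto
  finally show ?thesis .
qed

lemma encode_block_scheme:
  "encode (block_scheme cw M n d) i w y t =
    (if even t then Complex (e1 (fst (cw w (t div 2)))) (e1 (snd (cw w (t div 2))))
     else Complex (e2 (fst (cw w (t div 2))) (label i (Re (y (t - 1)))))
                  (e2 (snd (cw w (t div 2))) (label i (Im (y (t - 1))))))"
proof (cases "even t")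
  case False
  then have "t - 1 < t" by (cases t) auto
  then have "fb_symbol (block_scheme cw M n d) i y t = label i (Re (y (t - 1))) + F * label i (Im (y (t - 1)))"
    using False by (simp add: fb_symbol_def block_scheme_def)
  then show ?thesis using False label_less F_pos
    by (simp add: encode_def block_scheme_def)
qed (simp add: encode_def block_scheme_def)

lemma valid_block_scheme:
  assumes cw: "\<And>w s. cw w s \<in> S \<times> S" and T: "1 \<le> T" and M: "1 \<le> M"
    and F: "log 2 (real F) \<le> cfb" and n: "2 * n \<le> T"
  shows "valid_scheme K snr inr cfb T M (block_scheme cw M n d)"
  unfolding valid_scheme_def
proof (intro allI impI conjI)
  fix i assume i: "i < K"
  show "fb_map (block_scheme cw M n d) i t \<in> (\<Pi>\<^sub>M s\<in>{..<t}. borel) \<rightarrow>\<^sub>M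
      count_space {..<fb_size (block_scheme cw M n d) i t}" for t
  proof -
    have "fb_map (block_scheme cw M n d) i t \<in> (\<Pi>\<^sub>M s\<in>{..<t}. borel) \<rightarrow>\<^sub>M count_space UNIV"
    proof (cases "odd t")
      case True
      then have "0 < t" by (rule odd_pos)
      then have "t - 1 \<in> {..<t}" by simp
      then have [measurable]: "(\<lambda>y. y (t - 1)) \<in> (\<Pi>\<^sub>M s\<in>{..<t}. (borel :: complex measure)) \<rightarrow>\<^sub>M borel"
        by (rule measurable_component_singleton)
      have "(\<lambda>y. label i (Re (y (t - 1))) + F * label i (Im (y (t - 1))))
        \<in> (\<Pi>\<^sub>M s\<in>{..<t}. (borel :: complex measure)) \<rightarrow>\<^sub>M count_space UNIV"
        by measurable
      then show ?thesis using True by (simp add: block_scheme_def)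
    qed (simp add: block_scheme_def)
    moreover have "fb_map (block_scheme cw M n d) i t y < fb_size (block_scheme cw M n d) i t" for y
      using pair_label_less by (simp add: block_scheme_def)
    ultimately show ?thesis
      by (auto simp: measurable_count_space_eq2_countable measurable_def)
  qed
  have "0 \<le> log 2 (real F)" using F_pos by simp
  have "(\<Sum>t<T. log 2 (real (fb_size (block_scheme cw M n d) i t)))
      = (\<Sum>t<T. if odd t then 2 * log 2 (real F) else 0)"
    using F_pos by (intro sum.cong) (auto simp: block_scheme_def log_mult)
  \<comment> \<open>Only odd times cost feedback, and at most T / 2 of the times below T are odd;
    hence the induction in steps of two.\<close>
  also have "\<dots> \<le> real T * log 2 (real F)"
  proof (induction T rule: induct_nat_012)
    case (ge2 k)
    then show ?case by (simp add: algebra_simps)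
  qed (use \<open>0 \<le> log 2 (real F)\<close> in auto)
  also have "\<dots> \<le> real T * cfb" using F by (intro mult_left_mono) auto
  finally show "(\<Sum>t<T. log 2 (real (fb_size (block_scheme cw M n d) i t))) \<le> real T * cfb" .
  show "decoder (block_scheme cw M n d) i \<in> (\<Pi>\<^sub>M s\<in>{..<T}. borel) \<rightarrow>\<^sub>M count_space UNIV"
  proof -
    let ?N = "\<Pi>\<^sub>M s\<in>{..<T}. (borel :: complex measure)"
    define E where "E = (\<lambda>w y. card {s. s < n \<and> \<not> sym_fits i (cw w s) (y (2 * s)) (y (2 * s + 1))})"
    have "Measurable.pred ?N (\<lambda>y. s < n \<and> \<not> sym_fits i (cw w s) (y (2 * s)) (y (2 * s + 1)))" for w s
    proof (cases "s < n")
      case True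
      then have "2 * s \<in> {..<T}" and "2 * s + 1 \<in> {..<T}" using n by auto
      from this[THEN measurable_component_singleton]
      have "(\<lambda>y. y (2 * s)) \<in> ?N \<rightarrow>\<^sub>M borel" and "(\<lambda>y. y (2 * s + 1)) \<in> ?N \<rightarrow>\<^sub>M borel"
        by simp_all
      have "Measurable.pred ?N (\<lambda>y. fits i (fst (cw w s)) (Re (y (2 * s))) (Re (y (2 * s + 1))))"
        "Measurable.pred ?N (\<lambda>y. fits i (snd (cw w s)) (Im (y (2 * s))) (Im (y (2 * s + 1))))"
        by (intro measurable_fits measurable_compose[OF _ borel_measurable_Re] measurable_compose[OF _ borel_measurable_Im]; fact)+
      then show ?thesis unfolding sym_fits_def
        by (simp only: True simp_thms pred_intros_logic)
    qed simp
    then have E [measurable]: "E w \<in> ?N \<rightarrow>\<^sub>M count_space UNIV" for w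
      unfolding E_def by (intro measurable_card) (simp only: mem_Collect_eq predE)
    have "decoder (block_scheme cw M n d) i = (\<lambda>y. LEAST w. w \<in> {1..M} \<and> E w y \<le> d)"
      by (simp add: block_scheme_def E_def)
    also have "\<dots> \<in> ?N \<rightarrow>\<^sub>M count_space UNIV" by measurable
    finally show ?thesis .
  qed
  show "(\<Sum>t<T. \<integral>\<^sup>+ \<omega>. ennreal ((cmod (transmitted K snr inr (block_scheme cw M n d) (fst \<omega>) (snd \<omega>) i t))\<^sup>2)
      \<partial>block_measure K T M) / of_nat T \<le> 1"
  proof -
    interpret prob_space "block_measure K T M" using M by (rule prob_space_block_measure)
    have "(\<integral>\<^sup>+ \<omega>. ennreal ((cmod (transmitted K snr inr (block_scheme cw M n d) (fst \<omega>) (snd \<omega>) i t))\<^sup>2)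
      \<partial>block_measure K T M) \<le> (\<integral>\<^sup>+ \<omega>. 1 \<partial>block_measure K T M)" for t
    proof (intro nn_integral_mono)
      fix \<omega>
      have sq: "x\<^sup>2 \<le> (1 / 2)\<^sup>2" if "\<bar>x\<bar> \<le> 1 / 2" for x :: real
        using power_mono[OF that, of 2] by simp
      \<comment> \<open>Coordinates of size at most 1 / 2 satisfy the power constraint pointwise,
        not only on average.\<close>
      have le: "(cmod (Complex a b))\<^sup>2 \<le> 1" if "\<bar>a\<bar> \<le> 1 / 2" "\<bar>b\<bar> \<le> 1 / 2" for a b
        using sq[OF that(1)] sq[OF that(2)] unfolding cmod_power2 by (simp add: power2_eq_square)
      have "fst (cw w s) \<in> S" "snd (cw w s) \<in> S" for w s
        using cw[of w s] by auto
      then have "(cmod (transmitted K snr inr (block_scheme cw M n d) (fst \<omega>) (snd \<omega>) i t))\<^sup>2 \<le> 1"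
        unfolding transmitted_def encode_block_scheme
        by (cases "even t") (simp_all only: if_True if_False le e1_le e2_le label_less)
      then show "ennreal ((cmod (transmitted K snr inr (block_scheme cw M n d) (fst \<omega>) (snd \<omega>) i t))\<^sup>2) \<le> 1"
        by simp
    qed
    then have "(\<Sum>t<T. \<integral>\<^sup>+ \<omega>. ennreal ((cmod (transmitted K snr inr (block_scheme cw M n d) (fst \<omega>) (snd \<omega>) i t))\<^sup>2)
      \<partial>block_measure K T M) \<le> (\<Sum>t<T. 1)"
      by (intro sum_mono) (simp add: emeasure_space_1)
    then show ?thesis using T
      by (simp add: divide_le_posI_ennreal)
  qed
qed

text \<open>The labels of all users steer the interference in the second use. So the first-use noise
  has to be small at every receiver, although the test concerns receiver i only.\<close>

lemma sym_fits_received: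
  assumes cw: "\<And>w s. cw w s \<in> S \<times> S" and i: "i < K"
    and Z: "\<And>j. j < K \<Longrightarrow> cmod (Z (j, 2 * s)) \<le> \<rho>" "\<And>j. j < K \<Longrightarrow> cmod (Z (j, 2 * s + 1)) \<le> \<rho>"
    and y_def: "y = received K snr inr (block_scheme cw M n d) W Z"
  shows "sym_fits i m (y i (2 * s)) (y i (2 * s + 1)) \<longleftrightarrow> m = cw (W i) s"
proof -
  define \<mu> where "\<mu> = (\<lambda>j\<in>{..<K}. fst (cw (W j) s))"
  define \<nu> where "\<nu> = (\<lambda>j\<in>{..<K}. snd (cw (W j) s))"
  have "fst (cw w s) \<in> S" "snd (cw w s) \<in> S" for w
    using cw[of w s] by auto
  then have tup: "\<mu> \<in> tuples" "\<nu> \<in> tuples" by (auto simp: \<mu>_def \<nu>_def)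
  have y1: "y j (2 * s) = Complex (o1 \<mu> j) (o1 \<nu> j) + Z (j, 2 * s)" if "j < K" for j
    unfolding y_def using that
    by (subst received.simps) (simp add: encode_block_scheme complex_eq_iff obs1_def \<mu>_def \<nu>_def)
  have l: "label j (Re (y j (2 * s))) = f j \<mu>" "label j (Im (y j (2 * s))) = f j \<nu>" if "j < K" for j
    using Z(1)[OF that] abs_Re_le_cmod[of "Z (j, 2 * s)"] abs_Im_le_cmod[of "Z (j, 2 * s)"] y1[OF that]
    by (auto intro!: label_eq tup that)
  have y2: "y j (2 * s + 1) = Complex (o2 \<mu> j) (o2 \<nu> j) + Z (j, 2 * s + 1)" if "j < K" for j
    using that l unfolding y_def
    by (subst received.simps) (simp add: encode_block_scheme complex_eq_iff obs2_def \<mu>_def \<nu>_def)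
  have "fits i m' (Re (y i (2 * s))) (Re (y i (2 * s + 1))) \<longleftrightarrow> m' = \<mu> i" for m'
    using Z(1)[OF i] Z(2)[OF i] abs_Re_le_cmod[of "Z (i, 2 * s)"] abs_Re_le_cmod[of "Z (i, 2 * s + 1)"] y1[OF i] y2[OF i]
    by (intro fits_iff tup i) auto
  moreover have "fits i m' (Im (y i (2 * s))) (Im (y i (2 * s + 1))) \<longleftrightarrow> m' = \<nu> i" for m'
    using Z(1)[OF i] Z(2)[OF i] abs_Im_le_cmod[of "Z (i, 2 * s)"] abs_Im_le_cmod[of "Z (i, 2 * s + 1)"] y1[OF i] y2[OF i]
    by (intro fits_iff tup i) auto
  ultimately show ?thesis
    using i by (auto simp: sym_fits_def \<mu>_def \<nu>_def prod_eq_iff)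
qed

text \<open>At a pair without large noise exactly the true symbol passes the test; at the at most d
  other pairs nothing is known. The true word thus fails at most d tests, whereas a wrong word
  differs from it at more than 2 * d pairs and fails at more than d of them.\<close>

lemma decoded_block_scheme:
  assumes cw: "\<And>w s. cw w s \<in> S \<times> S" and i: "i < K" and n: "2 * n \<le> T"
    and dist: "\<And>w w'. w \<in> {1..M} \<Longrightarrow> w' \<in> {1..M} \<Longrightarrow> w \<noteq> w' \<Longrightarrow> 2 * d < card {s. s < n \<and> cw w s \<noteq> cw w' s}"
    and W: "W i \<in> {1..M}" and Z: "card {p \<in> {..<K} \<times> {..<T}. \<rho> < cmod (Z p)} \<le> d"
  shows "decoded K snr inr T (block_scheme cw M n d) W Z i = W i"
proof -
  define y where "y = received K snr inr (block_scheme cw M n d) W Z"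
  define B where "B = {s. s < n \<and> (\<exists>j<K. \<rho> < cmod (Z (j, 2 * s)) \<or> \<rho> < cmod (Z (j, 2 * s + 1)))}"
  let ?P = "{p \<in> {..<K} \<times> {..<T}. \<rho> < cmod (Z p)}"
  have finP: "finite ?P" by (rule finite_subset[of _ "{..<K} \<times> {..<T}"]) auto
  have "B \<subseteq> (\<lambda>p. snd p div 2) ` ?P"
  proof
    fix s assume "s \<in> B"
    then obtain j where j: "s < n" "j < K" "\<rho> < cmod (Z (j, 2 * s)) \<or> \<rho> < cmod (Z (j, 2 * s + 1))"
      by (auto simp: B_def)
    then have "(j, 2 * s) \<in> ?P \<or> (j, 2 * s + 1) \<in> ?P" using n by auto
    then show "s \<in> (\<lambda>p. snd p div 2) ` ?P" by force
  qed
  then have "card B \<le> card ?P" using finP by (meson card_image_le card_mono finite_imageI le_trans)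
  then have cB: "card B \<le> d" using Z by simp
  have finB: "finite B" by (simp add: B_def)
  have good: "sym_fits i m (y i (2 * s)) (y i (2 * s + 1)) \<longleftrightarrow> m = cw (W i) s" if "s < n" "s \<notin> B" for s m
  proof -
    have "\<not> (\<exists>j<K. \<rho> < cmod (Z (j, 2 * s)) \<or> \<rho> < cmod (Z (j, 2 * s + 1)))"
      using \<open>s < n\<close> \<open>s \<notin> B\<close> unfolding B_def by blast
    then have "cmod (Z (j, 2 * s)) \<le> \<rho>" "cmod (Z (j, 2 * s + 1)) \<le> \<rho>" if "j < K" for j
      using that by (meson not_less)+
    then show ?thesis unfolding y_def by (intro sym_fits_received[OF cw i _ _ refl])
  qed
  let ?E = "\<lambda>w. {s. s < n \<and> \<not> sym_fits i (cw w s) (y i (2 * s)) (y i (2 * s + 1))}"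
  have "(w \<in> {1..M} \<and> card (?E w) \<le> d) \<longleftrightarrow> w = W i" for w
  proof
    assume w: "w = W i"
    have "?E w \<subseteq> B" using good w by blast
    then have "card (?E w) \<le> card B" using finB by (intro card_mono)
    then show "w \<in> {1..M} \<and> card (?E w) \<le> d" using W w cB by simp
  next
    assume w: "w \<in> {1..M} \<and> card (?E w) \<le> d"
    show "w = W i"
    proof (rule ccontr)
      assume ne: "w \<noteq> W i"
      have "{s. s < n \<and> cw w s \<noteq> cw (W i) s} \<subseteq> ?E w \<union> B" using good by blast
      then have "card {s. s < n \<and> cw w s \<noteq> cw (W i) s} \<le> card (?E w \<union> B)"
        using finB by (intro card_mono) auto
      also have "\<dots> \<le> card (?E w) + card B" by (rule card_Un_le)
      finally show False using dist[of w "W i"] w W ne cB by auto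
    qed
  qed
  moreover have "(LEAST w. w = W i) = W i" by (rule Least_equality) auto
  ultimately have "(LEAST w. w \<in> {1..M} \<and> card (?E w) \<le> d) = W i" by simp
  moreover have "{s. s < n \<and> \<not> sym_fits i (cw w s) (restrict (y i) {..<T} (2 * s)) (restrict (y i) {..<T} (2 * s + 1))} = ?E w" for w
    using n by (intro Collect_cong) auto
  ultimately show ?thesis
    by (simp add: decoded_def block_scheme_def y_def del: restrict_apply)
qed

lemma error_prob_block_scheme:
  assumes cw: "\<And>w s. cw w s \<in> S \<times> S" and i: "i < K" and n: "2 * n \<le> T" and M: "1 \<le> M"
    and dist: "\<And>w w'. w \<in> {1..M} \<Longrightarrow> w' \<in> {1..M} \<Longrightarrow> w \<noteq> w' \<Longrightarrow> 2 * d < card {s. s < n \<and> cw w s \<noteq> cw w' s}"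
  shows "error_prob K snr inr T M (block_scheme cw M n d) i
    \<le> (1 + measure cgauss {z. \<rho> < cmod z}) ^ (K * T) / 2 ^ Suc d"
proof -
  let ?B = "\<Pi>\<^sub>M p\<in>{..<K} \<times> {..<T}. cgauss"
  let ?P = "\<lambda>Z. Suc d \<le> card {p \<in> {..<K} \<times> {..<T}. \<rho> < cmod (Z p)}"
  interpret prob_space "block_measure K T M" using M by (rule prob_space_block_measure)
  let ?I = "{..<K} \<times> {..<T}"
  \<comment> \<open>As a finite union over sets of positions the event is measurable. Only this
    larger event has to be: monotonicity asks nothing of the error event.\<close>
  have "?P Z \<longleftrightarrow> (\<exists>A\<in>{A \<in> Pow ?I. Suc d \<le> card A}. \<forall>p\<in>A. \<rho> < cmod (Z p))" (is "_ \<longleftrightarrow> ?Q Z") for Z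
  proof
    assume "?P Z"
    then show "?Q Z" by (intro bexI[of _ "{p \<in> ?I. \<rho> < cmod (Z p)}"]) auto
  next
    assume "?Q Z"
    then obtain A where A: "A \<subseteq> ?I" "Suc d \<le> card A" "\<forall>p\<in>A. \<rho> < cmod (Z p)" by blast
    then have "card A \<le> card {p \<in> ?I. \<rho> < cmod (Z p)}" by (intro card_mono) auto
    then show "?P Z" using A(2) by simp
  qed
  moreover have "Measurable.pred ?B ?Q"
  proof (intro pred_intros_finite(3,4))
    show "finite {A \<in> Pow ?I. Suc d \<le> card A}" by simp
    show "finite A" if "A \<in> {A \<in> Pow ?I. Suc d \<le> card A}" for A
      using that by (intro finite_subset[of A ?I]) simp_all
    fix A p assume "A \<in> {A \<in> Pow ?I. Suc d \<le> card A}" "p \<in> A"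
    then have "A \<subseteq> ?I" "p \<in> A" by simp_all
    then have "p \<in> ?I" by (rule subsetD)
    note this [measurable]
    show "Measurable.pred ?B (\<lambda>Z. \<rho> < cmod (Z p))" by measurable
  qed
  ultimately have meas: "{Z \<in> space ?B. ?P Z} \<in> sets ?B" by (simp add: pred_def)
  have "error_prob K snr inr T M (block_scheme cw M n d) i
      \<le> measure (block_measure K T M) {\<omega> \<in> space (block_measure K T M). ?P (snd \<omega>)}"
    unfolding error_prob_def
  proof (intro finite_measure_mono measure_block_measure_noise M meas subsetI)
    fix \<omega> assume \<omega>: "\<omega> \<in> {\<omega> \<in> space (block_measure K T M).
      decoded K snr inr T (block_scheme cw M n d) (fst \<omega>) (snd \<omega>) i \<noteq> fst \<omega> i}"
    then have "fst \<omega> i \<in> {1..M}"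
      using i by (auto simp: block_measure_def space_pair_measure space_PiM PiE_iff space_uniform_count_measure)
    then show "\<omega> \<in> {\<omega> \<in> space (block_measure K T M). ?P (snd \<omega>)}"
      using decoded_block_scheme[OF cw i n dist] \<omega> by (auto simp: not_less_eq_eq[symmetric])
  qed
  also have "\<dots> = measure ?B {Z \<in> space ?B. ?P Z}"
    by (rule measure_block_measure_noise(2)[OF M meas])
  also have "\<dots> \<le> (1 + measure cgauss {z. \<rho> < cmod z}) ^ card ({..<K} \<times> {..<T}) / 2 ^ Suc d"
    by (rule prob_many_large_noises) auto
  finally show ?thesis by (simp add: card_cartesian_product)
qed

end

section \<open>Rates of two-slot codes and passage to the degrees of freedom\<close>

lemma num_messages_bounds:
  assumes "0 \<le> R"
  shows "1 \<le> num_messages T R" and "real (num_messages T R) \<le> 2 powr (real T * R + 1)"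
proof -
  have pos: "0 < 2 powr (real T * R)" by simp
  have ge: "1 \<le> 2 powr (real T * R)" using assms by (simp add: ge_one_powr_ge_zero)
  show "1 \<le> num_messages T R"
    unfolding num_messages_def using pos by linarith
  have "real (num_messages T R) \<le> 2 powr (real T * R) + 1"
    unfolding num_messages_def using pos by linarith
  also have "\<dots> \<le> 2 powr (real T * R + 1)" using ge by (simp add: powr_add)
  finally show "real (num_messages T R) \<le> 2 powr (real T * R + 1)" .
qed

context two_slot_code
begin

text \<open>\<theta> is the tolerated number of large noises per channel use. The condition on it
  makes the Chernoff bound ((1 + p) ^ K / 2 powr \<theta>) ^ T vanish, where p is the tail
  probability. Correcting that many lost pairs needs distance 2 * \<theta> * T out of about T / 2
  outer symbols, a fraction of 4 * \<theta>, which is the factor in the rate.\<close>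

lemma achievable:
  assumes \<theta>: "0 < \<theta>" "(1 + measure cgauss {z. \<rho> < cmod z}) ^ K < 2 powr \<theta>"
    and F: "log 2 (real F) \<le> cfb"
    and R: "0 \<le> R" "R \<le> (1 - 4 * \<theta>) * log 2 (card S) - 1"
  shows "achievable_rate K snr inr cfb R"
proof -
  define \<epsilon> where "\<epsilon> = measure cgauss {z. \<rho> < cmod z}"
  define l where "l = log 2 (card S)"
  \<comment> \<open>The decoder ignores the last use of an odd block.\<close>
  define n where "n = (\<lambda>T::nat. T div 2)"
  define d where "d = (\<lambda>T::nat. nat \<lfloor>\<theta> * T\<rfloor>)"
  let ?M = "\<lambda>T. num_messages T R"
  have cardS: "0 < card S" using finite_S S_nonempty by (simp add: card_gt_0_iff)
  have S2: "finite (S \<times> S)" "S \<times> S \<noteq> {}" using finite_S S_nonempty by auto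
  have "\<exists>cw :: nat \<Rightarrow> nat \<Rightarrow> 'm \<times> 'm. (\<forall>w s. cw w s \<in> S \<times> S) \<and>
    (?M T * (2 ^ n T * card (S \<times> S) ^ (2 * d T)) \<le> card (S \<times> S) ^ n T \<longrightarrow>
      (\<forall>w\<in>{1..?M T}. \<forall>w'\<in>{1..?M T}. w \<noteq> w' \<longrightarrow> 2 * d T < card {s. s < n T \<and> cw w s \<noteq> cw w' s}))" for T
    by (rule gilbert_varshamov[OF S2])
  then have "\<exists>cw :: nat \<Rightarrow> nat \<Rightarrow> nat \<Rightarrow> 'm \<times> 'm. \<forall>T. (\<forall>w s. cw T w s \<in> S \<times> S) \<and>
    (?M T * (2 ^ n T * card (S \<times> S) ^ (2 * d T)) \<le> card (S \<times> S) ^ n T \<longrightarrow>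
      (\<forall>w\<in>{1..?M T}. \<forall>w'\<in>{1..?M T}. w \<noteq> w' \<longrightarrow> 2 * d T < card {s. s < n T \<and> cw T w s \<noteq> cw T w' s}))"
    by (intro choice allI)
  then obtain cw :: "nat \<Rightarrow> nat \<Rightarrow> nat \<Rightarrow> 'm \<times> 'm" where cw: "\<And>T w s. cw T w s \<in> S \<times> S"
    and dist: "\<And>T w w'. ?M T * (2 ^ n T * card (S \<times> S) ^ (2 * d T)) \<le> card (S \<times> S) ^ n T \<Longrightarrow>
      w \<in> {1..?M T} \<Longrightarrow> w' \<in> {1..?M T} \<Longrightarrow> w \<noteq> w' \<Longrightarrow> 2 * d T < card {s. s < n T \<and> cw T w s \<noteq> cw T w' s}"
    by blast
  have n: "2 * n T \<le> T" for T by (simp add: n_def)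
  \<comment> \<open>Half of the bit subtracted from the rate pays for the factor 2 ^ n; the other
    half covers the rounding of the message number and the ignored use, once T is at least 2 * (1 +
    l).\<close>
  have size: "?M T * (2 ^ n T * card (S \<times> S) ^ (2 * d T)) \<le> card (S \<times> S) ^ n T"
    if T: "2 * (1 + l) \<le> real T" for T
  proof -
    have q: "real (card (S \<times> S)) ^ k = 2 powr (2 * l * real k)" for k
    proof -
      have "real (card (S \<times> S)) = 2 powr (2 * l)"
        unfolding mult_2 powr_add using cardS by (simp add: l_def card_cartesian_product)
      then have "real (card (S \<times> S)) ^ k = (2 powr (2 * l)) ^ k" by (simp only:)
      also have "\<dots> = (2 powr (2 * l)) powr real k" by (rule powr_realpow[symmetric]) simp
      finally show ?thesis by (simp only: powr_powr)
    qed
    have l0: "0 \<le> l" using cardS by (simp add: l_def)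
    have nT: "real (n T) \<le> real T / 2" "real T - 1 \<le> 2 * real (n T)" unfolding n_def by linarith+
    have dT: "real (d T) \<le> \<theta> * real T" using \<theta>(1) by (simp add: d_def)
    have "real T * R \<le> real T * ((1 - 4 * \<theta>) * l - 1)"
      using R(2) by (intro mult_left_mono) (auto simp: l_def)
    also have "\<dots> = real T * l - 4 * (l * (\<theta> * real T)) - real T" by (simp only: algebra_simps)
    finally have "real T * R \<le> real T * l - 4 * (l * (\<theta> * real T)) - real T" .
    moreover have "l * real (d T) \<le> l * (\<theta> * real T)"
      using dT l0 by (rule mult_left_mono)
    moreover have "(real T - 1) * l \<le> 2 * real (n T) * l"
      using nT(2) l0 by (rule mult_right_mono)
    then have "real T * l - l \<le> 2 * l * real (n T)" by (simp only: algebra_simps)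
    moreover have "2 * l * real (2 * d T) = 4 * (l * real (d T))" by simp
    \<comment> \<open>All products are replaced by variables, which leaves a linear
      inequality.\<close>
    moreover have "t + 1 + (n' + y) \<le> x"
      if "t \<le> w - 4 * v - T'" "u \<le> v" "w - l \<le> x" "y = 4 * u" "n' \<le> T' / 2" "2 * (1 + l) \<le> T'"
      for t T' w u v x y n' :: real
      using that by (simp add: field_simps)
    ultimately have le: "(real T * R + 1) + (real (n T) + 2 * l * real (2 * d T)) \<le> 2 * l * real (n T)"
      using nT(1) T by blast
    have "real (?M T * (2 ^ n T * card (S \<times> S) ^ (2 * d T)))
        \<le> 2 powr (real T * R + 1) * (2 powr real (n T) * 2 powr (2 * l * real (2 * d T)))"
      using num_messages_bounds(2)[OF R(1), of T]
      by (simp only: of_nat_mult of_nat_power q) (intro mult_mono, auto simp: powr_realpow)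
    also have "\<dots> = 2 powr ((real T * R + 1) + (real (n T) + 2 * l * real (2 * d T)))"
      by (simp only: powr_add)
    also have "\<dots> \<le> 2 powr (2 * l * real (n T))" using le by simp
    also have "\<dots> = real (card (S \<times> S) ^ n T)" by (simp only: of_nat_power q)
    finally show ?thesis by (simp only: of_nat_le_iff)
  qed
  let ?c = "\<lambda>T. block_scheme (cw T) (?M T) (n T) (d T)"
  have "valid_scheme K snr inr cfb T (?M T) (?c T)" if "1 \<le> T" for T
    using that by (intro valid_block_scheme cw F n num_messages_bounds R)
  moreover have "(\<lambda>T. error_prob K snr inr T (?M T) (?c T) i) \<longlonglongrightarrow> 0" if i: "i < K" for i
  proof (rule tendsto_sandwich)
    show "\<forall>\<^sub>F T in sequentially. 0 \<le> error_prob K snr inr T (?M T) (?c T) i"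
      by (simp add: error_prob_def)
    have "\<forall>\<^sub>F T in sequentially. 2 * (1 + l) \<le> real T"
      by (meson eventually_sequentiallyI nat_ceiling_le_eq)
    then show "\<forall>\<^sub>F T in sequentially. error_prob K snr inr T (?M T) (?c T) i \<le> ((1 + \<epsilon>) ^ K / 2 powr \<theta>) ^ T"
    proof eventually_elim
      case (elim T)
      have "error_prob K snr inr T (?M T) (?c T) i \<le> (1 + \<epsilon>) ^ (K * T) / 2 ^ Suc (d T)"
        unfolding \<epsilon>_def
        by (rule error_prob_block_scheme[OF cw i n num_messages_bounds(1)[OF R(1)] dist[OF size[OF elim]]])
      also have "\<dots> \<le> (1 + \<epsilon>) ^ (K * T) / 2 powr (\<theta> * T)"
      proof (intro divide_left_mono)
        have "\<theta> * T \<le> real (Suc (d T))" unfolding d_def by linarith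
        then have "2 powr (\<theta> * T) \<le> 2 powr real (Suc (d T))" by simp
        then show "2 powr (\<theta> * T) \<le> 2 ^ Suc (d T)" by (simp only: powr_realpow)
      qed (auto simp: \<epsilon>_def)
      also have "\<dots> = ((1 + \<epsilon>) ^ K / 2 powr \<theta>) ^ T"
      proof -
        have "2 powr (\<theta> * T) = (2 powr \<theta>) ^ T"
          by (simp only: powr_powr[symmetric]) (rule powr_realpow, simp)
        then show ?thesis by (simp only: power_mult power_divide)
      qed
      finally show ?case .
    qed
    show "(\<lambda>T. ((1 + \<epsilon>) ^ K / 2 powr \<theta>) ^ T) \<longlonglongrightarrow> 0"
      using \<theta>(2) by (intro LIMSEQ_power_zero) (simp add: \<epsilon>_def)
  qed simp
  ultimately show ?thesis
    unfolding achievable_rate_def using R(1) by (intro conjI exI[of _ ?c]) auto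
qed

end

text \<open>With snr = P ^ 2, a real code with P powr (2 * D') messages per pair of uses gives D' *
  log snr bits per use, as the two real dimensions cancel against the two uses. A lower bound on a
  Liminf is tested by smaller values only, so codes for each D' < D suffice, and the constant bit
  lost in \<open>achievable\<close> disappears against log snr.\<close>

lemma gdof_sym_ge:
  assumes D: "0 < D"
    and codes: "\<And>D'. 0 < D' \<Longrightarrow> D' < D \<Longrightarrow> \<exists>\<eta>>0. \<forall>\<^sub>F P in at_top. \<exists>(S :: 'm set) F e1 f e2.
       two_slot_code K (P\<^sup>2) ((P powr \<alpha>)\<^sup>2) (P powr \<eta>) S F e1 f e2 \<and>
       real F \<le> P powr (2 * \<beta>) \<and> P powr (2 * D') \<le> real (card S)"
  shows "ereal D \<le> gdof_sym K \<alpha> \<beta>"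
  unfolding gdof_sym_def
proof (subst le_Liminf_iff, intro allI impI)
  fix y :: ereal assume y: "y < ereal D"
  \<comment> \<open>The maximum keeps the tested rate E positive.\<close>
  then have "max y 0 < ereal D" using D by (simp add: zero_ereal_def)
  then obtain E where E: "max y 0 < ereal E" "ereal E < ereal D" by (meson ereal_dense2)
  then have E0: "0 < E" "E < D" "y < ereal E" by (auto simp: zero_ereal_def)
  define D' where "D' = (E + D) / 2"
  have D': "0 < D'" "D' < D" "E < D'" using E0 by (auto simp: D'_def field_simps)
  obtain \<theta> where \<theta>: "0 < \<theta>" "E < (1 - 4 * \<theta>) * D'"
  proof
    \<comment> \<open>This choice spends half of the gap between E and D' on the distance of the
      outer code.\<close>
    show "0 < (D' - E) / (8 * D')" using D' by simp
    show "E < (1 - 4 * ((D' - E) / (8 * D'))) * D'" using D' by (simp add: field_simps)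
  qed
  obtain \<eta> where \<eta>: "0 < \<eta>" and ev: "\<forall>\<^sub>F P in at_top. \<exists>(S :: 'm set) F e1 f e2.
       two_slot_code K (P\<^sup>2) ((P powr \<alpha>)\<^sup>2) (P powr \<eta>) S F e1 f e2 \<and>
       real F \<le> P powr (2 * \<beta>) \<and> P powr (2 * D') \<le> real (card S)"
    using codes[OF D'(1,2)] by blast
  have "((\<lambda>P. (1 + measure cgauss {z. P powr \<eta> < cmod z}) ^ K) \<longlongrightarrow> (1 + 0) ^ K) at_top"
  proof (intro tendsto_intros)
    have "filterlim (\<lambda>P::real. P powr \<eta>) at_top at_top" using \<eta> by real_asymp
    then show "((\<lambda>P. measure cgauss {z. P powr \<eta> < cmod z}) \<longlongrightarrow> 0) at_top"
      by (rule filterlim_compose[OF cgauss_tail_tendsto_0])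
  qed
  then have small: "\<forall>\<^sub>F P in at_top. (1 + measure cgauss {z. P powr \<eta> < cmod z}) ^ K < 2 powr \<theta>"
    by (rule order_tendstoD(2)) (use \<theta> in simp)
  have sq: "filterlim sqrt at_top at_top" by real_asymp
  have large: "\<forall>\<^sub>F snr::real in at_top. 1 + E * log 2 snr \<le> (1 - 4 * \<theta>) * D' * log 2 snr"
    using \<theta>(2) by real_asymp
  show "\<forall>\<^sub>F snr in at_top. y < sym_capacity K snr (snr powr \<alpha>) (\<beta> * log 2 snr) / ereal (log 2 snr)"
    using eventually_compose_filterlim[OF ev sq] eventually_compose_filterlim[OF small sq] large
      eventually_gt_at_top[of 1]
  proof eventually_elim
    case (elim snr)
    define P where "P = sqrt snr"
    have P: "0 < P" "1 < P" "P\<^sup>2 = snr" "P powr a = snr powr (a / 2)" for a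
      using elim(4) by (simp_all add: P_def) (simp add: powr_half_sqrt[symmetric] powr_powr)
    have inr: "(P powr \<alpha>)\<^sup>2 = snr powr \<alpha>" using elim(4) by (simp add: P(4) power2_eq_square powr_add[symmetric])
    from elim(1) obtain S :: "'m set" and F e1 f e2 where
      code: "two_slot_code K snr (snr powr \<alpha>) (P powr \<eta>) S F e1 f e2"
      and F: "real F \<le> P powr (2 * \<beta>)" and card: "P powr (2 * D') \<le> real (card S)"
      using P(3) inr unfolding P_def by auto
    interpret two_slot_code K snr "snr powr \<alpha>" "P powr \<eta>" S F e1 f e2 by (rule code)
    have lpos: "0 < log 2 snr" using elim(4) by simp
    have "log 2 (real F) \<le> log 2 (P powr (2 * \<beta>))" using F F_pos P by (subst log_le_cancel_iff) auto
    also have "\<dots> = \<beta> * log 2 snr" using elim(4) by (simp add: P(4) log_powr)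
    finally have F': "log 2 (real F) \<le> \<beta> * log 2 snr" .
    have "log 2 (P powr (2 * D')) \<le> log 2 (card S)" using card P
      by (subst log_le_cancel_iff) (use finite_S S_nonempty in \<open>auto simp: card_gt_0_iff\<close>)
    moreover have "log 2 (P powr (2 * D')) = D' * log 2 snr" using elim(4) by (simp add: P(4) log_powr)
    ultimately have "D' * log 2 snr \<le> log 2 (card S)" by simp
    moreover have "0 \<le> 1 - 4 * \<theta>" using \<theta>(2) E0(1) D'(1)
      by (meson less_eq_real_def less_trans linorder_not_le mult_nonpos_nonneg not_less)
    ultimately have "(1 - 4 * \<theta>) * (D' * log 2 snr) \<le> (1 - 4 * \<theta>) * log 2 (card S)"
      by (intro mult_left_mono)
    then have R: "E * log 2 snr \<le> (1 - 4 * \<theta>) * log 2 (card S) - 1"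
      using elim(3) by (simp add: algebra_simps)
    have "achievable_rate K snr (snr powr \<alpha>) (\<beta> * log 2 snr) (E * log 2 snr)"
      using elim(2) lpos E0(1) by (intro achievable[OF \<theta>(1) _ F' _ R]) (auto simp: P_def)
    then have "ereal (E * log 2 snr) \<le> sym_capacity K snr (snr powr \<alpha>) (\<beta> * log 2 snr)"
      unfolding sym_capacity_def by (intro SUP_upper) simp
    then have "ereal E \<le> sym_capacity K snr (snr powr \<alpha>) (\<beta> * log 2 snr) / ereal (log 2 snr)"
      using lpos by (subst ereal_le_divide_pos) (auto simp: mult.commute)
    with E0(3) show ?case by (rule less_le_trans)
  qed
qed

section \<open>Codes with feedback\<close>

text \<open>One step of successive decoding: distinct integers differ by at least w at their own
  level, which the lower levels r and the noise cannot compensate.\<close>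

lemma leading_digit_eq:
  fixes x y :: nat and w r \<nu> :: real
  assumes "\<bar>w * (real x - real y) + r\<bar> \<le> \<nu>" and "\<nu> + \<bar>r\<bar> < w"
  shows "x = y"
proof (rule ccontr)
  assume "x \<noteq> y"
  then have "1 \<le> \<bar>real x - real y\<bar>" by linarith
  moreover have "0 < w" using assms by linarith
  ultimately have "w \<le> \<bar>w * (real x - real y)\<bar>" by (simp add: abs_mult)
  then show False using assms by linarith
qed

lemma abs_diff_le: "x \<le> b \<Longrightarrow> y \<le> b \<Longrightarrow> 0 \<le> w \<Longrightarrow> \<bar>w * (real x - real y)\<bar> \<le> w * real b"
  for x y b :: nat and w :: real
  by (simp add: abs_mult mult_left_mono)

lemma sum_others_le:
  fixes g :: "nat \<Rightarrow> nat"
  assumes "\<And>j. j < K \<Longrightarrow> g j \<le> b"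
  shows "(\<Sum>j\<in>{..<K} - {i}. g j) \<le> K * b" and "(\<Sum>j<K. g j) \<le> K * b"
proof -
  show "(\<Sum>j<K. g j) \<le> K * b" using sum_bounded_above[of "{..<K}" g b] assms by simp
  have "(\<Sum>j\<in>{..<K} - {i}. g j) \<le> (\<Sum>j<K. g j)" by (intro sum_mono2) auto
  then show "(\<Sum>j\<in>{..<K} - {i}. g j) \<le> K * b"
    using \<open>(\<Sum>j<K. g j) \<le> K * b\<close> by linarith
qed

lemma sum_split_user:
  fixes g :: "nat \<Rightarrow> nat"
  assumes "i < K"
  shows "(\<Sum>j<K. g j) = g i + (\<Sum>j\<in>{..<K} - {i}. g j)"
  using assms by (intro sum.remove) auto

lemma tuple_app: "\<mu> \<in> {..<K} \<rightarrow>\<^sub>E S \<Longrightarrow> j < K \<Longrightarrow> \<mu> j \<in> S"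
  by auto

text \<open>This is how a transmitter removes its own known contribution x from a label; adding L -
  x mod L stands for subtracting x modulo L.\<close>

lemma mod_subtract_recover:
  fixes s x L :: nat
  assumes "s < L"
  shows "((x + s) mod L + (L - x mod L)) mod L = s"
proof -
  have "x mod L \<le> L" using assms by (intro less_imp_le mod_less_divisor) auto
  have "((x + s) mod L + (L - x mod L)) mod L = ((x + s) + (L - x mod L)) mod L"
    by (simp add: mod_add_left_eq)
  also have "(x + s) + (L - x mod L) = s + L * (x div L + 1)"
  proof -
    have "L * (x div L + 1) = L * (x div L) + L" by simp
    then show ?thesis using \<open>x mod L \<le> L\<close> mult_div_mod_eq[of L x] by linarith
  qed
  also have "\<dots> mod L = s" using assms by (simp only: mod_mult_self2 mod_less)
  finally show ?thesis .
qed

text \<open>The levels U1, U2, U1 * h, U3 are peeled off in this order, \<open>g1\<close> to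
  \<open>g4\<close> making each exceed all that lies below it. The interfering private digits, of
  amplitude h * U3, are never resolved and count as additional noise.\<close>

lemma weak_digits:
  fixes x x' t t' X X' v v' Q Q' Ct CX Cv CQ :: nat and h U1 U2 U3 \<nu> :: real
  assumes "0 \<le> h" "0 \<le> U1" "0 \<le> U2" "0 \<le> U3"
    and g4: "\<nu> + h * U3 * CQ < U3"
    and g3: "\<nu> + h * U3 * CQ + U3 * Cv < U1 * h"
    and g2: "\<nu> + h * U3 * CQ + U3 * Cv + U1 * h * CX < U2"
    and g1: "\<nu> + h * U3 * CQ + U3 * Cv + U1 * h * CX + U2 * Ct < U1"
    and b: "t \<le> Ct" "t' \<le> Ct" "X \<le> CX" "X' \<le> CX" "v \<le> Cv" "v' \<le> Cv" "Q \<le> CQ" "Q' \<le> CQ"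
    and le: "\<bar>(U1 * x + U2 * t + U1 * h * X + U3 * v + h * U3 * Q)
      - (U1 * x' + U2 * t' + U1 * h * X' + U3 * v' + h * U3 * Q')\<bar> \<le> \<nu>"
  shows "x = x' \<and> t = t' \<and> X = X' \<and> v = v'"
proof -
  have t: "\<bar>U2 * (real t - real t')\<bar> \<le> U2 * Ct" and X: "\<bar>U1 * h * (real X - real X')\<bar> \<le> U1 * h * CX"
    and v: "\<bar>U3 * (real v - real v')\<bar> \<le> U3 * Cv" and Q: "\<bar>h * U3 * (real Q - real Q')\<bar> \<le> h * U3 * CQ"
    using assms(1-4) b by (intro abs_diff_le; simp)+
  have le': "\<bar>U1 * (real x - real x') + (U2 * (real t - real t') + U1 * h * (real X - real X')
      + U3 * (real v - real v') + h * U3 * (real Q - real Q'))\<bar> \<le> \<nu>"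
    using le by (simp add: algebra_simps)
  have x: "x = x'" by (rule leading_digit_eq[OF le']) (use t X v Q g1 in linarith)
  have le': "\<bar>U2 * (real t - real t') + (U1 * h * (real X - real X')
      + U3 * (real v - real v') + h * U3 * (real Q - real Q'))\<bar> \<le> \<nu>"
    using le' x by (simp add: add.assoc)
  have t': "t = t'" by (rule leading_digit_eq[OF le']) (use X v Q g2 in linarith)
  have le': "\<bar>U1 * h * (real X - real X')
      + (U3 * (real v - real v') + h * U3 * (real Q - real Q'))\<bar> \<le> \<nu>"
    using le' t' by (simp add: add.assoc)
  have X': "X = X'" by (rule leading_digit_eq[OF le']) (use v Q g3 in linarith)
  have le': "\<bar>U3 * (real v - real v') + h * U3 * (real Q - real Q')\<bar> \<le> \<nu>"
    using le' X' by simp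
  have v': "v = v'" by (rule leading_digit_eq[OF le']) (use Q g4 in linarith)
  show ?thesis using x t' X' v' by blast
qed

text \<open>
  \<open>U1\<close>, \<open>U2\<close>, \<open>U3\<close> are the received amplitudes of the own common digit, of the digit resolved by
  feedback, and of the private digit. By \<open>align\<close> the interfering feedback digits land on the private
  digit as \<open>p + E * (their sum)\<close>. The label is this integer divided by \<open>E\<close>, reduced modulo \<open>K * B + 1\<close>,
  which exceeds the sum; the transmitter knows \<open>p\<close> and can subtract its contribution.
\<close>

lemma weak_feedback_code:
  fixes K A B C E :: nat and P r U1 U2 U3 \<rho> :: real
  defines "h \<equiv> r / P"
  defines "\<nu> \<equiv> 2 * \<rho> + h * U3 * real (K * C)"
  defines "V \<equiv> U3 * real (C + E * (K * (K * B)))"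
  assumes K: "1 \<le> K" and pos: "0 < P" "0 \<le> r" "0 \<le> U1" "0 \<le> U2" "0 \<le> U3" "0 < E"
    and align: "h * U2 = U3 * real E"
    and g4: "\<nu> < U3"
    and g3: "\<nu> + V < U1 * h"
    and g2: "\<nu> + V + U1 * h * real (K * A) < U2"
    and g1: "\<nu> + V + U1 * h * real (K * A) + U2 * real (K * B) < U1"
    and power: "U1 * real A + U2 * real ((K + 1) * B) + U3 * real C \<le> P / 2"
  shows "\<exists>e1 f e2. two_slot_code K (P\<^sup>2) (r\<^sup>2) \<rho> ({..A} \<times> {..B} \<times> {..C} \<times> {..A} \<times> {..C}) (K * B + 1) e1 f e2"
proof -
  \<comment> \<open>A message consists of the common, feedback and private digits of the first use
    and the common and private digits of the second.\<close>
  define ga :: "nat \<times> nat \<times> nat \<times> nat \<times> nat \<Rightarrow> nat" where "ga = fst"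
  define gb :: "nat \<times> nat \<times> nat \<times> nat \<times> nat \<Rightarrow> nat" where "gb = (\<lambda>m. fst (snd m))"
  define gp :: "nat \<times> nat \<times> nat \<times> nat \<times> nat \<Rightarrow> nat" where "gp = (\<lambda>m. fst (snd (snd m)))"
  define ga2 :: "nat \<times> nat \<times> nat \<times> nat \<times> nat \<Rightarrow> nat" where "ga2 = (\<lambda>m. fst (snd (snd (snd m))))"
  define gp2 :: "nat \<times> nat \<times> nat \<times> nat \<times> nat \<Rightarrow> nat" where "gp2 = (\<lambda>m. snd (snd (snd (snd m))))"
  note g_defs = ga_def gb_def gp_def ga2_def gp2_def
  define S where "S = {..A} \<times> {..B} \<times> {..C} \<times> {..A} \<times> {..C}"
  define L where "L = K * B + 1"
  define e1 where "e1 = (\<lambda>m. (U1 * ga m + U2 * gb m + U3 * gp m) / P)"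
  define rec where "rec = (\<lambda>m l. (l + (L - (gp m div E) mod L)) mod L)"
  define e2 where "e2 = (\<lambda>m l. (U1 * ga2 m + U2 * real (gb m + rec m l) + U3 * gp2 m) / P)"
  define f where "f = (\<lambda>i \<mu>. ((gp (\<mu> i) + E * (\<Sum>j\<in>{..<K} - {i}. gb (\<mu> j))) div E) mod L)"
  have gS: "ga m \<le> A" "gb m \<le> B" "gp m \<le> C" "ga2 m \<le> A" "gp2 m \<le> C" if "m \<in> S" for m
    using that by (auto simp: S_def g_defs)
  have g_inj: "m = m'" if "ga m = ga m'" "gb m = gb m'" "gp m = gp m'" "ga2 m = ga2 m'" "gp2 m = gp2 m'" for m m'
    using that by (simp add: g_defs prod_eq_iff)
  have L: "0 < L" by (simp add: L_def)
  have h0: "0 \<le> h" using pos by (simp add: h_def)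
  have Ph: "P * h = r" using pos by (simp add: h_def)
  have sq: "sqrt (P\<^sup>2) = P" "sqrt (r\<^sup>2) = r" using pos by auto
  let ?s = "\<lambda>i g. \<Sum>j\<in>{..<K} - {i}. g j :: nat"
  have obs1: "obs1 K (P\<^sup>2) (r\<^sup>2) e1 \<mu> i = U1 * ga (\<mu> i) + U2 * gb (\<mu> i) + U1 * h * ?s i (\<lambda>j. ga (\<mu> j))
      + U3 * real (gp (\<mu> i) + E * ?s i (\<lambda>j. gb (\<mu> j))) + h * U3 * ?s i (\<lambda>j. gp (\<mu> j))" for \<mu> i
  proof -
    have "(\<Sum>j\<in>{..<K} - {i}. r * e1 (\<mu> j))
      = h * U1 * ?s i (\<lambda>j. ga (\<mu> j)) + h * U2 * ?s i (\<lambda>j. gb (\<mu> j)) + h * U3 * ?s i (\<lambda>j. gp (\<mu> j))"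
      by (simp add: e1_def h_def sum.distrib sum_distrib_left add_divide_distrib distrib_left mult_ac)
    moreover have "P * e1 (\<mu> i) = U1 * ga (\<mu> i) + U2 * gb (\<mu> i) + U3 * gp (\<mu> i)"
      using pos by (simp add: e1_def)
    ultimately show ?thesis
      unfolding obs1_def sq align by (simp add: algebra_simps)
  qed
  have tot: "gb (\<mu> j) + rec (\<mu> j) (f j \<mu>) = (\<Sum>k<K. gb (\<mu> k))"
    if \<mu>: "\<mu> \<in> {..<K} \<rightarrow>\<^sub>E S" and j: "j < K" for \<mu> j
  proof -
    have "?s j (\<lambda>k. gb (\<mu> k)) \<le> K * B"
      by (intro sum_others_le gS tuple_app[OF \<mu>])
    then have "?s j (\<lambda>k. gb (\<mu> k)) < L" by (simp add: L_def)
    \<comment> \<open>The interferers add a multiple of E, so the division separates their sum from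
      the private digit without a carry.\<close>
    moreover have "(gp (\<mu> j) + E * ?s j (\<lambda>k. gb (\<mu> k))) div E = gp (\<mu> j) div E + ?s j (\<lambda>k. gb (\<mu> k))"
      using pos(6) by simp
    ultimately have "rec (\<mu> j) (f j \<mu>) = ?s j (\<lambda>k. gb (\<mu> k))"
      unfolding rec_def f_def by (simp only: mod_subtract_recover)
    then show ?thesis using sum_split_user[OF j, of "\<lambda>k. gb (\<mu> k)"] by simp
  qed
  \<comment> \<open>In the second use all users send the same total, so the K - 1 interfering copies
    put a multiple of it on the private level. The total is decoded first, from level U2, and this
    interference is then known.\<close>
  have obs2: "obs2 K (P\<^sup>2) (r\<^sup>2) e2 f \<mu> i = U1 * ga2 (\<mu> i) + U2 * (\<Sum>k<K. gb (\<mu> k)) + U1 * h * ?s i (\<lambda>j. ga2 (\<mu> j))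
      + U3 * real (gp2 (\<mu> i) + E * ((K - 1) * (\<Sum>k<K. gb (\<mu> k)))) + h * U3 * ?s i (\<lambda>j. gp2 (\<mu> j))"
    if \<mu>: "\<mu> \<in> {..<K} \<rightarrow>\<^sub>E S" and i: "i < K" for \<mu> i
  proof -
    define T where "T = (\<Sum>k<K. gb (\<mu> k))"
    have e2: "e2 (\<mu> j) (f j \<mu>) = (U1 * ga2 (\<mu> j) + U2 * T + U3 * gp2 (\<mu> j)) / P" if "j < K" for j
      using tot[OF \<mu> that] unfolding e2_def T_def by simp
    have "(\<Sum>j\<in>{..<K} - {i}. r * e2 (\<mu> j) (f j \<mu>))
      = (\<Sum>j\<in>{..<K} - {i}. h * U1 * ga2 (\<mu> j) + h * U2 * T + h * U3 * gp2 (\<mu> j))"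
      by (intro sum.cong refl) (simp add: e2 h_def add_divide_distrib distrib_left mult_ac)
    also have "\<dots> = h * U1 * ?s i (\<lambda>j. ga2 (\<mu> j)) + h * U2 * T * real (K - 1) + h * U3 * ?s i (\<lambda>j. gp2 (\<mu> j))"
      using i by (simp add: sum.distrib sum_distrib_left[symmetric] card_Diff_singleton)
    finally have sum: "(\<Sum>j\<in>{..<K} - {i}. r * e2 (\<mu> j) (f j \<mu>)) = \<dots>" .
    moreover have "P * e2 (\<mu> i) (f i \<mu>) = U1 * ga2 (\<mu> i) + U2 * T + U3 * gp2 (\<mu> i)"
      using pos e2[OF i] by simp
    moreover have "real (gp2 (\<mu> i) + E * ((K - 1) * T)) = gp2 (\<mu> i) + E * T * real (K - 1)"
      by simp
    ultimately show ?thesis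
      unfolding obs2_def sq align T_def[symmetric] by (simp only: algebra_simps of_nat_mult)
  qed
  \<comment> \<open>The bounds serve both uses. The second one puts a total of up to K * B on level
    U2 and K - 1 copies of it on the private level.\<close>
  have digits: "x = x' \<and> t = t' \<and> X = X' \<and> v = v'"
    if "t \<le> K * B" "t' \<le> K * B" "X \<le> K * A" "X' \<le> K * A" "v \<le> C + E * (K * (K * B))" "v' \<le> C + E * (K * (K * B))"
      "Q \<le> K * C" "Q' \<le> K * C"
      "\<bar>(U1 * x + U2 * t + U1 * h * X + U3 * v + h * U3 * Q)
      - (U1 * x' + U2 * t' + U1 * h * X' + U3 * v' + h * U3 * Q')\<bar> \<le> 2 * \<rho>"
    for x x' t t' X X' v v' Q Q' :: nat
    using g1 g2 g3 g4 unfolding \<nu>_def V_def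
    by (intro weak_digits[OF h0 pos(3-5) _ _ _ _ that]) (simp_all add: add_ac)
  have slot1: "ga (\<mu> i) = ga (\<mu>' i) \<and> gb (\<mu> i) = gb (\<mu>' i) \<and>
      gp (\<mu> i) + E * ?s i (\<lambda>j. gb (\<mu> j)) = gp (\<mu>' i) + E * ?s i (\<lambda>j. gb (\<mu>' j))"
    if \<mu>: "\<mu> \<in> {..<K} \<rightarrow>\<^sub>E S" "\<mu>' \<in> {..<K} \<rightarrow>\<^sub>E S" and i: "i < K"
      and le: "\<bar>obs1 K (P\<^sup>2) (r\<^sup>2) e1 \<mu> i - obs1 K (P\<^sup>2) (r\<^sup>2) e1 \<mu>' i\<bar> \<le> 2 * \<rho>" for \<mu> \<mu>' i
  proof -
    have b: "gb (\<nu> i) \<le> K * B" "?s i (\<lambda>j. ga (\<nu> j)) \<le> K * A" "?s i (\<lambda>j. gp (\<nu> j)) \<le> K * C"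
      "gp (\<nu> i) + E * ?s i (\<lambda>j. gb (\<nu> j)) \<le> C + E * (K * (K * B))" if "\<nu> \<in> {..<K} \<rightarrow>\<^sub>E S" for \<nu>
    proof -
      note m = tuple_app[OF that]
      show "gb (\<nu> i) \<le> K * B" using gS(2)[OF m[OF i]] K by (metis le_trans mult_le_mono1 nat_mult_1)
      show "?s i (\<lambda>j. ga (\<nu> j)) \<le> K * A" "?s i (\<lambda>j. gp (\<nu> j)) \<le> K * C"
        by (intro sum_others_le gS m; assumption)+
      have "?s i (\<lambda>j. gb (\<nu> j)) \<le> K * B" by (intro sum_others_le gS m; assumption)+
      also have "\<dots> \<le> K * (K * B)" using K by (metis mult_le_mono1 nat_mult_1)
      finally show "gp (\<nu> i) + E * ?s i (\<lambda>j. gb (\<nu> j)) \<le> C + E * (K * (K * B))"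
        using gS(3)[OF m[OF i]] by (intro add_mono mult_left_mono) auto
    qed
    show ?thesis
      using digits[OF b(1)[OF \<mu>(1)] b(1)[OF \<mu>(2)] b(2)[OF \<mu>(1)] b(2)[OF \<mu>(2)] b(4)[OF \<mu>(1)] b(4)[OF \<mu>(2)]
          b(3)[OF \<mu>(1)] b(3)[OF \<mu>(2)] le[unfolded obs1]] by blast
  qed
  have slot2: "ga2 (\<mu> i) = ga2 (\<mu>' i) \<and> (\<Sum>k<K. gb (\<mu> k)) = (\<Sum>k<K. gb (\<mu>' k)) \<and> gp2 (\<mu> i) = gp2 (\<mu>' i)"
    if \<mu>: "\<mu> \<in> {..<K} \<rightarrow>\<^sub>E S" "\<mu>' \<in> {..<K} \<rightarrow>\<^sub>E S" and i: "i < K"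
      and le: "\<bar>obs2 K (P\<^sup>2) (r\<^sup>2) e2 f \<mu> i - obs2 K (P\<^sup>2) (r\<^sup>2) e2 f \<mu>' i\<bar> \<le> 2 * \<rho>" for \<mu> \<mu>' i
  proof -
    have b: "(\<Sum>k<K. gb (\<nu> k)) \<le> K * B" "?s i (\<lambda>j. ga2 (\<nu> j)) \<le> K * A" "?s i (\<lambda>j. gp2 (\<nu> j)) \<le> K * C"
      "gp2 (\<nu> i) + E * ((K - 1) * (\<Sum>k<K. gb (\<nu> k))) \<le> C + E * (K * (K * B))" if "\<nu> \<in> {..<K} \<rightarrow>\<^sub>E S" for \<nu>
    proof -
      note m = tuple_app[OF that]
      show T: "(\<Sum>k<K. gb (\<nu> k)) \<le> K * B" by (intro sum_others_le gS m; assumption)+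
      show "?s i (\<lambda>j. ga2 (\<nu> j)) \<le> K * A" "?s i (\<lambda>j. gp2 (\<nu> j)) \<le> K * C"
        by (intro sum_others_le gS m; assumption)+
      show "gp2 (\<nu> i) + E * ((K - 1) * (\<Sum>k<K. gb (\<nu> k))) \<le> C + E * (K * (K * B))"
        using gS(5)[OF m[OF i]] T by (intro add_mono mult_left_mono mult_le_mono) auto
    qed
    have "ga2 (\<mu> i) = ga2 (\<mu>' i) \<and> (\<Sum>k<K. gb (\<mu> k)) = (\<Sum>k<K. gb (\<mu>' k)) \<and>
      ?s i (\<lambda>j. ga2 (\<mu> j)) = ?s i (\<lambda>j. ga2 (\<mu>' j)) \<and>
      gp2 (\<mu> i) + E * ((K - 1) * (\<Sum>k<K. gb (\<mu> k))) = gp2 (\<mu>' i) + E * ((K - 1) * (\<Sum>k<K. gb (\<mu>' k)))"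
      using digits[OF b(1)[OF \<mu>(1)] b(1)[OF \<mu>(2)] b(2)[OF \<mu>(1)] b(2)[OF \<mu>(2)] b(4)[OF \<mu>(1)] b(4)[OF \<mu>(2)]
          b(3)[OF \<mu>(1)] b(3)[OF \<mu>(2)] le[unfolded obs2[OF \<mu>(1) i] obs2[OF \<mu>(2) i]]] .
    then show ?thesis by (metis add_right_cancel)
  qed
  have "two_slot_code K (P\<^sup>2) (r\<^sup>2) \<rho> S L e1 f e2"
  proof
    show "finite S" "S \<noteq> {}" "0 < L" using L by (auto simp: S_def)
    have bd: "U1 * real x + U2 * real y + U3 * real z \<le> P / 2"
      if "x \<le> A" "y \<le> (K + 1) * B" "z \<le> C" for x y z
    proof -
      have "U1 * real x + U2 * real y + U3 * real z \<le> U1 * real A + U2 * real ((K + 1) * B) + U3 * real C"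
        using that pos by (intro add_mono mult_left_mono) (simp_all only: of_nat_le_iff)
      then show ?thesis using power by linarith
    qed
    have nn: "0 \<le> U1 * real x + U2 * real y + U3 * real z" for x y z
      using pos by simp
    show "\<bar>e1 m\<bar> \<le> 1 / 2" if "m \<in> S" for m
    proof -
      have "gb m \<le> (K + 1) * B" using gS(2)[OF that] by simp
      then have "U1 * ga m + U2 * gb m + U3 * gp m \<le> P / 2" using gS[OF that] by (intro bd)
      then show ?thesis using nn[of "ga m" "gb m" "gp m"] pos by (simp add: e1_def abs_div_pos divide_le_eq)
    qed
    show "\<bar>e2 m l\<bar> \<le> 1 / 2" if "m \<in> S" "l < L" for m l
    proof -
      \<comment> \<open>The amplitude bound is required for every label below L and not only for
        true ones. The own digit and the recovered sum are therefore bounded separately, which gives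
        (K + 1) * B instead of K * B.\<close>
      have "rec m l < L" using L by (simp add: rec_def)
      then have "gb m + rec m l \<le> (K + 1) * B" using gS(2)[OF that(1)] by (simp add: L_def)
      then have "U1 * ga2 m + U2 * real (gb m + rec m l) + U3 * gp2 m \<le> P / 2" using gS[OF that(1)] by (intro bd)
      then show ?thesis using nn[of "ga2 m" "gb m + rec m l" "gp2 m"] pos by (simp add: e2_def abs_div_pos divide_le_eq)
    qed
    show "f i \<mu> < L" for i \<mu> using L by (simp add: f_def)
    show "f i \<mu> = f i \<mu>'" if "\<mu> \<in> {..<K} \<rightarrow>\<^sub>E S" "\<mu>' \<in> {..<K} \<rightarrow>\<^sub>E S" "i < K"
      "\<bar>obs1 K (P\<^sup>2) (r\<^sup>2) e1 \<mu> i - obs1 K (P\<^sup>2) (r\<^sup>2) e1 \<mu>' i\<bar> \<le> 2 * \<rho>" for \<mu> \<mu>' i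
      using slot1[OF that] by (simp add: f_def)
    show "\<mu> i = \<mu>' i" if "\<mu> \<in> {..<K} \<rightarrow>\<^sub>E S" "\<mu>' \<in> {..<K} \<rightarrow>\<^sub>E S" "i < K"
      "\<bar>obs1 K (P\<^sup>2) (r\<^sup>2) e1 \<mu> i - obs1 K (P\<^sup>2) (r\<^sup>2) e1 \<mu>' i\<bar> \<le> 2 * \<rho>"
      "\<bar>obs2 K (P\<^sup>2) (r\<^sup>2) e2 f \<mu> i - obs2 K (P\<^sup>2) (r\<^sup>2) e2 f \<mu>' i\<bar> \<le> 2 * \<rho>" for \<mu> \<mu>' i
    proof -
      note s1 = slot1[OF that(1-4)] and s2 = slot2[OF that(1-3,5)]
      \<comment> \<open>The own digit from the first use and the total from the second yield the sum
        of the others, which strips the first private digit of its interference.\<close>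
      have "?s i (\<lambda>j. gb (\<mu> j)) = ?s i (\<lambda>j. gb (\<mu>' j))"
        using s1 s2 sum_split_user[OF that(3), of "\<lambda>j. gb (\<mu> j)"] sum_split_user[OF that(3), of "\<lambda>j. gb (\<mu>' j)"]
        by linarith
      with s1 s2 show ?thesis by (intro g_inj) auto
    qed
  qed
  then show ?thesis unfolding S_def L_def by blast
qed

text \<open>Cross gains dominate, so from the top a receiver sees the interfering common digits, the
  interfering feedback digits and its own common digit; its own feedback digit drowns in the noise.
  The label is the decoded sum of the other users' feedback digits. In the second use the others
  transmit the total over their strong links, and subtracting the earlier sum reveals the own
  digit.\<close>

lemma strong_feedback_code:
  fixes K B C :: nat and P r V1 V2 \<rho> :: real
  defines "h \<equiv> P / r"
  defines "\<nu> \<equiv> 2 * \<rho> + h * V2 * real (K * B)"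
  assumes K: "2 \<le> K" and pos: "0 < r" "0 \<le> P" "0 \<le> V1" "0 \<le> V2"
    and g3: "\<nu> < h * V1"
    and g2: "\<nu> + h * V1 * real C < V2"
    and g1: "\<nu> + h * V1 * real C + V2 * real (K * (K * B)) < V1"
    and power: "V1 * real C + V2 * real ((K + 1) * B) \<le> r / 2"
  shows "\<exists>e1 f e2. two_slot_code K (P\<^sup>2) (r\<^sup>2) \<rho> ({..C} \<times> {..B} \<times> {..C}) (K * B + 1) e1 f e2"
proof -
  define gc :: "nat \<times> nat \<times> nat \<Rightarrow> nat" where "gc = fst"
  define gb :: "nat \<times> nat \<times> nat \<Rightarrow> nat" where "gb = (\<lambda>m. fst (snd m))"
  define gc2 :: "nat \<times> nat \<times> nat \<Rightarrow> nat" where "gc2 = (\<lambda>m. snd (snd m))"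
  note g_defs = gc_def gb_def gc2_def
  define S where "S = {..C} \<times> {..B} \<times> {..C}"
  define L where "L = K * B + 1"
  define e1 where "e1 = (\<lambda>m. (V1 * gc m + V2 * gb m) / r)"
  define e2 where "e2 = (\<lambda>m l::nat. (V1 * gc2 m + V2 * real (gb m + l)) / r)"
  let ?s = "\<lambda>i g. \<Sum>j\<in>{..<K} - {i}. g j :: nat"
  define f where "f = (\<lambda>i \<mu>. ?s i (\<lambda>j. gb (\<mu> j)))"
  have gS: "gc m \<le> C" "gb m \<le> B" "gc2 m \<le> C" if "m \<in> S" for m
    using that by (auto simp: S_def g_defs)
  have g_inj: "m = m'" if "gc m = gc m'" "gb m = gb m'" "gc2 m = gc2 m'" for m m'
    using that by (simp add: g_defs prod_eq_iff)
  have h0: "0 \<le> h" using pos by (simp add: h_def)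
  have sq: "sqrt (P\<^sup>2) = P" "sqrt (r\<^sup>2) = r" using pos by auto
  have obs1: "obs1 K (P\<^sup>2) (r\<^sup>2) e1 \<mu> i = V1 * ?s i (\<lambda>j. gc (\<mu> j)) + V2 * ?s i (\<lambda>j. gb (\<mu> j))
      + h * V1 * gc (\<mu> i) + h * V2 * gb (\<mu> i)" for \<mu> i
  proof -
    have "(\<Sum>j\<in>{..<K} - {i}. r * e1 (\<mu> j)) = V1 * ?s i (\<lambda>j. gc (\<mu> j)) + V2 * ?s i (\<lambda>j. gb (\<mu> j))"
      using pos by (simp add: e1_def sum.distrib sum_distrib_left)
    moreover have "P * e1 (\<mu> i) = h * V1 * gc (\<mu> i) + h * V2 * gb (\<mu> i)"
      by (simp add: e1_def h_def add_divide_distrib distrib_left)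
    ultimately show ?thesis unfolding obs1_def sq by simp
  qed
  have obs2: "obs2 K (P\<^sup>2) (r\<^sup>2) e2 f \<mu> i = V1 * ?s i (\<lambda>j. gc2 (\<mu> j)) + V2 * real ((K - 1) * (\<Sum>k<K. gb (\<mu> k)))
      + h * V1 * gc2 (\<mu> i) + h * V2 * (\<Sum>k<K. gb (\<mu> k))" if i: "i < K" for \<mu> i
  proof -
    define T where "T = (\<Sum>k<K. gb (\<mu> k))"
    have e2: "e2 (\<mu> j) (f j \<mu>) = (V1 * gc2 (\<mu> j) + V2 * T) / r" if "j < K" for j
      using sum_split_user[OF that, of "\<lambda>k. gb (\<mu> k)"] by (simp only: e2_def f_def T_def)
    have "(\<Sum>j\<in>{..<K} - {i}. r * e2 (\<mu> j) (f j \<mu>)) = (\<Sum>j\<in>{..<K} - {i}. V1 * gc2 (\<mu> j) + V2 * T)"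
      using pos by (intro sum.cong refl) (simp add: e2)
    also have "\<dots> = V1 * ?s i (\<lambda>j. gc2 (\<mu> j)) + V2 * real ((K - 1) * T)"
      using i by (simp add: sum.distrib sum_distrib_left[symmetric] card_Diff_singleton)
    finally have sum: "(\<Sum>j\<in>{..<K} - {i}. r * e2 (\<mu> j) (f j \<mu>)) = \<dots>" .
    moreover have "P * e2 (\<mu> i) (f i \<mu>) = h * V1 * gc2 (\<mu> i) + h * V2 * T"
      using e2[OF i] by (simp add: h_def add_divide_distrib distrib_left)
    ultimately show ?thesis unfolding obs2_def sq T_def[symmetric] by simp
  qed
  have digits: "x = x' \<and> t = t' \<and> v = v'"
    if b: "t \<le> K * (K * B)" "t' \<le> K * (K * B)" "v \<le> C" "v' \<le> C" "Q \<le> K * B" "Q' \<le> K * B"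
      and le: "\<bar>(V1 * x + V2 * t + h * V1 * v + h * V2 * Q) - (V1 * x' + V2 * t' + h * V1 * v' + h * V2 * Q')\<bar> \<le> 2 * \<rho>"
    for x x' t t' v v' Q Q' :: nat
  proof -
    have t: "\<bar>V2 * (real t - real t')\<bar> \<le> V2 * real (K * (K * B))" and v: "\<bar>h * V1 * (real v - real v')\<bar> \<le> h * V1 * real C"
      and Q: "\<bar>h * V2 * (real Q - real Q')\<bar> \<le> h * V2 * real (K * B)"
      using b h0 pos by (intro abs_diff_le; simp)+
    have le': "\<bar>V1 * (real x - real x') + (V2 * (real t - real t') + h * V1 * (real v - real v')
        + h * V2 * (real Q - real Q'))\<bar> \<le> 2 * \<rho>"
      using le by (simp add: algebra_simps)
    have x: "x = x'" by (rule leading_digit_eq[OF le']) (use t v Q g1 \<nu>_def in linarith)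
    have le': "\<bar>V2 * (real t - real t') + (h * V1 * (real v - real v') + h * V2 * (real Q - real Q'))\<bar> \<le> 2 * \<rho>"
      using le' x by (simp add: add.assoc)
    have t': "t = t'" by (rule leading_digit_eq[OF le']) (use v Q g2 \<nu>_def in linarith)
    have le': "\<bar>h * V1 * (real v - real v') + h * V2 * (real Q - real Q')\<bar> \<le> 2 * \<rho>"
      using le' t' by simp
    have "v = v'" by (rule leading_digit_eq[OF le']) (use Q g3 \<nu>_def in linarith)
    with x t' show ?thesis by blast
  qed
  have slot1: "?s i (\<lambda>j. gb (\<mu> j)) = ?s i (\<lambda>j. gb (\<mu>' j)) \<and> gc (\<mu> i) = gc (\<mu>' i)"
    if \<mu>: "\<mu> \<in> {..<K} \<rightarrow>\<^sub>E S" "\<mu>' \<in> {..<K} \<rightarrow>\<^sub>E S" and i: "i < K"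
      and le: "\<bar>obs1 K (P\<^sup>2) (r\<^sup>2) e1 \<mu> i - obs1 K (P\<^sup>2) (r\<^sup>2) e1 \<mu>' i\<bar> \<le> 2 * \<rho>" for \<mu> \<mu>' i
  proof -
    have b: "?s i (\<lambda>j. gb (\<nu> j)) \<le> K * (K * B)" "gc (\<nu> i) \<le> C" "gb (\<nu> i) \<le> K * B" if "\<nu> \<in> {..<K} \<rightarrow>\<^sub>E S" for \<nu>
    proof -
      note m = tuple_app[OF that]
      have "?s i (\<lambda>j. gb (\<nu> j)) \<le> K * B" by (intro sum_others_le gS m; assumption)+
      then show "?s i (\<lambda>j. gb (\<nu> j)) \<le> K * (K * B)"
        using K by (metis le_trans mult_le_mono1 nat_mult_1 one_le_numeral)
      show "gc (\<nu> i) \<le> C" using gS m i by blast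
      show "gb (\<nu> i) \<le> K * B" using gS(2)[OF m[OF i]] K by (metis le_trans mult_le_mono1 nat_mult_1 one_le_numeral)
    qed
    show ?thesis
      using digits[OF b(1)[OF \<mu>(1)] b(1)[OF \<mu>(2)] b(2)[OF \<mu>(1)] b(2)[OF \<mu>(2)]
          b(3)[OF \<mu>(1)] b(3)[OF \<mu>(2)] le[unfolded obs1]] by blast
  qed
  have slot2: "(\<Sum>k<K. gb (\<mu> k)) = (\<Sum>k<K. gb (\<mu>' k)) \<and> gc2 (\<mu> i) = gc2 (\<mu>' i)"
    if \<mu>: "\<mu> \<in> {..<K} \<rightarrow>\<^sub>E S" "\<mu>' \<in> {..<K} \<rightarrow>\<^sub>E S" and i: "i < K"
      and le: "\<bar>obs2 K (P\<^sup>2) (r\<^sup>2) e2 f \<mu> i - obs2 K (P\<^sup>2) (r\<^sup>2) e2 f \<mu>' i\<bar> \<le> 2 * \<rho>" for \<mu> \<mu>' i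
  proof -
    have b: "(K - 1) * (\<Sum>k<K. gb (\<nu> k)) \<le> K * (K * B)" "gc2 (\<nu> i) \<le> C" "(\<Sum>k<K. gb (\<nu> k)) \<le> K * B"
      if "\<nu> \<in> {..<K} \<rightarrow>\<^sub>E S" for \<nu>
    proof -
      note m = tuple_app[OF that]
      show T: "(\<Sum>k<K. gb (\<nu> k)) \<le> K * B" by (intro sum_others_le gS m; assumption)+
      then show "(K - 1) * (\<Sum>k<K. gb (\<nu> k)) \<le> K * (K * B)" by (intro mult_le_mono) auto
      show "gc2 (\<nu> i) \<le> C" using gS m i by blast
    qed
    have "(K - 1) * (\<Sum>k<K. gb (\<mu> k)) = (K - 1) * (\<Sum>k<K. gb (\<mu>' k)) \<and> gc2 (\<mu> i) = gc2 (\<mu>' i)"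
      using digits[OF b(1)[OF \<mu>(1)] b(1)[OF \<mu>(2)] b(2)[OF \<mu>(1)] b(2)[OF \<mu>(2)]
          b(3)[OF \<mu>(1)] b(3)[OF \<mu>(2)] le[unfolded obs2[OF i]]] by blast
    \<comment> \<open>The total arrives K - 1 times; cancelling this factor requires K to be at
      least 2.\<close>
    then show ?thesis using K by simp
  qed
  have "two_slot_code K (P\<^sup>2) (r\<^sup>2) \<rho> S L e1 f e2"
  proof
    show "finite S" "S \<noteq> {}" "0 < L" by (auto simp: S_def L_def)
    have bd: "V1 * real x + V2 * real y \<le> r / 2" if "x \<le> C" "y \<le> (K + 1) * B" for x y
    proof -
      have "V1 * real x + V2 * real y \<le> V1 * real C + V2 * real ((K + 1) * B)"
        using that pos by (intro add_mono mult_left_mono) (simp_all only: of_nat_le_iff)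
      then show ?thesis using power by linarith
    qed
    have nn: "0 \<le> V1 * real x + V2 * real y" for x y using pos by simp
    show "\<bar>e1 m\<bar> \<le> 1 / 2" if "m \<in> S" for m
    proof -
      have "gb m \<le> (K + 1) * B" using gS(2)[OF that] by simp
      then have "V1 * gc m + V2 * gb m \<le> r / 2" using gS[OF that] by (intro bd)
      then show ?thesis using nn[of "gc m" "gb m"] pos by (simp add: e1_def abs_div_pos divide_le_eq)
    qed
    show "\<bar>e2 m l\<bar> \<le> 1 / 2" if "m \<in> S" "l < L" for m l
    proof -
      have "gb m + l \<le> (K + 1) * B" using gS(2)[OF that(1)] that(2) by (simp add: L_def)
      then have "V1 * gc2 m + V2 * real (gb m + l) \<le> r / 2" using gS[OF that(1)] by (intro bd)
      then show ?thesis using nn[of "gc2 m" "gb m + l"] pos by (simp add: e2_def abs_div_pos divide_le_eq)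
    qed
    show "f i \<mu> < L" if \<mu>: "\<mu> \<in> {..<K} \<rightarrow>\<^sub>E S" "i < K" for i \<mu>
    proof -
      have "f i \<mu> \<le> K * B" unfolding f_def by (intro sum_others_le gS tuple_app[OF \<mu>(1)])
      then show ?thesis by (simp add: L_def)
    qed
    show "f i \<mu> = f i \<mu>'" if "\<mu> \<in> {..<K} \<rightarrow>\<^sub>E S" "\<mu>' \<in> {..<K} \<rightarrow>\<^sub>E S" "i < K"
      "\<bar>obs1 K (P\<^sup>2) (r\<^sup>2) e1 \<mu> i - obs1 K (P\<^sup>2) (r\<^sup>2) e1 \<mu>' i\<bar> \<le> 2 * \<rho>" for \<mu> \<mu>' i
      using slot1[OF that] by (simp add: f_def)
    show "\<mu> i = \<mu>' i" if "\<mu> \<in> {..<K} \<rightarrow>\<^sub>E S" "\<mu>' \<in> {..<K} \<rightarrow>\<^sub>E S" "i < K"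
      "\<bar>obs1 K (P\<^sup>2) (r\<^sup>2) e1 \<mu> i - obs1 K (P\<^sup>2) (r\<^sup>2) e1 \<mu>' i\<bar> \<le> 2 * \<rho>"
      "\<bar>obs2 K (P\<^sup>2) (r\<^sup>2) e2 f \<mu> i - obs2 K (P\<^sup>2) (r\<^sup>2) e2 f \<mu>' i\<bar> \<le> 2 * \<rho>" for \<mu> \<mu>' i
    proof -
      note s1 = slot1[OF that(1-4)] and s2 = slot2[OF that(1-3,5)]
      have "gb (\<mu> i) = gb (\<mu>' i)"
        using s1 s2 sum_split_user[OF that(3), of "\<lambda>j. gb (\<mu> j)"] sum_split_user[OF that(3), of "\<lambda>j. gb (\<mu>' j)"]
        by linarith
      with s1 s2 show ?thesis by (intro g_inj) auto
    qed
  qed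
  then show ?thesis unfolding S_def L_def by blast
qed

section \<open>Choice of amplitudes and guard factors for the feedback codes\<close>

lemma of_nat_floor_le: "0 \<le> x \<Longrightarrow> real (nat \<lfloor>x\<rfloor>) \<le> x"
  by simp

lemma le_Suc_nat_floor: "x \<le> real (nat \<lfloor>x\<rfloor> + 1)"
  by linarith

text \<open>Summing K digits enlarges the alphabet by a factor of at most K + 1, which the guard
  already taken off the digit pays for. If the digit is trivial, the alphabet has size 1.\<close>

lemma feedback_size_le:
  fixes Z G :: real and K k :: nat
  assumes "1 \<le> Z" "real K + 1 \<le> G ^ k" "0 < G"
  shows "real (K * nat \<lfloor>Z / G ^ k\<rfloor> + 1) \<le> Z"
proof (cases "nat \<lfloor>Z / G ^ k\<rfloor> = 0")
  case False
  define B where "B = nat \<lfloor>Z / G ^ k\<rfloor>"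
  have B: "1 \<le> real B" "real B \<le> Z / G ^ k" using False assms by (auto simp: B_def)
  have "real (K * B + 1) \<le> (real K + 1) * real B" using B(1) by (simp add: algebra_simps)
  also have "\<dots> \<le> G ^ k * (Z / G ^ k)" using assms B by (intro mult_mono) auto
  also have "\<dots> = Z" using assms by simp
  finally show ?thesis by (simp add: B_def)
qed (use assms in simp)

text \<open>
  \<open>G\<close> is a guard factor, \<open>P / X\<close> the cross gain. In terms of exponents, \<open>X = P powr (1 - \<alpha>)\<close>,
  \<open>Y = P powr max 0 (2 * \<alpha> - 1)\<close> and \<open>Z \<le> P powr (2 * \<beta>)\<close> are the sizes of the private, the common
  and the feedback digit. If \<open>Y = 1\<close> the common digit is trivial since \<open>A = 0\<close>.
\<close>

lemma weak_scaled_code: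
  fixes G X Y Z P :: real and K :: nat
  defines "A \<equiv> nat \<lfloor>Y / G ^ 3\<rfloor>" and "B \<equiv> nat \<lfloor>Z / G ^ 5\<rfloor>" and "C \<equiv> nat \<lfloor>X / G ^ 3\<rfloor>"
  assumes K: "1 \<le> K" and G: "100 * (real K)\<^sup>2 \<le> G" and ge1: "1 \<le> X" "1 \<le> Y" "1 \<le> Z"
    and YZ: "Y * Z \<le> X" and XYZ: "X * Y * Z \<le> P" and XY: "X\<^sup>2 * Y \<le> P \<or> Y = 1"
  shows "\<exists>e1 f e2. two_slot_code K (P\<^sup>2) ((P / X)\<^sup>2) G ({..A} \<times> {..B} \<times> {..C} \<times> {..A} \<times> {..C}) (K * B + 1) e1 f e2"
proof -
  \<comment> \<open>E has to be an integer for the alignment h * U2 = U3 * E, with h = 1 / X and U3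
    = G ^ 2. Its size Y * G lifts U2 above the interfering common digits, which reach up to X *
    Y.\<close>
  define E where "E = nat \<lceil>Y * G\<rceil>"
  define U1 where "U1 = G ^ 2 * X ^ 2"
  define U2 where "U2 = G ^ 2 * E * X"
  have k: "1 \<le> real K" using K by simp
  have k2: "real K \<le> (real K)\<^sup>2" using mult_left_mono[OF k, of "real K"] by (simp add: power2_eq_square)
  have G100: "100 \<le> G" "100 * real K \<le> G" using k k2 G by linarith+
  have G0: "0 < G" and X0: "0 < X" and Y0: "0 < Y" and Z0: "0 < Z" using G100 ge1 by linarith+
  have X_le_P: "X \<le> P"
  proof -
    have "X * (1 * 1) \<le> X * (Y * Z)" using ge1 by (intro mult_left_mono mult_mono) auto
    then show ?thesis using XYZ by (simp add: mult.assoc)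
  qed
  have P0: "0 < P" using X_le_P X0 by linarith
  have YX: "Y \<le> X"
  proof -
    have "Y * 1 \<le> Y * Z" using ge1 Y0 by (intro mult_left_mono) auto
    then show ?thesis using YZ by simp
  qed
  have E: "Y * G \<le> real E" "real E \<le> 2 * (Y * G)" "0 < E"
  proof -
    have "1 * 1 \<le> Y * G" using ge1 G100 by (intro mult_mono) auto
    then show "Y * G \<le> real E" "real E \<le> 2 * (Y * G)" "0 < E" unfolding E_def by linarith+
  qed
  have A: "real A \<le> Y / G ^ 3" and B: "real B \<le> Z / G ^ 5" and C: "real C \<le> X / G ^ 3"
    unfolding A_def B_def C_def using ge1 G0 by (intro of_nat_floor_le; simp)+
  \<comment> \<open>Y * Z <= X keeps the aligned feedback digits on the private level below the
    interfering common digits, whose unit is G ^ 2 * X.\<close>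
  have EB: "real E * real B \<le> 2 * X / G ^ 4"
  proof -
    have "real E * real B \<le> (2 * (Y * G)) * (Z / G ^ 5)"
      using E B Y0 G0 by (intro mult_mono) auto
    also have "\<dots> = 2 * (Y * Z) / G ^ 4" using G0 by (simp add: field_simps power_numeral_reduce)
    also have "\<dots> \<le> 2 * X / G ^ 4" using YZ G0 by (intro divide_right_mono) auto
    finally show ?thesis .
  qed
  have inv: "P / X / P = 1 / X" using P0 by simp
  have V: "G\<^sup>2 * real (C + E * (K * (K * B))) \<le> X"
  proof -
    have "G\<^sup>2 * real (C + E * (K * (K * B))) = G\<^sup>2 * real C + G\<^sup>2 * (real K)\<^sup>2 * (real E * real B)"
      by (simp add: algebra_simps power2_eq_square)
    also have "\<dots> \<le> G\<^sup>2 * (X / G ^ 3) + G\<^sup>2 * (real K)\<^sup>2 * (2 * X / G ^ 4)"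
      using C EB by (intro add_mono mult_left_mono) auto
    also have "\<dots> = X * (1 / G) + X * (2 * ((real K)\<^sup>2 / G) * (1 / G))"
      using G0 by (simp add: field_simps power_numeral_reduce)
    also have "\<dots> \<le> X * (1 / 2) + X * (2 * (1 / 100) * 1)"
    proof (intro add_mono mult_left_mono mult_mono)
      show "(real K)\<^sup>2 / G \<le> 1 / 100" "1 / G \<le> 1 / 2" "1 / G \<le> 1" using G G100 G0 by (simp_all add: field_simps)
    qed (use X0 G0 in auto)
    also have "\<dots> \<le> X" using X0 by simp
    finally show ?thesis .
  qed
  have nu: "2 * G + 1 / X * G\<^sup>2 * real (K * C) \<le> 2 * G + 1"
  proof -
    have "1 / X * G\<^sup>2 * real (K * C) = (G\<^sup>2 * real K / X) * real C" by simp
    also have "\<dots> \<le> (G\<^sup>2 * real K / X) * (X / G ^ 3)" using C X0 by (intro mult_left_mono) auto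
    also have "\<dots> = real K / G" using X0 G0 by (simp add: field_simps power_numeral_reduce)
    also have "\<dots> \<le> 1" using G100 G0 k by (simp add: field_simps)
    finally show ?thesis by simp
  qed
  have UA: "U1 * (1 / X) * real (K * A) \<le> X * Y"
  proof -
    have "U1 * (1 / X) * real (K * A) = (G\<^sup>2 * X * real K) * real A"
      using X0 by (simp add: U1_def power2_eq_square)
    also have "\<dots> \<le> (G\<^sup>2 * X * real K) * (Y / G ^ 3)" using A X0 by (intro mult_left_mono) auto
    also have "\<dots> = X * Y * (real K / G)" using G0 by (simp add: field_simps power_numeral_reduce)
    also have "\<dots> \<le> X * Y * 1"
      using G100 G0 X0 Y0 k by (intro mult_left_mono) (auto simp: field_simps)
    finally show ?thesis by simp
  qed
  have U2B: "U2 * real B \<le> 2 * (X * Y * Z) / G\<^sup>2"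
  proof -
    have "U2 * real B \<le> (G\<^sup>2 * (2 * (Y * G)) * X) * (Z / G ^ 5)"
      unfolding U2_def using E B X0 Y0 G0 by (intro mult_mono mult_left_mono mult_right_mono) auto
    also have "\<dots> = 2 * (X * Y * Z) / G\<^sup>2" using G0 by (simp add: field_simps power_numeral_reduce)
    finally show ?thesis .
  qed
  have G2: "100 * G \<le> G\<^sup>2" using G100 G0 by (simp add: power2_eq_square)
  have X2: "X \<le> X\<^sup>2" "X * Y \<le> X\<^sup>2" "X * Y * Z \<le> X\<^sup>2" "X \<le> X * Y"
    using ge1 YX X0 YZ by (simp_all add: power2_eq_square mult.assoc)
  have scale: "G\<^sup>2 \<le> G\<^sup>2 * t \<and> 10000 * t \<le> G\<^sup>2 * t" if "1 \<le> t" for t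
  proof -
    have "10000 \<le> G\<^sup>2" using G2 G100 by linarith
    then show ?thesis using that mult_left_mono[OF that, of "G\<^sup>2"] mult_right_mono[of 10000 "G\<^sup>2" t] by simp
  qed
  have U2_ge: "G\<^sup>2 * (X * Y) \<le> U2"
  proof -
    have "G\<^sup>2 * (X * Y) * 1 \<le> G\<^sup>2 * (X * Y) * G" using G100 X0 Y0 by (intro mult_left_mono) auto
    also have "\<dots> = (G\<^sup>2 * X) * (Y * G)" by simp
    also have "\<dots> \<le> (G\<^sup>2 * X) * real E" using E(1) X0 by (intro mult_left_mono) auto
    finally show ?thesis by (simp add: U2_def mult_ac)
  qed
  have KG: "2 * real (K + 1) / G\<^sup>2 \<le> 1 / 25"
  proof -
    have "50 * real (K + 1) \<le> 100 * G" using k G100 by simp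
    then show ?thesis using G2 G0 by (simp add: field_simps)
  qed
  show ?thesis
    unfolding A_def[symmetric] B_def[symmetric] C_def[symmetric]
  proof (rule weak_feedback_code[where E = E and ?U1.0 = U1 and ?U2.0 = U2 and ?U3.0 = "G\<^sup>2", OF K])
    show "0 < P" "0 \<le> P / X" "0 \<le> U1" "0 \<le> U2" "0 \<le> G\<^sup>2" "0 < E"
      using P0 X0 E by (auto simp: U1_def U2_def)
    show "P / X / P * U2 = G\<^sup>2 * real E" unfolding inv using X0 by (simp add: U2_def)
    show "2 * G + P / X / P * G\<^sup>2 * real (K * C) < G\<^sup>2"
      unfolding inv using nu G2 G100 by linarith
    show "2 * G + P / X / P * G\<^sup>2 * real (K * C) + G\<^sup>2 * real (C + E * (K * (K * B))) < U1 * (P / X / P)"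
    proof -
      have "U1 * (1 / X) = G\<^sup>2 * X" using X0 by (simp add: U1_def power2_eq_square)
      then show ?thesis unfolding inv using nu V scale[OF ge1(1)] G2 G100 ge1(1) by linarith
    qed
    show "2 * G + P / X / P * G\<^sup>2 * real (K * C) + G\<^sup>2 * real (C + E * (K * (K * B)))
        + U1 * (P / X / P) * real (K * A) < U2"
    proof -
      have "1 \<le> X * Y" using ge1(1) X2(4) by linarith
      then show ?thesis unfolding inv using nu V UA U2_ge scale[of "X * Y"] G2 G100 X2(4) by linarith
    qed
    show "2 * G + P / X / P * G\<^sup>2 * real (K * C) + G\<^sup>2 * real (C + E * (K * (K * B)))
        + U1 * (P / X / P) * real (K * A) + U2 * real (K * B) < U1"
    proof -
      have "U2 * real (K * B) = real K * (U2 * real B)" by simp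
      also have "\<dots> \<le> real K * (2 * (X * Y * Z) / G\<^sup>2)" using U2B by (intro mult_left_mono) auto
      also have "\<dots> \<le> real (K + 1) * (2 * (X * Y * Z) / G\<^sup>2)" using X0 Y0 Z0 by (intro mult_right_mono) auto
      also have "\<dots> = (X * Y * Z) * (2 * real (K + 1) / G\<^sup>2)" by simp
      also have "\<dots> \<le> X\<^sup>2 * (1 / 25)" using KG X2(3) X0 Y0 Z0 by (intro mult_mono) auto
      finally have "U2 * real (K * B) \<le> X\<^sup>2 * (1 / 25)" .
      moreover have "1 \<le> X\<^sup>2" using ge1(1) X2(1) by linarith
      ultimately show ?thesis unfolding inv
        using nu V UA scale[of "X\<^sup>2"] G2 G100 X2 unfolding U1_def by linarith
    qed
    show "U1 * real A + U2 * real ((K + 1) * B) + G\<^sup>2 * real C \<le> P / 2"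
    proof -
      have "U1 * real A \<le> P / 100"
        using XY
      proof
        assume "X\<^sup>2 * Y \<le> P"
        have "U1 * real A \<le> (G\<^sup>2 * X\<^sup>2) * (Y / G ^ 3)"
          unfolding U1_def using A by (intro mult_left_mono) auto
        also have "\<dots> = (X\<^sup>2 * Y) / G" using G0 by (simp add: field_simps power_numeral_reduce)
        also have "\<dots> \<le> P / 100" using \<open>X\<^sup>2 * Y \<le> P\<close> G100 P0 by (intro frac_le) auto
        finally show ?thesis .
      next
        assume "Y = 1"
        have "1 < G ^ 3" using G100 by (intro one_less_power) auto
        then have "Y / G ^ 3 < 1" using \<open>Y = 1\<close> G0 by (simp add: divide_less_eq_1)
        then have "real A < 1" using A by linarith
        then show ?thesis using P0 by simp
      qed
      moreover have "U2 * real ((K + 1) * B) \<le> P / 25"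
      proof -
        have "U2 * real ((K + 1) * B) = real (K + 1) * (U2 * real B)" by (simp only: of_nat_mult mult_ac)
        also have "\<dots> \<le> real (K + 1) * (2 * (X * Y * Z) / G\<^sup>2)" using U2B by (intro mult_left_mono) auto
        also have "\<dots> = (X * Y * Z) * (2 * real (K + 1) / G\<^sup>2)" by simp
        also have "\<dots> \<le> P * (1 / 25)" using KG XYZ X0 Y0 Z0 P0 by (intro mult_mono) auto
        finally show ?thesis by simp
      qed
      moreover have "G\<^sup>2 * real C \<le> P / 100"
      proof -
        have "G\<^sup>2 * real C \<le> G\<^sup>2 * (X / G ^ 3)" using C by (intro mult_left_mono) auto
        also have "\<dots> = X / G" using G0 by (simp add: field_simps power_numeral_reduce)
        also have "\<dots> \<le> P / 100" using X_le_P G100 P0 by (intro frac_le) auto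
        finally show ?thesis .
      qed
      ultimately show ?thesis using P0 by linarith
    qed
  qed
qed

text \<open>Up to guards, the received range from 1 to P * W is divided as follows: the own common
  digit fills 1 to P, the interfering feedback digits P to P * Z, the interfering common digits W to
  P * W. These intervals are disjoint because P * Z <= W.\<close>

lemma strong_scaled_code:
  fixes G W Z P :: real and K :: nat
  defines "B \<equiv> nat \<lfloor>Z / G ^ 2\<rfloor>" and "C \<equiv> nat \<lfloor>P / G ^ 3\<rfloor>"
  assumes K: "2 \<le> K" and G: "100 * (real K)\<^sup>2 \<le> G" and ge1: "1 \<le> W" "1 \<le> Z" "G\<^sup>2 \<le> P"
    and PZ: "P * Z \<le> W"
  shows "\<exists>e1 f e2. two_slot_code K (P\<^sup>2) ((P * W)\<^sup>2) G ({..C} \<times> {..B} \<times> {..C}) (K * B + 1) e1 f e2"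
proof -
  define V1 where "V1 = G\<^sup>2 * W"
  have k: "1 \<le> real K" using K by simp
  have k2: "real K \<le> (real K)\<^sup>2" using mult_left_mono[OF k, of "real K"] by (simp add: power2_eq_square)
  have G100: "100 \<le> G" "100 * real K \<le> G" using k k2 G by linarith+
  have G0: "0 < G" and W0: "0 < W" and Z0: "0 < Z" using G100 ge1 by linarith+
  have G2: "100 * G \<le> G\<^sup>2" using G100 G0 by (simp add: power2_eq_square)
  have P0: "0 < P" "10000 \<le> P" using G2 G100 ge1 by linarith+
  have PW: "P \<le> W"
    using mult_left_mono[OF ge1(2), of P] P0 PZ by linarith
  have inv: "P / (P * W) = 1 / W" using P0 by simp
  have B: "real B \<le> Z / G\<^sup>2" and C: "real C \<le> P / G ^ 3"
    unfolding B_def C_def using ge1 P0 G0 by (intro of_nat_floor_le; simp)+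
  have PB: "P * real B \<le> W / G\<^sup>2"
  proof -
    have "P * real B \<le> P * (Z / G\<^sup>2)" using B P0 by (intro mult_left_mono) auto
    also have "\<dots> = P * Z / G\<^sup>2" by simp
    also have "\<dots> \<le> W / G\<^sup>2" using PZ by (intro divide_right_mono) auto
    finally show ?thesis .
  qed
  have K2: "(real K)\<^sup>2 / G\<^sup>2 \<le> 1 / 100" "real K / G\<^sup>2 \<le> 1" "real (K + 1) / G\<^sup>2 \<le> 1 / 25"
    using G G2 G100 G0 k by (simp_all add: field_simps)
  have nu: "2 * G + 1 / W * P * real (K * B) \<le> 2 * G + 1"
  proof -
    have "1 / W * P * real (K * B) = (real K / W) * (P * real B)" by simp
    also have "\<dots> \<le> (real K / W) * (W / G\<^sup>2)" using PB W0 by (intro mult_left_mono) auto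
    also have "\<dots> = real K / G\<^sup>2" using W0 by simp
    finally show ?thesis using K2 by linarith
  qed
  have V1C: "1 / W * V1 * real C \<le> P / 100"
  proof -
    have "1 / W * V1 * real C = G\<^sup>2 * real C" using W0 by (simp add: V1_def)
    also have "\<dots> \<le> G\<^sup>2 * (P / G ^ 3)" using C by (intro mult_left_mono) auto
    also have "\<dots> = P / G" using G0 by (simp add: field_simps power_numeral_reduce)
    also have "\<dots> \<le> P / 100" using G100 P0 by (intro frac_le) auto
    finally show ?thesis .
  qed
  show ?thesis
  proof (rule strong_feedback_code[where ?V1.0 = V1 and ?V2.0 = P, OF K])
    show "0 < P * W" "0 \<le> P" "0 \<le> V1" "0 \<le> P" using P0 W0 by (auto simp: V1_def)
    show "2 * G + P / (P * W) * P * real (K * B) < P / (P * W) * V1"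
    proof -
      have "1 / W * V1 = G\<^sup>2" using W0 by (simp add: V1_def)
      then show ?thesis unfolding inv using nu G2 G100 by linarith
    qed
    show "2 * G + P / (P * W) * P * real (K * B) + P / (P * W) * V1 * real C < P"
      unfolding inv using nu V1C G2 G100 ge1(3) by linarith
    show "2 * G + P / (P * W) * P * real (K * B) + P / (P * W) * V1 * real C + P * real (K * (K * B)) < V1"
    proof -
      have "P * real (K * (K * B)) = (real K)\<^sup>2 * (P * real B)" by (simp add: power2_eq_square)
      also have "\<dots> \<le> (real K)\<^sup>2 * (W / G\<^sup>2)" using PB by (intro mult_left_mono) auto
      also have "\<dots> = W * ((real K)\<^sup>2 / G\<^sup>2)" by simp
      also have "\<dots> \<le> W * (1 / 100)" using K2 W0 by (intro mult_left_mono) auto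
      finally have "P * real (K * (K * B)) \<le> W * (1 / 100)" .
      moreover have "10000 * W \<le> V1" unfolding V1_def using G2 G100 W0 by (intro mult_right_mono) auto
      ultimately show ?thesis unfolding inv using nu V1C G2 G100 ge1(3) PW P0 W0 by linarith
    qed
    show "V1 * real C + P * real ((K + 1) * B) \<le> P * W / 2"
    proof -
      have "V1 * real C = W * (1 / W * V1 * real C)" using W0 by simp
      also have "\<dots> \<le> W * (P / 100)" using V1C W0 by (intro mult_left_mono) auto
      finally have "V1 * real C \<le> P * W / 100" by (simp add: mult.commute)
      moreover have "P * real ((K + 1) * B) \<le> P * W / 25"
      proof -
        have "P * real ((K + 1) * B) = real (K + 1) * (P * real B)" by (simp only: of_nat_mult mult_ac)
        also have "\<dots> \<le> real (K + 1) * (W / G\<^sup>2)" using PB by (intro mult_left_mono) auto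
        also have "\<dots> = W * (real (K + 1) / G\<^sup>2)" by simp
        also have "\<dots> \<le> W * (1 / 25)" using K2(3) W0 by (intro mult_left_mono) auto
        also have "\<dots> \<le> (P * W) * (1 / 25)" using P0 W0 by (intro mult_right_mono) auto
        finally show ?thesis by simp
      qed
      moreover have "0 < P * W" using P0 W0 by simp
      ultimately show ?thesis by linarith
    qed
  qed
qed

text \<open>The hypotheses \<open>le\<close> are Y * Z <= X and X * Y * Z <= P in exponents, and the
  one on \<kappa> is the power condition for the common digit. Common and private digits are sent in
  both uses but the feedback digit counts once, hence b / 2 in the rate.\<close>

lemma weak_codes:
  fixes \<alpha> \<beta> \<kappa> b D' :: real
  assumes K: "1 \<le> K" and \<alpha>: "0 \<le> \<alpha>" "\<alpha> \<le> 1" and \<kappa>: "0 \<le> \<kappa>" and b: "0 \<le> b" "b \<le> 2 * \<beta>"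
    and le: "\<kappa> + b \<le> 1 - \<alpha>" "\<kappa> + b \<le> \<alpha>" and \<kappa>': "2 * (1 - \<alpha>) + \<kappa> \<le> 1 \<or> \<kappa> = 0"
    and D': "D' < \<kappa> + 1 - \<alpha> + b / 2"
  shows "\<exists>\<eta>>0. \<forall>\<^sub>F P in at_top. \<exists>(S :: (nat \<times> nat \<times> nat \<times> nat \<times> nat) set) F e1 f e2.
       two_slot_code K (P\<^sup>2) ((P powr \<alpha>)\<^sup>2) (P powr \<eta>) S F e1 f e2 \<and>
       real F \<le> P powr (2 * \<beta>) \<and> P powr (2 * D') \<le> real (card S)"
proof -
  \<comment> \<open>17 = 3 + 5 + 3 + 3 + 3 counts the guard factors of the five digits, so the
    exponents add up to exactly 2 * D'.\<close>
  define \<eta> where "\<eta> = (2 * \<kappa> + 2 * (1 - \<alpha>) + b - 2 * D') / 17"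
  have \<eta>: "0 < \<eta>" using D' by (simp add: \<eta>_def)
  have large: "\<forall>\<^sub>F P in at_top. 100 * (real K)\<^sup>2 \<le> P powr \<eta>" using \<eta> by real_asymp
  show ?thesis
  proof (intro exI[of _ \<eta>] conjI \<eta>)
    show "\<forall>\<^sub>F P in at_top. \<exists>(S :: (nat \<times> nat \<times> nat \<times> nat \<times> nat) set) F e1 f e2.
       two_slot_code K (P\<^sup>2) ((P powr \<alpha>)\<^sup>2) (P powr \<eta>) S F e1 f e2 \<and>
       real F \<le> P powr (2 * \<beta>) \<and> P powr (2 * D') \<le> real (card S)"
      using large eventually_ge_at_top[of 1]
    proof eventually_elim
      case (elim P)
      define G where "G = P powr \<eta>"
      define X where "X = P powr (1 - \<alpha>)"
      define Y where "Y = P powr \<kappa>"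
      define Z where "Z = P powr b"
      define A where "A = nat \<lfloor>Y / G ^ 3\<rfloor>"
      define B where "B = nat \<lfloor>Z / G ^ 5\<rfloor>"
      define C where "C = nat \<lfloor>X / G ^ 3\<rfloor>"
      have P: "1 \<le> P" "0 < P" using elim by auto
      have mono: "P powr u \<le> P powr v" if "u \<le> v" for u v using P that by (intro powr_mono)
      have ge1: "1 \<le> X" "1 \<le> Y" "1 \<le> Z"
        using P \<alpha> \<kappa> b by (auto simp: X_def Y_def Z_def ge_one_powr_ge_zero)
      have G: "100 * (real K)\<^sup>2 \<le> G" using elim by (simp add: G_def)
      have Gpow: "G ^ n = P powr (n * \<eta>)" for n
        using P by (simp add: G_def powr_realpow[symmetric] powr_powr mult.commute)
      have PX: "P / X = P powr \<alpha>" using P by (simp add: X_def powr_diff)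
      have "P powr 1 = P" using P by simp
      have "\<exists>e1 f e2. two_slot_code K (P\<^sup>2) ((P / X)\<^sup>2) G ({..A} \<times> {..B} \<times> {..C} \<times> {..A} \<times> {..C}) (K * B + 1) e1 f e2"
        unfolding A_def B_def C_def
      proof (rule weak_scaled_code[OF K G ge1])
        show "Y * Z \<le> X" unfolding X_def Y_def Z_def powr_add[symmetric] by (rule mono[OF le(1)])
        have "X * Y * Z \<le> P powr 1"
          unfolding X_def Y_def Z_def powr_add[symmetric] using le(2) by (intro mono) simp
        then show "X * Y * Z \<le> P" using P by simp
        show "X\<^sup>2 * Y \<le> P \<or> Y = 1"
          using \<kappa>'
        proof
          assume *: "2 * (1 - \<alpha>) + \<kappa> \<le> 1"
          have "X\<^sup>2 * Y \<le> P powr 1"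
            unfolding X_def Y_def power2_eq_square powr_add[symmetric] using * by (intro mono) simp
          then show ?thesis using P by simp
        qed (use P in \<open>simp add: Y_def\<close>)
      qed
      moreover have "real (K * B + 1) \<le> P powr (2 * \<beta>)"
      proof -
        have k: "1 \<le> real K" using K by simp
        have k2: "real K \<le> (real K)\<^sup>2" using mult_left_mono[OF k, of "real K"] by (simp add: power2_eq_square)
        have G1: "1 \<le> G" "real K + 1 \<le> G" using k k2 G by linarith+
        have "G ^ 1 \<le> G ^ 5" using G1 by (intro power_increasing) auto
        then have "real (K * B + 1) \<le> Z" unfolding B_def using G1 ge1 by (intro feedback_size_le) auto
        also have "\<dots> \<le> P powr (2 * \<beta>)" unfolding Z_def by (rule mono[OF b(2)])
        finally show ?thesis .
      qed
      moreover have "P powr (2 * D') \<le> real (card ({..A} \<times> {..B} \<times> {..C} \<times> {..A} \<times> {..C}))"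
      proof -
        have a: "Y / G ^ 3 \<le> real (A + 1)" "Z / G ^ 5 \<le> real (B + 1)" "X / G ^ 3 \<le> real (C + 1)"
          unfolding A_def B_def C_def by (rule le_Suc_nat_floor)+
        have p: "Y / G ^ 3 = P powr (\<kappa> - 3 * \<eta>)" "Z / G ^ 5 = P powr (b - 5 * \<eta>)"
          "X / G ^ 3 = P powr (1 - \<alpha> - 3 * \<eta>)"
          unfolding Gpow X_def Y_def Z_def by (simp_all add: powr_diff)
        have "P powr (2 * D') = P powr (\<kappa> - 3 * \<eta>) * (P powr (b - 5 * \<eta>) * (P powr (1 - \<alpha> - 3 * \<eta>)
            * (P powr (\<kappa> - 3 * \<eta>) * P powr (1 - \<alpha> - 3 * \<eta>))))"
          unfolding powr_add[symmetric] by (intro arg_cong2[where f = "(powr)"] refl) (simp add: \<eta>_def field_simps)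
        also have "\<dots> \<le> real (A + 1) * (real (B + 1) * (real (C + 1) * (real (A + 1) * real (C + 1))))"
          using a unfolding p by (intro mult_mono) auto
        also have "\<dots> = real (card ({..A} \<times> {..B} \<times> {..C} \<times> {..A} \<times> {..C}))"
          by (simp only: card_cartesian_product card_atMost of_nat_mult Suc_eq_plus1)
        finally show ?thesis .
      qed
      ultimately show ?case unfolding PX G_def by blast
    qed
  qed
qed

lemma strong_codes:
  fixes \<alpha> \<beta> b D' :: real
  assumes K: "2 \<le> K" and b: "0 \<le> b" "b \<le> 2 * \<beta>" "b \<le> \<alpha> - 2" and D': "D' < 1 + b / 2"
  shows "\<exists>\<eta>>0. \<forall>\<^sub>F P in at_top. \<exists>(S :: (nat \<times> nat \<times> nat) set) F e1 f e2.
       two_slot_code K (P\<^sup>2) ((P powr \<alpha>)\<^sup>2) (P powr \<eta>) S F e1 f e2 \<and>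
       real F \<le> P powr (2 * \<beta>) \<and> P powr (2 * D') \<le> real (card S)"
proof -
  \<comment> \<open>8 = 3 + 2 + 3 counts the guard factors of the three digits; the bound 1 / 2
    ensures G ^ 2 <= P.\<close>
  define \<eta> where "\<eta> = min (1 / 2) ((2 + b - 2 * D') / 8)"
  have \<eta>: "0 < \<eta>" "2 * \<eta> \<le> 1" "8 * \<eta> \<le> 2 + b - 2 * D'" using D' by (auto simp: \<eta>_def min_def)
  have large: "\<forall>\<^sub>F P in at_top. 100 * (real K)\<^sup>2 \<le> P powr \<eta>" using \<eta> by real_asymp
  show ?thesis
  proof (intro exI[of _ \<eta>] conjI \<eta>)
    show "\<forall>\<^sub>F P in at_top. \<exists>(S :: (nat \<times> nat \<times> nat) set) F e1 f e2.
       two_slot_code K (P\<^sup>2) ((P powr \<alpha>)\<^sup>2) (P powr \<eta>) S F e1 f e2 \<and>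
       real F \<le> P powr (2 * \<beta>) \<and> P powr (2 * D') \<le> real (card S)"
      using large eventually_ge_at_top[of 1]
    proof eventually_elim
      case (elim P)
      define G where "G = P powr \<eta>"
      define W where "W = P powr (\<alpha> - 1)"
      define Z where "Z = P powr b"
      define B where "B = nat \<lfloor>Z / G ^ 2\<rfloor>"
      define C where "C = nat \<lfloor>P / G ^ 3\<rfloor>"
      have P: "1 \<le> P" "0 < P" using elim by auto
      have P1: "P powr 1 = P" using P by simp
      have mono: "P powr u \<le> P powr v" if "u \<le> v" for u v using P that by (intro powr_mono)
      have ge1: "1 \<le> W" "1 \<le> Z" using P b by (auto simp: W_def Z_def ge_one_powr_ge_zero)
      have G: "100 * (real K)\<^sup>2 \<le> G" using elim by (simp add: G_def)
      have Gpow: "G ^ n = P powr (n * \<eta>)" for n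
        using P by (simp add: G_def powr_realpow[symmetric] powr_powr mult.commute)
      have PW: "P * W = P powr \<alpha>" using P by (simp add: W_def powr_diff)
      have G2: "G\<^sup>2 \<le> P"
        using mono[of "2 * \<eta>" 1] \<eta>(2) P1 by (simp add: Gpow)
      have "\<exists>e1 f e2. two_slot_code K (P\<^sup>2) ((P * W)\<^sup>2) G ({..C} \<times> {..B} \<times> {..C}) (K * B + 1) e1 f e2"
        unfolding B_def C_def
      proof (rule strong_scaled_code[OF K G ge1 G2])
        have "P powr 1 * Z \<le> W"
          unfolding W_def Z_def powr_add[symmetric] using b(3) by (intro mono) simp
        then show "P * Z \<le> W" using P1 by simp
      qed
      moreover have "real (K * B + 1) \<le> P powr (2 * \<beta>)"
      proof -
        have k: "1 \<le> real K" using K by simp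
        have k2: "real K \<le> (real K)\<^sup>2" using mult_left_mono[OF k, of "real K"] by (simp add: power2_eq_square)
        have G1: "1 \<le> G" "real K + 1 \<le> G" using k k2 G by linarith+
        have "G ^ 1 \<le> G ^ 2" using G1 by (intro power_increasing) auto
        then have "real (K * B + 1) \<le> Z" unfolding B_def using G1 ge1 by (intro feedback_size_le) auto
        also have "\<dots> \<le> P powr (2 * \<beta>)" unfolding Z_def by (rule mono[OF b(2)])
        finally show ?thesis .
      qed
      moreover have "P powr (2 * D') \<le> real (card ({..C} \<times> {..B} \<times> {..C}))"
      proof -
        have a: "Z / G ^ 2 \<le> real (B + 1)" "P / G ^ 3 \<le> real (C + 1)"
          unfolding B_def C_def by (rule le_Suc_nat_floor)+
        have p: "Z / G ^ 2 = P powr (b - 2 * \<eta>)" "P / G ^ 3 = P powr (1 - 3 * \<eta>)"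
          unfolding Gpow Z_def using P1 by (simp_all add: powr_diff)
        have "P powr (2 * D') \<le> P powr (1 - 3 * \<eta>) * (P powr (b - 2 * \<eta>) * P powr (1 - 3 * \<eta>))"
          unfolding powr_add[symmetric] using \<eta>(3) by (intro mono) simp
        also have "\<dots> \<le> real (C + 1) * (real (B + 1) * real (C + 1))"
          using a unfolding p by (intro mult_mono) auto
        also have "\<dots> = real (card ({..C} \<times> {..B} \<times> {..C}))"
          by (simp only: card_cartesian_product card_atMost of_nat_mult Suc_eq_plus1)
        finally show ?thesis .
      qed
      ultimately show ?case unfolding PW G_def by blast
    qed
  qed
qed

section \<open>Codes without feedback\<close>

lemma emeasure_slab_le:
  fixes a c \<delta> :: real
  assumes "a \<noteq> 0" "0 < \<delta>"
  shows "emeasure (restrict_space lborel {0..1}) {y \<in> {0..1}. \<bar>c + y * a\<bar> < \<delta>} \<le> ennreal (2 * \<delta> / \<bar>a\<bar>)"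
proof -
  have sub: "{y \<in> {0..1}. \<bar>c + y * a\<bar> < \<delta>} \<subseteq> {- c / a - \<delta> / \<bar>a\<bar> <..< - c / a + \<delta> / \<bar>a\<bar>}"
  proof
    fix y assume "y \<in> {y \<in> {0..1}. \<bar>c + y * a\<bar> < \<delta>}"
    then have "\<bar>c + y * a\<bar> / \<bar>a\<bar> < \<delta> / \<bar>a\<bar>" using assms by (simp add: divide_strict_right_mono)
    also have "\<bar>c + y * a\<bar> / \<bar>a\<bar> = \<bar>y - (- c / a)\<bar>"
      using assms by (simp add: abs_divide[symmetric] add_divide_distrib add.commute)
    finally show "y \<in> {- c / a - \<delta> / \<bar>a\<bar> <..< - c / a + \<delta> / \<bar>a\<bar>}" by (auto simp: abs_less_iff)
  qed
  have "emeasure (restrict_space lborel {0..1}) {y \<in> {0..1}. \<bar>c + y * a\<bar> < \<delta>}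
      = emeasure lborel {y \<in> {0..1}. \<bar>c + y * a\<bar> < \<delta>}"
    by (rule emeasure_restrict_space) auto
  also have "\<dots> \<le> emeasure lborel {- c / a - \<delta> / \<bar>a\<bar> <..< - c / a + \<delta> / \<bar>a\<bar>}"
    by (rule emeasure_mono[OF sub]) simp
  also have "\<dots> = ennreal (2 * \<delta> / \<bar>a\<bar>)" using assms by simp
  finally show ?thesis .
qed

text \<open>Probabilistic method with uniform coefficients in the unit cube: a linear form with a
  coefficient of size at least \<open>m j\<close> is smaller than \<delta> with probability at most
  2 * \<delta> / \<open>m j\<close>, and a union bound leaves a common good choice.\<close>

lemma exists_coefficients:
  fixes v :: "'i \<Rightarrow> nat \<Rightarrow> real" and \<delta> :: real
  assumes I: "finite I" and \<delta>: "0 < \<delta>"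
    and m: "\<And>j. j \<in> I \<Longrightarrow> 0 < m j \<and> (\<exists>k<N. m j \<le> \<bar>v j k\<bar>)"
    and sum: "(\<Sum>j\<in>I. 2 * \<delta> / m j) < 1"
  shows "\<exists>g. (\<forall>k<N. 0 \<le> g k \<and> g k \<le> 1) \<and> (\<forall>j\<in>I. \<delta> \<le> \<bar>\<Sum>k<N. g k * v j k\<bar>)"
proof -
  define U where "U = restrict_space lborel {0..1::real}"
  define M where "M = (\<Pi>\<^sub>M k\<in>{..<N}. U)"
  have spU: "space U = {0..1}" by (simp add: U_def space_restrict_space)
  interpret U: prob_space U
    by standard (simp add: spU, simp add: U_def emeasure_restrict_space)
  interpret P: product_prob_space "\<lambda>_::nat. U" "{..<N}"
    by (simp add: product_prob_space_def product_prob_space_axioms_def product_sigma_finite_def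
        U.prob_space_axioms U.sigma_finite_measure_axioms)
  have prob: "emeasure (Pi\<^sub>M J (\<lambda>_. U)) (space (Pi\<^sub>M J (\<lambda>_. U))) = 1" for J :: "nat set"
    by (intro prob_space.emeasure_space_1 prob_space_PiM U.prob_space_axioms)
  have idU: "(\<lambda>y. y) \<in> borel_measurable U"
    unfolding U_def by (intro measurable_restrict_space1) simp
  have comp: "(\<lambda>g. g k) \<in> borel_measurable (Pi\<^sub>M J (\<lambda>_. U))" if "k \<in> J" for k J
    using measurable_compose[OF measurable_component_singleton[OF that] idU] by simp
  let ?bad = "\<lambda>j. {g \<in> space M. \<bar>\<Sum>k<N. g k * v j k\<bar> < \<delta>}"
  have meas: "?bad j \<in> sets M" for j
  proof -
    have "(\<lambda>g. \<Sum>k<N. g k * v j k) \<in> borel_measurable M"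
      unfolding M_def by (intro borel_measurable_sum borel_measurable_times comp borel_measurable_const) auto
    then show ?thesis by measurable
  qed
  have bad: "emeasure M (?bad j) \<le> ennreal (2 * \<delta> / m j)" if j: "j \<in> I" for j
  proof -
    obtain k where k: "k < N" "m j \<le> \<bar>v j k\<bar>" and mj: "0 < m j" using m[OF j] by blast
    define J where "J = {..<N} - {k}"
    have ins: "{..<N} = insert k J" and kJ: "k \<notin> J" "finite J" using k by (auto simp: J_def)
    have "emeasure M (?bad j) = (\<integral>\<^sup>+g. indicator (?bad j) g \<partial>M)" using meas by simp
    \<comment> \<open>Fubini with the coordinate of the large coefficient innermost: with the others
      fixed, the bad event is an interval.\<close>
    also have "\<dots> = (\<integral>\<^sup>+x. (\<integral>\<^sup>+y. indicator (?bad j) (x(k := y)) \<partial>U) \<partial>Pi\<^sub>M J (\<lambda>_. U))"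
      unfolding M_def ins using kJ meas[of j] unfolding M_def ins
      by (intro P.product_nn_integral_insert) auto
    also have "\<dots> \<le> (\<integral>\<^sup>+x. ennreal (2 * \<delta> / m j) \<partial>Pi\<^sub>M J (\<lambda>_. U))"
    proof (rule nn_integral_mono)
      fix x assume x: "x \<in> space (Pi\<^sub>M J (\<lambda>_. U))"
      define c where "c = (\<Sum>l\<in>J. x l * v j l)"
      have s: "(\<Sum>l<N. (x(k := y)) l * v j l) = c + y * v j k" for y
      proof -
        have "(\<Sum>l\<in>J. (x(k := y)) l * v j l) = c" unfolding c_def using kJ by (intro sum.cong) auto
        then show ?thesis unfolding ins using kJ by simp
      qed
      let ?S = "{y \<in> {0..1}. \<bar>c + y * v j k\<bar> < \<delta>}"
      have mS: "?S \<in> sets U"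
        unfolding U_def by (subst sets_restrict_space_iff) auto
      have "(\<integral>\<^sup>+y. indicator (?bad j) (x(k := y)) \<partial>U) \<le> (\<integral>\<^sup>+y. indicator ?S y \<partial>U)"
        by (intro nn_integral_mono) (auto simp: indicator_def s spU simp del: fun_upd_apply)
      also have "\<dots> = emeasure U ?S" using mS by simp
      also have "\<dots> \<le> ennreal (2 * \<delta> / \<bar>v j k\<bar>)"
        unfolding U_def by (rule emeasure_slab_le) (use k mj \<delta> in auto)
      also have "\<dots> \<le> ennreal (2 * \<delta> / m j)"
        using k mj \<delta> by (intro ennreal_leI divide_left_mono) auto
      finally show "(\<integral>\<^sup>+y. indicator (?bad j) (x(k := y)) \<partial>U) \<le> ennreal (2 * \<delta> / m j)" .
    qed
    also have "\<dots> = ennreal (2 * \<delta> / m j)" using prob by simp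
    finally show ?thesis .
  qed
  have "emeasure M (\<Union>j\<in>I. ?bad j) \<le> (\<Sum>j\<in>I. emeasure M (?bad j))"
    using I meas by (intro emeasure_subadditive_finite) auto
  also have "\<dots> \<le> (\<Sum>j\<in>I. ennreal (2 * \<delta> / m j))" by (intro sum_mono bad)
  also have "\<dots> = ennreal (\<Sum>j\<in>I. 2 * \<delta> / m j)"
    using m \<delta> by (intro sum_ennreal) (auto intro!: divide_nonneg_pos)
  also have "\<dots> < ennreal 1" using sum by (simp add: ennreal_less_iff sum_nonneg m \<delta> less_imp_le)
  finally have "emeasure M (\<Union>j\<in>I. ?bad j) < emeasure M (space M)" using prob by (simp add: M_def)
  moreover have "emeasure M (space M) \<le> emeasure M (\<Union>j\<in>I. ?bad j)" if "space M \<subseteq> (\<Union>j\<in>I. ?bad j)"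
    by (rule emeasure_mono[OF that]) (intro sets.finite_UN I meas)
  ultimately have "\<not> space M \<subseteq> (\<Union>j\<in>I. ?bad j)" by (meson not_le)
  then obtain g where gM: "g \<in> space M" and "g \<notin> (\<Union>j\<in>I. ?bad j)" by blast
  then have "\<not> \<bar>\<Sum>k<N. g k * v j k\<bar> < \<delta>" if "j \<in> I" for j using that by blast
  then have g: "g \<in> space M" "\<And>j. j \<in> I \<Longrightarrow> \<delta> \<le> \<bar>\<Sum>k<N. g k * v j k\<bar>"
    using gM by (simp_all only: not_less)
  then show ?thesis by (intro exI[of _ g]) (auto simp: M_def space_PiM PiE_iff spU)
qed

text \<open>
  The union bound separates the cases \<open>u = 0\<close> and \<open>u \<noteq> 0\<close>: the slabs of the former are wider by the
  factor \<open>1 / h\<close>, but there are only about \<open>B ^ N\<close> of them instead of \<open>B ^ (2 * N)\<close>. This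
  trade-off is what requires \<open>2 / 3 < \<alpha> < 2\<close>.
\<close>

lemma lattice_coefficients:
  fixes h \<delta> :: real and N B :: nat
  assumes h: "0 < h" "h * B \<le> 1 / 2" and B: "1 \<le> B" and \<delta>: "0 < \<delta>"
    and count: "(3 * real B) ^ (2 * N) * (4 * \<delta>) + (3 * real B) ^ N * (2 * \<delta> / h) < 1"
  shows "\<exists>g. (\<forall>k<N. 0 \<le> g k \<and> g k \<le> 1) \<and>
    (\<forall>u w :: nat \<Rightarrow> int. (\<forall>k<N. \<bar>u k\<bar> \<le> int B \<and> \<bar>w k\<bar> \<le> int B) \<longrightarrow> (\<exists>k<N. u k \<noteq> 0 \<or> w k \<noteq> 0) \<longrightarrow>
      \<delta> \<le> \<bar>\<Sum>k<N. g k * (u k + h * w k)\<bar>)"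
proof -
  define U where "U = {..<N} \<rightarrow>\<^sub>E {- int B..int B}"
  define z where "z = (\<lambda>k\<in>{..<N}. 0::int)"
  define I where "I = U \<times> U - {(z, z)}"
  define v where "v = (\<lambda>(u, w) (k::nat). real_of_int (u k) + h * real_of_int (w k :: int))"
  \<comment> \<open>If u is nonzero, some |u k + h * w k| is at least 1 - h * B, thus at least 1 /
    2. If u = 0, only h is guaranteed.\<close>
  define m where "m = (\<lambda>(u, w :: nat \<Rightarrow> int). if u \<noteq> z then 1 / 2 else h)"
  have finU: "finite U" unfolding U_def by (intro finite_PiE) auto
  have cardU: "real (card U) \<le> (3 * real B) ^ N"
  proof -
    have "real (card U) = real (2 * B + 1) ^ N" by (simp add: U_def card_PiE add.commute)
    also have "\<dots> \<le> (3 * real B) ^ N" using B by (intro power_mono) auto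
    finally show ?thesis .
  qed
  have ne: "\<exists>k<N. u k \<noteq> 0" if "u \<in> U" "u \<noteq> z" for u
    using that by (auto simp: U_def z_def PiE_iff extensional_def fun_eq_iff) (metis)
  have mv: "0 < m j \<and> (\<exists>k<N. m j \<le> \<bar>v j k\<bar>)" if j: "j \<in> I" for j
  proof -
    obtain u w where uw: "j = (u, w)" "u \<in> U" "w \<in> U" "(u, w) \<noteq> (z, z)" using j by (auto simp: I_def)
    show ?thesis
    proof (cases "u = z")
      case False
      then obtain k where k: "k < N" "u k \<noteq> 0" using ne uw by blast
      have "w k \<in> {- int B..int B}" by (rule PiE_mem[OF uw(3)[unfolded U_def]]) (simp add: k)
      then have "\<bar>real_of_int (w k)\<bar> \<le> real B" by (auto simp: abs_le_iff)
      then have "\<bar>h * real_of_int (w k)\<bar> \<le> h * real B" using h by (simp add: abs_mult)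
      moreover have "1 \<le> \<bar>real_of_int (u k)\<bar>" using k(2) by linarith
      ultimately have "1 / 2 \<le> \<bar>v j k\<bar>" using h(2) unfolding v_def uw(1) prod.case by linarith
      then show ?thesis using k False by (auto simp: m_def uw(1))
    next
      case True
      then obtain k where k: "k < N" "w k \<noteq> 0" using ne uw by blast
      have "1 \<le> \<bar>real_of_int (w k)\<bar>" using k(2) by linarith
      then have "h * 1 \<le> \<bar>h * real_of_int (w k)\<bar>" using h by (simp add: abs_mult)
      then have "h \<le> \<bar>v j k\<bar>" using True k by (simp add: v_def uw(1) z_def)
      then show ?thesis using k True h by (auto simp: m_def uw(1))
    qed
  qed
  have "(\<Sum>j\<in>I. 2 * \<delta> / m j) \<le> (\<Sum>j\<in>U \<times> U. 4 * \<delta>) + (\<Sum>j\<in>{z} \<times> U. 2 * \<delta> / h)"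
  proof -
    have "(\<Sum>j\<in>I. 2 * \<delta> / m j) \<le> (\<Sum>j\<in>I. 4 * \<delta> + (if j \<in> {z} \<times> U then 2 * \<delta> / h else 0))"
      using \<delta> h by (intro sum_mono) (auto simp: m_def I_def)
    also have "\<dots> \<le> (\<Sum>j\<in>U \<times> U. 4 * \<delta> + (if j \<in> {z} \<times> U then 2 * \<delta> / h else 0))"
      using finU \<delta> h by (intro sum_mono2) (auto simp: I_def)
    also have "\<dots> = (\<Sum>j\<in>U \<times> U. 4 * \<delta>) + (\<Sum>j\<in>(U \<times> U) \<inter> ({z} \<times> U). 2 * \<delta> / h)"
      using finU by (subst sum.inter_restrict) (auto simp: sum.distrib)
    also have "(\<Sum>j\<in>(U \<times> U) \<inter> ({z} \<times> U). 2 * \<delta> / h) \<le> (\<Sum>j\<in>{z} \<times> U. 2 * \<delta> / h)"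
      using finU \<delta> h by (intro sum_mono2) auto
    finally show ?thesis by simp
  qed
  also have "\<dots> = (real (card U) * real (card U)) * (4 * \<delta>) + real (card U) * (2 * \<delta> / h)"
    by (simp only: sum_constant card_cartesian_product of_nat_mult) simp
  also have "\<dots> \<le> ((3 * real B) ^ N * (3 * real B) ^ N) * (4 * \<delta>) + (3 * real B) ^ N * (2 * \<delta> / h)"
    using cardU \<delta> h by (intro add_mono mult_right_mono mult_mono) auto
  also have "\<dots> < 1" using count by (simp only: power_add[symmetric] mult_2[symmetric])
  finally have sum: "(\<Sum>j\<in>I. 2 * \<delta> / m j) < 1" .
  have "finite I" using finU by (simp add: I_def)
  from exists_coefficients[OF this \<delta> mv sum] obtain g where
    g: "\<And>k. k < N \<Longrightarrow> 0 \<le> g k \<and> g k \<le> 1" "\<And>j. j \<in> I \<Longrightarrow> \<delta> \<le> \<bar>\<Sum>k<N. g k * v j k\<bar>" by blast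
  show ?thesis
  proof (intro exI[of _ g] conjI allI impI)
    fix u w :: "nat \<Rightarrow> int"
    assume b: "\<forall>k<N. \<bar>u k\<bar> \<le> int B \<and> \<bar>w k\<bar> \<le> int B" and n: "\<exists>k<N. u k \<noteq> 0 \<or> w k \<noteq> 0"
    let ?u = "restrict u {..<N}" and ?w = "restrict w {..<N}"
    have "?u \<in> U" "?w \<in> U" using b by (auto simp: U_def abs_le_iff)
    moreover have "(?u, ?w) \<noteq> (z, z)"
    proof
      assume "(?u, ?w) = (z, z)"
      then have "?u k = z k" "?w k = z k" for k by auto
      then show False using n by (metis lessThan_iff restrict_apply' z_def)
    qed
    ultimately have "(?u, ?w) \<in> I" by (simp add: I_def)
    from g(2)[OF this] show "\<delta> \<le> \<bar>\<Sum>k<N. g k * (u k + h * w k)\<bar>" by (simp add: v_def)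
  qed (use g in auto)
qed

text \<open>Dividing by the larger amplitude Q leaves the gains 1 and h, in an order that depends on
  whether the own link or the cross links are stronger. By \<open>sep\<close>, a change of the own
  integers or of the interfering sums moves the output by V * \<delta>, more than noise and private
  digits can undo. So both are decoded, and the own private digit then stands out alone. The two
  uses carry independent copies of the code, and label alphabet 1 means no feedback.\<close>

lemma unaided_code:
  fixes K A C N :: nat and c1 c2 s r Q V U \<delta> \<rho> :: real and g :: "nat \<Rightarrow> real"
  defines "R \<equiv> ({..<N} \<rightarrow>\<^sub>E {..A}) \<times> {..C}"
  assumes K: "1 \<le> K" and pos: "0 < Q" "0 \<le> c1" "0 \<le> c2" "0 \<le> V" "0 \<le> U" "0 \<le> s" "0 \<le> r"
    and sr: "s = c1 * Q" "r = c2 * Q"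
    and g: "\<And>k. k < N \<Longrightarrow> 0 \<le> g k \<and> g k \<le> 1"
    and sep: "\<And>u w :: nat \<Rightarrow> int. (\<forall>k<N. \<bar>u k\<bar> \<le> int (K * A) \<and> \<bar>w k\<bar> \<le> int (K * A)) \<Longrightarrow>
      (\<exists>k<N. u k \<noteq> 0 \<or> w k \<noteq> 0) \<Longrightarrow> \<delta> \<le> \<bar>\<Sum>k<N. g k * (c1 * u k + c2 * w k)\<bar>"
    and common: "2 * \<rho> + c2 * U * real (K * C) + c1 * U * real C < V * \<delta>"
    and bottom: "C = 0 \<or> 2 * \<rho> + c2 * U * real (K * C) < c1 * U"
    and power: "V * real (N * A) + U * real C \<le> Q / 2"
  shows "\<exists>e1 f e2. two_slot_code K (s\<^sup>2) (r\<^sup>2) \<rho> (R \<times> R) 1 e1 f e2"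
proof -
  define en where "en = (\<lambda>q :: (nat \<Rightarrow> nat) \<times> nat. (V * (\<Sum>k<N. g k * real (fst q k)) + U * real (snd q)) / Q)"
  define ob where "ob = (\<lambda>i (\<mu> :: nat \<Rightarrow> (nat \<Rightarrow> nat) \<times> nat). s * en (\<mu> i) + (\<Sum>j\<in>{..<K} - {i}. r * en (\<mu> j)))"
  let ?s = "\<lambda>i g. \<Sum>j\<in>{..<K} - {i}. g j :: nat"
  have R: "k < N \<Longrightarrow> fst q k \<le> A" "snd q \<le> C" "fst q \<in> extensional {..<N}" if "q \<in> R" for q k
  proof -
    have "fst q \<in> {..<N} \<rightarrow>\<^sub>E {..A}" "snd q \<in> {..C}" using that by (simp_all only: R_def mem_Times_iff)
    then show "k < N \<Longrightarrow> fst q k \<le> A" "snd q \<le> C" "fst q \<in> extensional {..<N}"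
      using PiE_mem[of "fst q" "{..<N}" "\<lambda>_. {..A}" k] by (simp_all add: PiE_def)
  qed
  have ob: "ob i \<mu> = V * (\<Sum>k<N. g k * (c1 * real (fst (\<mu> i) k) + c2 * real (?s i (\<lambda>j. fst (\<mu> j) k))))
      + c1 * U * real (snd (\<mu> i)) + c2 * U * real (?s i (\<lambda>j. snd (\<mu> j)))" for i \<mu>
  proof -
    have en: "s * en q = c1 * (V * (\<Sum>k<N. g k * real (fst q k)) + U * real (snd q))"
      "r * en q = c2 * (V * (\<Sum>k<N. g k * real (fst q k)) + U * real (snd q))" for q
      using pos(1) by (simp_all add: en_def sr)
    have lin': "(\<Sum>j\<in>J. c2 * (V * x j + U * y j)) = c2 * V * (\<Sum>j\<in>J. x j) + c2 * U * (\<Sum>j\<in>J. y j)"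
      for J :: "nat set" and x y
      unfolding sum_distrib_left sum.distrib[symmetric] by (intro sum.cong refl) (simp only: algebra_simps)
    have "(\<Sum>j\<in>{..<K} - {i}. \<Sum>k<N. g k * real (fst (\<mu> j) k)) = (\<Sum>k<N. \<Sum>j\<in>{..<K} - {i}. g k * real (fst (\<mu> j) k))"
      by (rule sum.swap)
    also have "\<dots> = (\<Sum>k<N. g k * real (?s i (\<lambda>j. fst (\<mu> j) k)))"
      by (simp only: sum_distrib_left of_nat_sum)
    finally have swap: "(\<Sum>j\<in>{..<K} - {i}. \<Sum>k<N. g k * real (fst (\<mu> j) k)) = \<dots>" .
    have others: "(\<Sum>j\<in>{..<K} - {i}. r * en (\<mu> j)) = c2 * V * (\<Sum>k<N. g k * real (?s i (\<lambda>j. fst (\<mu> j) k)))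
        + c2 * U * real (?s i (\<lambda>j. snd (\<mu> j)))"
      unfolding en(2) lin' swap of_nat_sum ..
    have lin: "(\<Sum>k<N. g k * (c1 * x k + c2 * y k)) = c1 * (\<Sum>k<N. g k * x k) + c2 * (\<Sum>k<N. g k * y k)" for x y
      unfolding sum_distrib_left sum.distrib[symmetric] by (intro sum.cong refl) (simp add: algebra_simps)
    show ?thesis
      unfolding ob_def others en(1) lin by (simp only: algebra_simps)
  qed
  have decode: "\<mu> i = \<mu>' i"
    if \<mu>: "\<And>j. j < K \<Longrightarrow> \<mu> j \<in> R" "\<And>j. j < K \<Longrightarrow> \<mu>' j \<in> R" and i: "i < K"
      and le: "\<bar>ob i \<mu> - ob i \<mu>'\<bar> \<le> 2 * \<rho>" for \<mu> \<mu>' i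
  proof -
    define u where "u = (\<lambda>k. int (fst (\<mu> i) k) - int (fst (\<mu>' i) k))"
    define w where "w = (\<lambda>k. int (?s i (\<lambda>j. fst (\<mu> j) k)) - int (?s i (\<lambda>j. fst (\<mu>' j) k)))"
    have AK: "A \<le> K * A" using K by (metis mult_le_mono1 nat_mult_1)
    have bu: "\<bar>u k\<bar> \<le> int (K * A)" if "k < N" for k
    proof -
      have "fst (\<mu> i) k \<le> K * A" "fst (\<mu>' i) k \<le> K * A"
        using R(1)[OF \<mu>(1)[OF i] that] R(1)[OF \<mu>(2)[OF i] that] AK by linarith+
      then show ?thesis unfolding u_def by linarith
    qed
    have bw: "\<bar>w k\<bar> \<le> int (K * A)" if "k < N" for k
    proof -
      have "?s i (\<lambda>j. fst (\<mu> j) k) \<le> K * A" by (intro sum_others_le R(1)[OF \<mu>(1) that])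
      moreover have "?s i (\<lambda>j. fst (\<mu>' j) k) \<le> K * A" by (intro sum_others_le R(1)[OF \<mu>(2) that])
      ultimately show ?thesis unfolding w_def by linarith
    qed
    let ?p = "snd (\<mu> i)" and ?p' = "snd (\<mu>' i)"
    let ?t = "?s i (\<lambda>j. snd (\<mu> j))" and ?t' = "?s i (\<lambda>j. snd (\<mu>' j))"
    have bp: "?p \<le> C" "?p' \<le> C" "?t \<le> K * C" "?t' \<le> K * C"
      using R(2)[OF \<mu>(1)[OF i]] R(2)[OF \<mu>(2)[OF i]]
      by (auto intro!: sum_others_le R(2) \<mu>)
    have p: "\<bar>c1 * U * (real ?p - real ?p')\<bar> \<le> c1 * U * real C" and t: "\<bar>c2 * U * (real ?t - real ?t')\<bar> \<le> c2 * U * real (K * C)"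
      using bp pos by (intro abs_diff_le; simp)+
    have diff: "ob i \<mu> - ob i \<mu>' = V * (\<Sum>k<N. g k * (c1 * u k + c2 * w k))
        + (c1 * U * (real ?p - real ?p') + c2 * U * (real ?t - real ?t'))"
    proof -
      have "(\<Sum>k<N. g k * (c1 * u k + c2 * w k)) =
        (\<Sum>k<N. g k * (c1 * real (fst (\<mu> i) k) + c2 * real (?s i (\<lambda>j. fst (\<mu> j) k))))
        - (\<Sum>k<N. g k * (c1 * real (fst (\<mu>' i) k) + c2 * real (?s i (\<lambda>j. fst (\<mu>' j) k))))"
        unfolding sum_subtractf[symmetric] by (intro sum.cong refl) (simp add: u_def w_def algebra_simps)
      note S = this
      show ?thesis unfolding ob S by (simp only: algebra_simps)
    qed
    have zero: "u k = 0 \<and> w k = 0" if "k < N" for k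
    proof (rule ccontr)
      assume "\<not> (u k = 0 \<and> w k = 0)"
      then have "\<delta> \<le> \<bar>\<Sum>k<N. g k * (c1 * u k + c2 * w k)\<bar>"
        using bu bw that by (intro sep) auto
      then have "V * \<delta> \<le> \<bar>V * (\<Sum>k<N. g k * (c1 * u k + c2 * w k))\<bar>"
        using pos by (simp add: abs_mult mult_left_mono)
      then show False using common le p t unfolding diff by linarith
    qed
    have "fst (\<mu> i) k = fst (\<mu>' i) k" for k
    proof (cases "k < N")
      case True
      then show ?thesis using zero[OF True] by (simp add: u_def)
    next
      case False
      then show ?thesis using R(3)[OF \<mu>(1)[OF i]] R(3)[OF \<mu>(2)[OF i]] by (simp add: extensional_def)
    qed
    moreover have "?p = ?p'"
      using bottom
    proof
      assume *: "2 * \<rho> + c2 * U * real (K * C) < c1 * U"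
      have "(\<Sum>k<N. g k * (c1 * u k + c2 * w k)) = 0" using zero by (intro sum.neutral) auto
      then have "\<bar>c1 * U * (real ?p - real ?p') + c2 * U * (real ?t - real ?t')\<bar> \<le> 2 * \<rho>"
        using le unfolding diff by simp
      then show ?thesis by (rule leading_digit_eq) (use * t in linarith)
    qed (use bp in simp)
    ultimately show ?thesis by (intro prod_eqI ext) auto
  qed
  have bound: "\<bar>en q\<bar> \<le> 1 / 2" if "q \<in> R" for q
  proof -
    have "g k * real (fst q k) \<le> 1 * real A" if "k < N" for k
      using g[OF that] R(1)[OF \<open>q \<in> R\<close> that] by (intro mult_mono) auto
    then have "(\<Sum>k<N. g k * real (fst q k)) \<le> real (N * A)"
      using sum_bounded_above[of "{..<N}" "\<lambda>k. g k * real (fst q k)" "real A"] by simp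
    then have "V * (\<Sum>k<N. g k * real (fst q k)) + U * real (snd q) \<le> V * real (N * A) + U * real C"
      using pos R(2)[OF that] by (intro add_mono mult_left_mono) auto
    moreover have "0 \<le> V * (\<Sum>k<N. g k * real (fst q k)) + U * real (snd q)"
      using pos g by (intro add_nonneg_nonneg mult_nonneg_nonneg sum_nonneg) auto
    ultimately show ?thesis using pos power by (simp add: en_def abs_div_pos divide_le_eq)
  qed
  define e1 where "e1 = (\<lambda>m :: ((nat \<Rightarrow> nat) \<times> nat) \<times> ((nat \<Rightarrow> nat) \<times> nat). en (fst m))"
  define e2 where "e2 = (\<lambda>(m :: ((nat \<Rightarrow> nat) \<times> nat) \<times> ((nat \<Rightarrow> nat) \<times> nat)) (l::nat). en (snd m))"
  define f where "f = (\<lambda>(i::nat) (\<mu> :: nat \<Rightarrow> ((nat \<Rightarrow> nat) \<times> nat) \<times> ((nat \<Rightarrow> nat) \<times> nat)). 0::nat)"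
  have sq: "sqrt (s\<^sup>2) = s" "sqrt (r\<^sup>2) = r" using pos by auto
  have o: "obs1 K (s\<^sup>2) (r\<^sup>2) e1 \<mu> i = ob i (\<lambda>j. fst (\<mu> j))" "obs2 K (s\<^sup>2) (r\<^sup>2) e2 f \<mu> i = ob i (\<lambda>j. snd (\<mu> j))" for \<mu> i
    unfolding obs1_def obs2_def sq ob_def e1_def e2_def by auto
  have "two_slot_code K (s\<^sup>2) (r\<^sup>2) \<rho> (R \<times> R) 1 e1 f e2"
  proof
    show "finite (R \<times> R)" unfolding R_def by (intro finite_cartesian_product finite_PiE) auto
    show "R \<times> R \<noteq> {}" unfolding R_def by (auto simp: PiE_eq_empty_iff)
    show "\<bar>e1 m\<bar> \<le> 1 / 2" if "m \<in> R \<times> R" for m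
      unfolding e1_def by (rule bound) (use that in \<open>simp add: mem_Times_iff\<close>)
    show "\<bar>e2 m l\<bar> \<le> 1 / 2" if "m \<in> R \<times> R" for m l
      unfolding e2_def by (rule bound) (use that in \<open>simp add: mem_Times_iff\<close>)
    show "f i \<mu> < 1" "f i \<mu> = f i \<mu>'" for i \<mu> \<mu>' by (simp_all add: f_def)
    show "\<mu> i = \<mu>' i" if \<mu>: "\<mu> \<in> {..<K} \<rightarrow>\<^sub>E R \<times> R" "\<mu>' \<in> {..<K} \<rightarrow>\<^sub>E R \<times> R" and i: "i < K"
      and le: "\<bar>obs1 K (s\<^sup>2) (r\<^sup>2) e1 \<mu> i - obs1 K (s\<^sup>2) (r\<^sup>2) e1 \<mu>' i\<bar> \<le> 2 * \<rho>"
        "\<bar>obs2 K (s\<^sup>2) (r\<^sup>2) e2 f \<mu> i - obs2 K (s\<^sup>2) (r\<^sup>2) e2 f \<mu>' i\<bar> \<le> 2 * \<rho>" for \<mu> \<mu>' i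
    proof -
      have mem: "fst (\<mu> j) \<in> R" "snd (\<mu> j) \<in> R" "fst (\<mu>' j) \<in> R" "snd (\<mu>' j) \<in> R" if "j < K" for j
        using tuple_app[OF \<mu>(1) that] tuple_app[OF \<mu>(2) that] by auto
      have "fst (\<mu> i) = fst (\<mu>' i)" by (rule decode[OF mem(1) mem(3) i le(1)[unfolded o]])
      moreover have "snd (\<mu> i) = snd (\<mu>' i)" by (rule decode[OF mem(2) mem(4) i le(2)[unfolded o]])
      ultimately show ?thesis by (rule prod_eqI)
    qed
  qed simp
  then show ?thesis by blast
qed

text \<open>With N coefficients and integers up to A = P powr t, the union bound over all (u, w)
  limits t * (2 * N + 1) to just below \<alpha>, so A ^ N approaches P powr (\<alpha> / 2) only as N
  grows. The pairs with u = 0 contribute an exponent near \<sigma> - \<alpha> / 2, negative by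
  assumption.\<close>

lemma random_coefficients:
  fixes \<alpha> \<sigma> \<xi> :: real and K :: nat
  assumes \<sigma>: "0 < \<sigma>" "2 * \<sigma> < \<alpha>" and \<xi>: "0 < \<xi>" and K: "1 \<le> K"
  shows "\<exists>N \<eta>. 0 < \<eta> \<and> \<eta> \<le> \<xi> \<and> (\<forall>\<^sub>F P in at_top. \<exists>(A::nat) g. 1 \<le> A \<and> (\<forall>k<N. 0 \<le> g k \<and> g k \<le> 1) \<and>
    (\<forall>u w :: nat \<Rightarrow> int. (\<forall>k<N. \<bar>u k\<bar> \<le> int (K * A) \<and> \<bar>w k\<bar> \<le> int (K * A)) \<longrightarrow> (\<exists>k<N. u k \<noteq> 0 \<or> w k \<noteq> 0) \<longrightarrow>
      A * P powr (3 * \<eta> - \<alpha>) \<le> \<bar>\<Sum>k<N. g k * (u k + P powr (- \<sigma>) * w k)\<bar>) \<and>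
    P powr (\<alpha> / 2 - \<xi>) \<le> real (A + 1) ^ N)"
proof -
  define \<eta> where "\<eta> = min ((\<alpha> / 2 - \<sigma>) / 2) (\<xi> / 4)"
  have \<eta>: "0 < \<eta>" "2 * \<eta> \<le> \<alpha> / 2 - \<sigma>" "4 * \<eta> \<le> \<xi>" using \<sigma> \<xi> by (auto simp: \<eta>_def min_def)
  define c where "c = \<alpha> - 4 * \<eta>"
  have c: "0 < c" using \<eta> \<sigma> by (simp add: c_def)
  \<comment> \<open>Chosen so that the first term of the union bound has exponent exactly -
    \<eta>.\<close>
  define \<tau> where "\<tau> = (\<lambda>N::nat. c / (2 * real N + 1))"
  have "(\<lambda>N. \<tau> N * (real N + 1)) \<longlonglongrightarrow> c / 2" "\<tau> \<longlonglongrightarrow> 0" "(\<lambda>N. \<tau> N * real N) \<longlonglongrightarrow> c / 2"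
    unfolding \<tau>_def by real_asymp+
  then have "\<forall>\<^sub>F N in sequentially. \<tau> N * (real N + 1) < \<alpha> - \<sigma> - 3 * \<eta>"
    "\<forall>\<^sub>F N in sequentially. \<tau> N < \<sigma>" "\<forall>\<^sub>F N in sequentially. \<alpha> / 2 - \<xi> < \<tau> N * real N"
    using \<eta> \<sigma> by (auto intro!: order_tendstoD simp: c_def)
  then have "\<forall>\<^sub>F N in sequentially. \<tau> N * (real N + 1) < \<alpha> - \<sigma> - 3 * \<eta> \<and> \<tau> N < \<sigma> \<and> \<alpha> / 2 - \<xi> < \<tau> N * real N"
    by (intro eventually_conj)
  then obtain N where N: "\<tau> N * (real N + 1) < \<alpha> - \<sigma> - 3 * \<eta>" "\<tau> N < \<sigma>" "\<alpha> / 2 - \<xi> < \<tau> N * real N"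
    by (auto simp: eventually_sequentially)
  define t where "t = \<tau> N"
  have t: "0 < t" "t * (2 * real N + 1) = c" using c by (auto simp: t_def \<tau>_def)
  define e where "e = t * (real N + 1) + 3 * \<eta> - \<alpha> + \<sigma>"
  have e: "e < 0" using N(1) by (simp add: e_def t_def)
  define c1 where "c1 = 4 * (3 * real K) ^ (2 * N)"
  define c2 where "c2 = 2 * (3 * real K) ^ N"
  have decay: "((\<lambda>P. a * P powr q) \<longlongrightarrow> 0) at_top" if "q < 0" for a q :: real
    using tendsto_mult[OF tendsto_const[of a] tendsto_neg_powr[OF that filterlim_ident]] by simp
  have "((\<lambda>P. c1 * P powr (- \<eta>) + c2 * P powr e) \<longlongrightarrow> 0) at_top"
    using tendsto_add[OF decay[of "- \<eta>" c1] decay[OF e, of c2]] \<eta>(1) by simp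
  then have ev1: "\<forall>\<^sub>F P in at_top. c1 * P powr (- \<eta>) + c2 * P powr e < 1" by (rule order_tendstoD) simp
  have "t - \<sigma> < 0" using N(2) by (simp add: t_def)
  then have "((\<lambda>P. real K * P powr (t - \<sigma>)) \<longlongrightarrow> 0) at_top" by (rule decay)
  then have ev2: "\<forall>\<^sub>F P in at_top. real K * P powr (t - \<sigma>) < 1 / 2" by (rule order_tendstoD) simp
  show ?thesis
  proof (intro exI conjI)
    show "0 < \<eta>" "\<eta> \<le> \<xi>" using \<eta> by auto
    show "\<forall>\<^sub>F P in at_top. \<exists>(A::nat) g. 1 \<le> A \<and> (\<forall>k<N. 0 \<le> g k \<and> g k \<le> 1) \<and>
    (\<forall>u w :: nat \<Rightarrow> int. (\<forall>k<N. \<bar>u k\<bar> \<le> int (K * A) \<and> \<bar>w k\<bar> \<le> int (K * A)) \<longrightarrow> (\<exists>k<N. u k \<noteq> 0 \<or> w k \<noteq> 0) \<longrightarrow>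
      A * P powr (3 * \<eta> - \<alpha>) \<le> \<bar>\<Sum>k<N. g k * (u k + P powr (- \<sigma>) * w k)\<bar>) \<and>
      P powr (\<alpha> / 2 - \<xi>) \<le> real (A + 1) ^ N"
      using ev1 ev2 eventually_ge_at_top[of 1]
    proof eventually_elim
      case (elim P)
      have P: "1 \<le> P" "0 < P" using elim by auto
      define x where "x = P powr t"
      define A where "A = nat \<lfloor>x\<rfloor>"
      \<comment> \<open>The factor A cancels the division by A that the power constraint imposes on
        the amplitude V later; three \<eta> pay for that constraint and leave a guard of G ^
        2.\<close>
      define \<delta> where "\<delta> = A * P powr (3 * \<eta> - \<alpha>)"
      have x: "1 \<le> x" using P t by (simp add: x_def ge_one_powr_ge_zero)
      then have A: "1 \<le> A" "real A \<le> x" by (simp_all add: A_def le_nat_floor)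
      have xpow: "x ^ n = P powr (t * n)" for n
        using P by (simp add: x_def powr_realpow[symmetric] powr_powr)
      have \<delta>: "0 < \<delta>" "\<delta> \<le> x * P powr (3 * \<eta> - \<alpha>)" using A P by (simp_all add: \<delta>_def)
      have KA: "3 * real (K * A) \<le> 3 * real K * x"
        unfolding of_nat_mult mult.assoc[symmetric] using A(2) by (rule mult_left_mono) simp
      have pw: "(3 * real (K * A)) ^ n \<le> (3 * real K * x) ^ n" for n
        by (rule power_mono[OF KA]) simp
      have "(3 * real (K * A)) ^ (2 * N) * (4 * \<delta>) \<le> (3 * real K * x) ^ (2 * N) * (4 * (x * P powr (3 * \<eta> - \<alpha>)))"
        using \<delta> x by (intro mult_mono[OF pw]) auto
      also have "\<dots> = c1 * (x ^ (2 * N + 1) * P powr (3 * \<eta> - \<alpha>))"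
        by (simp add: c1_def power_mult_distrib)
      also have "x ^ (2 * N + 1) * P powr (3 * \<eta> - \<alpha>) = P powr (- \<eta>)"
      proof -
        have "t * real (2 * N + 1) = c" using t(2) by (simp add: add.commute)
        then have "t * real (2 * N + 1) + (3 * \<eta> - \<alpha>) = - \<eta>" unfolding c_def by linarith
        then show ?thesis unfolding xpow powr_add[symmetric] by (simp only:)
      qed
      finally have term1: "(3 * real (K * A)) ^ (2 * N) * (4 * \<delta>) \<le> c1 * P powr (- \<eta>)" .
      have "(3 * real (K * A)) ^ N * (2 * \<delta> / P powr (- \<sigma>)) \<le> (3 * real K * x) ^ N * (2 * (x * P powr (3 * \<eta> - \<alpha>)) / P powr (- \<sigma>))"
        using \<delta> x by (intro mult_mono[OF pw] divide_right_mono) auto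
      also have "\<dots> = c2 * (x ^ (N + 1) * (P powr (3 * \<eta> - \<alpha>) / P powr (- \<sigma>)))"
        by (simp add: c2_def power_mult_distrib)
      also have "x ^ (N + 1) * (P powr (3 * \<eta> - \<alpha>) / P powr (- \<sigma>)) = P powr e"
      proof -
        have "t * real (N + 1) + ((3 * \<eta> - \<alpha>) - - \<sigma>) = e" by (simp add: e_def)
        then show ?thesis unfolding xpow powr_diff[symmetric] powr_add[symmetric] by (simp only:)
      qed
      finally have term2: "(3 * real (K * A)) ^ N * (2 * \<delta> / P powr (- \<sigma>)) \<le> c2 * P powr e" .
      have "P powr (- \<sigma>) * real (K * A) \<le> P powr (- \<sigma>) * (real K * x)"
      proof (rule mult_left_mono)
        show "real (K * A) \<le> real K * x" unfolding of_nat_mult using A(2) by (rule mult_left_mono) simp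
      qed simp
      also have "\<dots> = real K * P powr (t - \<sigma>)"
      proof -
        have "P powr (t - \<sigma>) = P powr (- \<sigma>) * P powr t" using powr_add[of P "- \<sigma>" t] by simp
        then show ?thesis unfolding x_def by (simp only: mult.left_commute)
      qed
      also have "\<dots> \<le> 1 / 2" using elim(2) by (rule less_imp_le)
      finally have half: "P powr (- \<sigma>) * real (K * A) \<le> 1 / 2" .
      have Ppos: "0 < P powr (- \<sigma>)" using P by simp
      have KA1: "1 \<le> K * A" using mult_le_mono[OF K A(1)] by simp
      have "(3 * real (K * A)) ^ (2 * N) * (4 * \<delta>) + (3 * real (K * A)) ^ N * (2 * \<delta> / P powr (- \<sigma>))
          \<le> c1 * P powr (- \<eta>) + c2 * P powr e"
        by (rule add_mono[OF term1 term2])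
      also have "\<dots> < 1" by (rule elim(1))
      finally have count: "(3 * real (K * A)) ^ (2 * N) * (4 * \<delta>) + (3 * real (K * A)) ^ N * (2 * \<delta> / P powr (- \<sigma>)) < 1" .
      from lattice_coefficients[OF Ppos half KA1 \<delta>(1) count]
      obtain g where g: "(\<forall>k<N. 0 \<le> g k \<and> g k \<le> 1) \<and>
        (\<forall>u w :: nat \<Rightarrow> int. (\<forall>k<N. \<bar>u k\<bar> \<le> int (K * A) \<and> \<bar>w k\<bar> \<le> int (K * A)) \<longrightarrow> (\<exists>k<N. u k \<noteq> 0 \<or> w k \<noteq> 0) \<longrightarrow>
          \<delta> \<le> \<bar>\<Sum>k<N. g k * (u k + P powr (- \<sigma>) * w k)\<bar>)"
        by (elim exE)
      have "P powr (\<alpha> / 2 - \<xi>) \<le> real (A + 1) ^ N"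
      proof -
        have "P powr (\<alpha> / 2 - \<xi>) \<le> P powr (t * real N)" using N(3) P(1) by (intro powr_mono) (auto simp: t_def)
        also have "\<dots> = x ^ N" by (rule xpow[symmetric])
        also have "\<dots> \<le> real (A + 1) ^ N" using x unfolding A_def by (intro power_mono le_Suc_nat_floor) auto
        finally show ?thesis .
      qed
      then show ?case
        using A(1) g[THEN conjunct1] g[THEN conjunct2] unfolding \<delta>_def by (intro exI[of _ A] exI[of _ g] conjI)
    qed
  qed
qed

text \<open>The private digit fills the lowest 1 - \<alpha> exponents, hidden from the other
  receivers. The \<alpha> exponents above are shared evenly by own integers and interfering sums,
  which gives 1 - \<alpha> + \<alpha> / 2. The condition 2 * (1 - \<alpha>) < \<alpha> is 2 / 3 <
  \<alpha>.\<close>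

lemma weak_unaided_codes:
  fixes \<alpha> \<beta> D' :: real
  assumes K: "1 \<le> K" and \<alpha>: "2 / 3 < \<alpha>" "\<alpha> < 1" and \<beta>: "0 \<le> \<beta>" and D': "D' < 1 - \<alpha> / 2"
  shows "\<exists>\<eta>>0. \<forall>\<^sub>F P in at_top. \<exists>(S :: (((nat \<Rightarrow> nat) \<times> nat) \<times> ((nat \<Rightarrow> nat) \<times> nat)) set) F e1 f e2.
       two_slot_code K (P\<^sup>2) ((P powr \<alpha>)\<^sup>2) (P powr \<eta>) S F e1 f e2 \<and>
       real F \<le> P powr (2 * \<beta>) \<and> P powr (2 * D') \<le> real (card S)"
proof -
  \<comment> \<open>One \<xi> is lost in the common integers and at most three in the private digit,
    whose guard is 3 * \<eta>.\<close>
  define \<xi> where "\<xi> = (1 - \<alpha> / 2 - D') / 4"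
  have \<xi>: "0 < \<xi>" using D' by (simp add: \<xi>_def)
  have "0 < 1 - \<alpha>" "2 * (1 - \<alpha>) < \<alpha>" using \<alpha> by auto
  from random_coefficients[OF this \<xi> K] obtain N \<eta> where \<eta>: "0 < \<eta>" "\<eta> \<le> \<xi>"
    and ev: "\<forall>\<^sub>F P in at_top. \<exists>(A::nat) g. 1 \<le> A \<and> (\<forall>k<N. 0 \<le> g k \<and> g k \<le> 1) \<and>
    (\<forall>u w :: nat \<Rightarrow> int. (\<forall>k<N. \<bar>u k\<bar> \<le> int (K * A) \<and> \<bar>w k\<bar> \<le> int (K * A)) \<longrightarrow> (\<exists>k<N. u k \<noteq> 0 \<or> w k \<noteq> 0) \<longrightarrow>
      A * P powr (3 * \<eta> - \<alpha>) \<le> \<bar>\<Sum>k<N. g k * (u k + P powr (- (1 - \<alpha>)) * w k)\<bar>) \<and>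
    P powr (\<alpha> / 2 - \<xi>) \<le> real (A + 1) ^ N" by blast
  have large: "\<forall>\<^sub>F P in at_top. 100 * (real K)\<^sup>2 + 8 * real N \<le> P powr \<eta>" using \<eta>(1) by real_asymp
  show ?thesis
  proof (intro exI[of _ \<eta>] conjI \<eta>)
    show "\<forall>\<^sub>F P in at_top. \<exists>(S :: (((nat \<Rightarrow> nat) \<times> nat) \<times> ((nat \<Rightarrow> nat) \<times> nat)) set) F e1 f e2.
       two_slot_code K (P\<^sup>2) ((P powr \<alpha>)\<^sup>2) (P powr \<eta>) S F e1 f e2 \<and>
       real F \<le> P powr (2 * \<beta>) \<and> P powr (2 * D') \<le> real (card S)"
      using ev large eventually_ge_at_top[of 1]
    proof eventually_elim
      case (elim P)
      define h where "h = P powr (- (1 - \<alpha>))"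
      from elim(1) obtain A g where A: "1 \<le> A" and g: "\<And>k. k < N \<Longrightarrow> 0 \<le> g k \<and> g k \<le> 1"
        and sep: "\<And>u w :: nat \<Rightarrow> int. (\<forall>k<N. \<bar>u k\<bar> \<le> int (K * A) \<and> \<bar>w k\<bar> \<le> int (K * A)) \<Longrightarrow> (\<exists>k<N. u k \<noteq> 0 \<or> w k \<noteq> 0) \<Longrightarrow>
            A * P powr (3 * \<eta> - \<alpha>) \<le> \<bar>\<Sum>k<N. g k * (u k + h * w k)\<bar>"
        and card: "P powr (\<alpha> / 2 - \<xi>) \<le> real (A + 1) ^ N"
        unfolding h_def by blast
      define G where "G = P powr \<eta>"
      define X where "X = P powr (1 - \<alpha>)"
      define C where "C = nat \<lfloor>X / G ^ 3\<rfloor>"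
      define \<delta> where "\<delta> = A * P powr (3 * \<eta> - \<alpha>)"
      define V where "V = P / (G * A)"
      have P: "1 \<le> P" "0 < P" using elim by auto
      have P1: "P powr 1 = P" using P by simp
      have X1: "1 \<le> X" using P \<alpha> by (simp add: X_def ge_one_powr_ge_zero)
      have XP: "X \<le> P" using powr_mono[of "1 - \<alpha>" 1 P] P \<alpha> by (simp add: X_def)
      have hX: "h = 1 / X" using P by (simp add: h_def X_def powr_minus powr_diff field_simps)
      have Gpow: "G ^ n = P powr (n * \<eta>)" for n
        using P by (simp add: G_def powr_realpow[symmetric] powr_powr mult.commute)
      have k: "1 \<le> real K" using K by simp
      have k2: "real K \<le> (real K)\<^sup>2" using mult_left_mono[OF k, of "real K"] by (simp add: power2_eq_square)
      have G: "100 * (real K)\<^sup>2 + 8 * real N \<le> G" using elim by (simp add: G_def)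
      have G100: "100 \<le> G" "100 * real K \<le> G" "8 * real N \<le> G" using k k2 G of_nat_0_le_iff[of N] by linarith+
      have G0: "0 < G" and X0: "0 < X" using G100 X1 by linarith+
      have G2: "100 * G \<le> G\<^sup>2" using G100 G0 by (simp add: power2_eq_square)
      have C: "real C \<le> X / G ^ 3" unfolding C_def using X0 G0 by (intro of_nat_floor_le) simp
      have UC: "G\<^sup>2 * real C \<le> X / 100"
      proof -
        have "G\<^sup>2 * real C \<le> G\<^sup>2 * (X / G ^ 3)" using C by (intro mult_left_mono) auto
        also have "\<dots> = X / G" using G0 by (simp add: field_simps power_numeral_reduce)
        also have "\<dots> \<le> X / 100" using X0 G100 by (intro frac_le) auto
        finally show ?thesis .
      qed
      have hUC: "h * G\<^sup>2 * real (K * C) \<le> 1"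
      proof -
        have "h * G\<^sup>2 * real (K * C) = (real K / X) * (G\<^sup>2 * real C)" by (simp add: hX)
        also have "\<dots> \<le> (real K / X) * (G\<^sup>2 * (X / G ^ 3))" using C X0 by (intro mult_left_mono) auto
        also have "\<dots> = real K / G" using X0 G0 by (simp add: field_simps power_numeral_reduce)
        also have "\<dots> \<le> 1" using G100 G0 k by (simp add: field_simps)
        finally show ?thesis .
      qed
      have V\<delta>: "V * \<delta> = G\<^sup>2 * X"
      proof -
        have "V * \<delta> = P * P powr (3 * \<eta> - \<alpha>) / G" using A by (simp add: V_def \<delta>_def)
        also have "\<dots> = P powr (1 + (3 * \<eta> - \<alpha>) - \<eta>)"
          unfolding powr_diff[of P _ \<eta>] powr_add P1 G_def ..
        also have "\<dots> = P powr (2 * \<eta> + (1 - \<alpha>))" by (simp add: algebra_simps)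
        also have "\<dots> = G\<^sup>2 * X" unfolding powr_add Gpow X_def by simp
        finally show ?thesis .
      qed
      let ?R = "({..<N} \<rightarrow>\<^sub>E {..A}) \<times> {..C}"
      have "\<exists>e1 f e2. two_slot_code K (P\<^sup>2) ((P powr \<alpha>)\<^sup>2) G (?R \<times> ?R) 1 e1 f e2"
      proof (rule unaided_code[where Q = P and ?c1.0 = 1 and ?c2.0 = h and V = V and U = "G\<^sup>2" and \<delta> = \<delta> and g = g, OF K])
        show "P powr \<alpha> = h * P" using P by (simp add: h_def powr_diff powr_minus field_simps)
        show "\<delta> \<le> \<bar>\<Sum>k<N. g k * (1 * real_of_int (u k) + h * real_of_int (w k))\<bar>"
          if "\<forall>k<N. \<bar>u k\<bar> \<le> int (K * A) \<and> \<bar>w k\<bar> \<le> int (K * A)" "\<exists>k<N. u k \<noteq> 0 \<or> w k \<noteq> 0" for u w :: "nat \<Rightarrow> int"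
          using sep[OF that] by (simp add: \<delta>_def)
        have "G\<^sup>2 \<le> G\<^sup>2 * X" "10000 * X \<le> G\<^sup>2 * X"
          using mult_left_mono[OF X1, of "G\<^sup>2"] G2 G100 X0 by (auto intro!: mult_right_mono)
        then show "2 * G + h * G\<^sup>2 * real (K * C) + 1 * G\<^sup>2 * real C < V * \<delta>"
          unfolding V\<delta> using hUC UC G2 G100 X1 by linarith
        have "2 * G + h * G\<^sup>2 * real (K * C) < 1 * G\<^sup>2" using hUC G2 G100 by linarith
        then show "C = 0 \<or> 2 * G + h * G\<^sup>2 * real (K * C) < 1 * G\<^sup>2" ..
        have "V * real (N * A) = P * (real N / G)" using A by (simp add: V_def)
        also have "\<dots> \<le> P * (1 / 8)" using G100 G0 P by (intro mult_left_mono) (auto simp: field_simps)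
        finally show "V * real (N * A) + G\<^sup>2 * real C \<le> P / 2" using UC XP P by linarith
      qed (use P g G0 in \<open>auto simp: h_def V_def\<close>)
      moreover have "real 1 \<le> P powr (2 * \<beta>)" using P \<beta> by (simp add: ge_one_powr_ge_zero)
      moreover have "P powr (2 * D') \<le> real (card (?R \<times> ?R))"
      proof -
        have "P powr D' \<le> P powr ((\<alpha> / 2 - \<xi>) + (1 - \<alpha> - 3 * \<eta>))"
          using \<eta>(2) P by (intro powr_mono) (auto simp: \<xi>_def field_simps)
        also have "\<dots> = P powr (\<alpha> / 2 - \<xi>) * (X / G ^ 3)"
          unfolding powr_add Gpow X_def by (simp add: powr_diff)
        also have "\<dots> \<le> real (A + 1) ^ N * real (C + 1)"
          using card X0 G0 unfolding C_def by (intro mult_mono le_Suc_nat_floor) auto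
        also have "\<dots> = real (card ?R)" by (simp add: card_cartesian_product card_PiE distrib_left)
        finally have R: "P powr D' \<le> real (card ?R)" .
        have "P powr (2 * D') = P powr D' * P powr D'" by (simp add: powr_add[symmetric])
        also have "\<dots> \<le> real (card ?R) * real (card ?R)" using R by (intro mult_mono) auto
        finally show ?thesis by (simp only: card_cartesian_product of_nat_mult)
      qed
      ultimately show ?case unfolding G_def by blast
    qed
  qed
qed

text \<open>No level is hidden from the other receivers, so there is no private digit. The \<alpha>
  received exponents are shared evenly, and 2 * (\<alpha> - 1) < \<alpha> is \<alpha> < 2.\<close>

lemma strong_unaided_codes:
  fixes \<alpha> \<beta> D' :: real
  assumes K: "1 \<le> K" and \<alpha>: "1 < \<alpha>" "\<alpha> < 2" and \<beta>: "0 \<le> \<beta>" and D': "D' < \<alpha> / 2"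
  shows "\<exists>\<eta>>0. \<forall>\<^sub>F P in at_top. \<exists>(S :: (((nat \<Rightarrow> nat) \<times> nat) \<times> ((nat \<Rightarrow> nat) \<times> nat)) set) F e1 f e2.
       two_slot_code K (P\<^sup>2) ((P powr \<alpha>)\<^sup>2) (P powr \<eta>) S F e1 f e2 \<and>
       real F \<le> P powr (2 * \<beta>) \<and> P powr (2 * D') \<le> real (card S)"
proof -
  define \<xi> where "\<xi> = \<alpha> / 2 - D'"
  have \<xi>: "0 < \<xi>" using D' by (simp add: \<xi>_def)
  have "0 < \<alpha> - 1" "2 * (\<alpha> - 1) < \<alpha>" using \<alpha> by auto
  from random_coefficients[OF this \<xi> K] obtain N \<eta> where \<eta>: "0 < \<eta>" "\<eta> \<le> \<xi>"
    and ev: "\<forall>\<^sub>F P in at_top. \<exists>(A::nat) g. 1 \<le> A \<and> (\<forall>k<N. 0 \<le> g k \<and> g k \<le> 1) \<and>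
    (\<forall>u w :: nat \<Rightarrow> int. (\<forall>k<N. \<bar>u k\<bar> \<le> int (K * A) \<and> \<bar>w k\<bar> \<le> int (K * A)) \<longrightarrow> (\<exists>k<N. u k \<noteq> 0 \<or> w k \<noteq> 0) \<longrightarrow>
      A * P powr (3 * \<eta> - \<alpha>) \<le> \<bar>\<Sum>k<N. g k * (u k + P powr (- (\<alpha> - 1)) * w k)\<bar>) \<and>
    P powr (\<alpha> / 2 - \<xi>) \<le> real (A + 1) ^ N" by blast
  have large: "\<forall>\<^sub>F P in at_top. 100 + 8 * real N \<le> P powr \<eta>" using \<eta>(1) by real_asymp
  show ?thesis
  proof (intro exI[of _ \<eta>] conjI \<eta>)
    show "\<forall>\<^sub>F P in at_top. \<exists>(S :: (((nat \<Rightarrow> nat) \<times> nat) \<times> ((nat \<Rightarrow> nat) \<times> nat)) set) F e1 f e2.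
       two_slot_code K (P\<^sup>2) ((P powr \<alpha>)\<^sup>2) (P powr \<eta>) S F e1 f e2 \<and>
       real F \<le> P powr (2 * \<beta>) \<and> P powr (2 * D') \<le> real (card S)"
      using ev large eventually_ge_at_top[of 1]
    proof eventually_elim
      case (elim P)
      define h where "h = P powr (- (\<alpha> - 1))"
      from elim(1) obtain A g where A: "1 \<le> A" and g: "\<And>k. k < N \<Longrightarrow> 0 \<le> g k \<and> g k \<le> 1"
        and sep: "\<And>u w :: nat \<Rightarrow> int. (\<forall>k<N. \<bar>u k\<bar> \<le> int (K * A) \<and> \<bar>w k\<bar> \<le> int (K * A)) \<Longrightarrow> (\<exists>k<N. u k \<noteq> 0 \<or> w k \<noteq> 0) \<Longrightarrow>
            A * P powr (3 * \<eta> - \<alpha>) \<le> \<bar>\<Sum>k<N. g k * (u k + h * w k)\<bar>"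
        and card: "P powr (\<alpha> / 2 - \<xi>) \<le> real (A + 1) ^ N"
        unfolding h_def by blast
      define G where "G = P powr \<eta>"
      define \<delta> where "\<delta> = A * P powr (3 * \<eta> - \<alpha>)"
      define V where "V = P powr \<alpha> / (G * A)"
      have P: "1 \<le> P" "0 < P" using elim by auto
      have Gpow: "G ^ n = P powr (n * \<eta>)" for n
        using P by (simp add: G_def powr_realpow[symmetric] powr_powr mult.commute)
      have G100: "100 \<le> G" "8 * real N \<le> G" using elim(2) of_nat_0_le_iff[of N] unfolding G_def by linarith+
      have G0: "0 < G" using G100 by linarith
      have G2: "100 * G \<le> G\<^sup>2" using G100 G0 by (simp add: power2_eq_square)
      have V\<delta>: "V * \<delta> = G\<^sup>2"
      proof -
        have "V * \<delta> = P powr \<alpha> * P powr (3 * \<eta> - \<alpha>) / G" using A by (simp add: V_def \<delta>_def)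
        also have "\<dots> = P powr (\<alpha> + (3 * \<eta> - \<alpha>) - \<eta>)"
          unfolding powr_diff[of P _ \<eta>] powr_add G_def ..
        also have "\<dots> = G\<^sup>2" unfolding Gpow by simp
        finally show ?thesis .
      qed
      let ?R = "({..<N} \<rightarrow>\<^sub>E {..A}) \<times> {..0::nat}"
      have "\<exists>e1 f e2. two_slot_code K (P\<^sup>2) ((P powr \<alpha>)\<^sup>2) G (?R \<times> ?R) 1 e1 f e2"
      proof (rule unaided_code[where Q = "P powr \<alpha>" and ?c1.0 = h and ?c2.0 = 1 and V = V and U = 0 and \<delta> = \<delta> and g = g, OF K])
        have "h * P powr \<alpha> = P powr 1" unfolding h_def powr_add[symmetric] by simp
        then show "P = h * P powr \<alpha>" using P by simp
        show "\<delta> \<le> \<bar>\<Sum>k<N. g k * (h * real_of_int (u k) + 1 * real_of_int (w k))\<bar>"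
          if *: "\<forall>k<N. \<bar>u k\<bar> \<le> int (K * A) \<and> \<bar>w k\<bar> \<le> int (K * A)" "\<exists>k<N. u k \<noteq> 0 \<or> w k \<noteq> 0" for u w :: "nat \<Rightarrow> int"
        proof -
          \<comment> \<open>The interfering sums now have gain 1, so u and w exchange their
            roles.\<close>
          have "A * P powr (3 * \<eta> - \<alpha>) \<le> \<bar>\<Sum>k<N. g k * (w k + h * u k)\<bar>" using * by (intro sep) auto
          then show ?thesis by (simp add: \<delta>_def add.commute)
        qed
        show "2 * G + 1 * 0 * real (K * 0) + h * 0 * real 0 < V * \<delta>" unfolding V\<delta> using G2 G100 by simp
        have "V * real (N * A) = P powr \<alpha> * (real N / G)" using A by (simp add: V_def)
        also have "\<dots> \<le> P powr \<alpha> * (1 / 2)" using G100 G0 by (intro mult_left_mono) (auto simp: field_simps)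
        finally show "V * real (N * A) + 0 * real 0 \<le> P powr \<alpha> / 2" by simp
      qed (use P g G0 in \<open>auto simp: h_def V_def\<close>)
      moreover have "real 1 \<le> P powr (2 * \<beta>)" using P \<beta> by (simp add: ge_one_powr_ge_zero)
      moreover have "P powr (2 * D') \<le> real (card (?R \<times> ?R))"
      proof -
        have "P powr D' \<le> real (A + 1) ^ N" using card by (simp add: \<xi>_def)
        also have "\<dots> = real (card ?R)" by (simp add: card_cartesian_product card_PiE)
        finally have R: "P powr D' \<le> real (card ?R)" .
        have "P powr (2 * D') = P powr D' * P powr D'" by (simp add: powr_add[symmetric])
        also have "\<dots> \<le> real (card ?R) * real (card ?R)" using R by (intro mult_mono) auto
        finally show ?thesis by (simp only: card_cartesian_product of_nat_mult)
      qed
      ultimately show ?case unfolding G_def by blast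
    qed
  qed
qed

section \<open>Exponents in the ranges of \<alpha>\<close>

theorem theorem6:
  fixes K :: nat and \<alpha> \<beta> :: real
  assumes "K \<ge> 2" and "\<alpha> \<ge> 0" and "\<alpha> \<noteq> 1" and "\<beta> \<ge> 0"
  shows "gdof_sym K \<alpha> \<beta> \<ge> ereal
    (if \<alpha> \<le> 1 / 2 then min (1 - \<alpha> + \<beta>) (1 - \<alpha> / 2)
     else if \<alpha> \<le> 2 / 3 then min (\<alpha> + \<beta>) (1 - \<alpha> / 2)
     else if \<alpha> < 1 then 1 - \<alpha> / 2
     else if \<alpha> \<le> 2 then \<alpha> / 2
     else min (1 + \<beta>) (\<alpha> / 2))"
proof -
  have K: "1 \<le> K" using assms(1) by simp
  consider "\<alpha> \<le> 1 / 2" | "1 / 2 < \<alpha>" "\<alpha> \<le> 2 / 3" | "2 / 3 < \<alpha>" "\<alpha> < 1" | "1 < \<alpha>" "\<alpha> < 2" | "2 \<le> \<alpha>"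
    using assms(3) by linarith
  then show ?thesis
  proof cases
    case 1
    \<comment> \<open>Without a common digit, the power condition caps b at \<alpha>.\<close>
    define b where "b = 2 * min \<beta> (\<alpha> / 2)"
    have "ereal (0 + 1 - \<alpha> + b / 2) \<le> gdof_sym K \<alpha> \<beta>"
      using assms 1 by (intro gdof_sym_ge[OF _ weak_codes[OF K, where \<kappa> = 0 and b = b]]) (auto simp: b_def min_def)
    moreover have "0 + 1 - \<alpha> + b / 2 = min (1 - \<alpha> + \<beta>) (1 - \<alpha> / 2)" by (simp add: b_def min_def)
    ultimately show ?thesis using 1 by simp
  next
    case 2
    \<comment> \<open>\<kappa> = 2 * \<alpha> - 1 is the largest exponent the power condition allows
      for the common digit; then \<kappa> + b <= 1 - \<alpha> reads b <= 2 - 3 * \<alpha>.\<close>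
    define b where "b = 2 * min \<beta> (1 - 3 * \<alpha> / 2)"
    have "ereal ((2 * \<alpha> - 1) + 1 - \<alpha> + b / 2) \<le> gdof_sym K \<alpha> \<beta>"
      using assms 2 by (intro gdof_sym_ge[OF _ weak_codes[OF K, where \<kappa> = "2 * \<alpha> - 1" and b = b]]) (auto simp: b_def min_def)
    moreover have "(2 * \<alpha> - 1) + 1 - \<alpha> + b / 2 = min (\<alpha> + \<beta>) (1 - \<alpha> / 2)" by (simp add: b_def min_def)
    ultimately show ?thesis using 2 by simp
  next
    case 3
    have "ereal (1 - \<alpha> / 2) \<le> gdof_sym K \<alpha> \<beta>"
      using assms 3 by (intro gdof_sym_ge[OF _ weak_unaided_codes[OF K]]) auto
    then show ?thesis using 3 by simp
  next
    case 4
    have "ereal (\<alpha> / 2) \<le> gdof_sym K \<alpha> \<beta>"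
      using assms 4 by (intro gdof_sym_ge[OF _ strong_unaided_codes[OF K]]) auto
    then show ?thesis using 4 by simp
  next
    case 5
    define b where "b = 2 * min \<beta> (\<alpha> / 2 - 1)"
    have "ereal (1 + b / 2) \<le> gdof_sym K \<alpha> \<beta>"
      using assms 5 by (intro gdof_sym_ge[OF _ strong_codes[OF assms(1), where b = b]]) (auto simp: b_def min_def)
    moreover have "1 + b / 2 = min (1 + \<beta>) (\<alpha> / 2)" by (simp add: b_def min_def)
    \<comment> \<open>The boundary \<alpha> = 2 is obtained from the feedback code, since the code
      without feedback needs \<alpha> < 2; both formulas equal 1 there.\<close>
    moreover have "min (1 + \<beta>) (\<alpha> / 2) = \<alpha> / 2" if "\<alpha> = 2" using that assms(4) by simp
    ultimately show ?thesis using 5 by auto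
  qed
qed

end
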